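(* Let $\mathcal H$ be a finite-dimensional Hilbert space and let $(\mathcal F_n)_{n\ge1}$, $\mathcal F_n\subseteq\mathcal D(\mathcal H^{\otimes n})$, satisfy: (1) each $\mathcal F_n$ is convex and closed; (2) $\mathcal F_1$ contains a full-rank state; (3) if $\sigma\in\mathcal F_{n+1}$ then $\mathrm{Tr}_{n+1}\sigma\in\mathcal F_n$; (4) if $\sigma\in\mathcal F_n$, $\sigma'\in\mathcal F_m$ then $\sigma\otimes\sigma'\in\mathcal F_{n+m}$; (5) each $\mathcal F_n$ is invariant under conjugation by the unitaries permuting the $n$ subsystems. Assume moreover that for some numbers $r_n\in(0,1]$ the following compatibility condition holds: for all $n,m\ge1$, every Hermitian operator $X$ on $\mathcal H^{\otimes n}$ with $\|X\|_\infty\le r_n$, every sign $\pm$, and every $\sigma\in\mathcal F_{n+m}$, \[ \mathrm{Tr}_{1\ldots n}\Big[\Big(\tfrac{\mathbb 1^{\otimes n}\pm X}{2}\otimes\mathbb 1^{\otimes m}\Big)\sigma\Big]\in\mathrm{cone}(\mathcal F_m). \] Then for all $\rho\in\mathcal D(\mathcal H)$ and all $\varepsilon\in(0,1)$, \[ \lim_{n\to\infty}\frac1nD_H^\varepsilon(\mathcal F_n\|\rho^{\otimes n})=D(\mathcal F\|\rho):=\min_{\sigma\in\mathcal F_1}D(\sigma\|\rho), \] and in particular $\mathrm{Sanov}(\rho\|\mathcal F)=D(\mathcal F\|\rho)$.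
   Context: $\mathrm{cone}(\mathcal F_m)=\{\lambda\sigma:\lambda\ge0,\ \sigma\in\mathcal F_m\}$; $\mathrm{Tr}_{1\ldots n}$ is the partial trace over the first $n$ subsystems; $\|\cdot\|_\infty$ is the operator norm. $D(\sigma\|\rho)=\mathrm{Tr}\,\sigma(\log\sigma-\log\rho)$ is the Umegaki relative entropy. $D_H^\varepsilon(\sigma\|\rho)=-\log\min\{\mathrm{Tr}M\rho:0\le M\le\mathbb 1,\ \mathrm{Tr}(\mathbb 1-M)\sigma\le\varepsilon\}$, $D_H^\varepsilon(\mathcal F_n\|\omega)=\inf_{\sigma\in\mathcal F_n}D_H^\varepsilon(\sigma\|\omega)$, and $\mathrm{Sanov}(\rho\|\mathcal F)=\lim_{\varepsilon\to0^+}\liminf_{n\to\infty}\frac1nD_H^\varepsilon(\mathcal F_n\|\rho^{\otimes n})$. *)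

theory Defs
  imports "HOL-Library.Extended_Real" "HOL-Library.Liminf_Limsup" "HOL-Combinatorics.Permutations" "Jordan_Normal_Form.Matrix" "Jordan_Normal_Form.DL_Rank"
begin

text \<open>Model: H = C^d. Operators on H^{(x)n} are d^n x d^n complex matrices (JNF type complex mat).
  Basis index x < d^n of H^{(x)n} is read in base d, first subsystem = most significant digit,
  consistent with the Kronecker product below.\<close>

definition adj :: "complex mat \<Rightarrow> complex mat" where
  "adj A = mat (dim_col A) (dim_row A) (\<lambda>(i,j). cnj (A $$ (j,i)))"

definition hermitian :: "nat \<Rightarrow> complex mat \<Rightarrow> bool" where
  "hermitian N A \<longleftrightarrow> A \<in> carrier_mat N N \<and> adj A = A"

definition mtrace :: "complex mat \<Rightarrow> complex" where
  "mtrace A = (\<Sum>i<dim_row A. A $$ (i,i))"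

definition cinner :: "complex vec \<Rightarrow> complex vec \<Rightarrow> complex" where
  "cinner u v = (\<Sum>i<dim_vec v. cnj (u $ i) * v $ i)"

definition vnorm :: "complex vec \<Rightarrow> real" where
  "vnorm v = sqrt (\<Sum>i<dim_vec v. (cmod (v $ i))\<^sup>2)"

definition psd :: "nat \<Rightarrow> complex mat \<Rightarrow> bool" where
  "psd N A \<longleftrightarrow> hermitian N A \<and> (\<forall>v \<in> carrier_vec N. 0 \<le> Re (cinner v (A *\<^sub>v v)))"

definition density :: "nat \<Rightarrow> complex mat set" where
  "density N = {A. psd N A \<and> mtrace A = 1}"

definition full_rank :: "nat \<Rightarrow> complex mat \<Rightarrow> bool" where
  "full_rank N A \<longleftrightarrow> A \<in> carrier_mat N N \<and> vec_space.rank N A = N"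

definition opnorm :: "complex mat \<Rightarrow> real" where
  "opnorm X = Sup {vnorm (X *\<^sub>v v) | v. v \<in> carrier_vec (dim_col X) \<and> vnorm v = 1}"

definition kron :: "complex mat \<Rightarrow> complex mat \<Rightarrow> complex mat" where
  "kron A B = mat (dim_row A * dim_row B) (dim_col A * dim_col B)
     (\<lambda>(i,j). A $$ (i div dim_row B, j div dim_col B) * B $$ (i mod dim_row B, j mod dim_col B))"

fun tpow :: "complex mat \<Rightarrow> nat \<Rightarrow> complex mat" where
  "tpow A 0 = 1\<^sub>m 1"
| "tpow A (Suc n) = kron (tpow A n) A"

definition ptrace_first :: "nat \<Rightarrow> nat \<Rightarrow> complex mat \<Rightarrow> complex mat" where
  "ptrace_first Na Nb S = mat Nb Nb (\<lambda>(k,l). \<Sum>i<Na. S $$ (i * Nb + k, i * Nb + l))"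

definition ptrace_last :: "nat \<Rightarrow> nat \<Rightarrow> complex mat \<Rightarrow> complex mat" where
  "ptrace_last Na Nb S = mat Na Na (\<lambda>(i,j). \<Sum>k<Nb. S $$ (i * Nb + k, j * Nb + k))"

text \<open>k-th tensor factor (k < n, k = 0 the first) of basis index x < d^n\<close>
definition digit :: "nat \<Rightarrow> nat \<Rightarrow> nat \<Rightarrow> nat \<Rightarrow> nat" where
  "digit d n x k = (x div d ^ (n - 1 - k)) mod d"

definition perm_unitary :: "nat \<Rightarrow> nat \<Rightarrow> (nat \<Rightarrow> nat) \<Rightarrow> complex mat" where
  "perm_unitary d n \<pi> = mat (d ^ n) (d ^ n)
     (\<lambda>(y,x). if (\<forall>k<n. digit d n y (\<pi> k) = digit d n x k) then 1 else 0)"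

definition convex_set :: "complex mat set \<Rightarrow> bool" where
  "convex_set F \<longleftrightarrow> (\<forall>A\<in>F. \<forall>B\<in>F. \<forall>t::real. 0 \<le> t \<and> t \<le> 1 \<longrightarrow>
      (complex_of_real t \<cdot>\<^sub>m A + complex_of_real (1 - t) \<cdot>\<^sub>m B) \<in> F)"

text \<open>closedness in the (unique) norm topology on N x N matrices, via entrywise convergence\<close>
definition closed_set :: "nat \<Rightarrow> complex mat set \<Rightarrow> bool" where
  "closed_set N F \<longleftrightarrow> (\<forall>X S. (\<forall>k. X k \<in> F) \<and> S \<in> carrier_mat N N \<and>
      (\<forall>i<N. \<forall>j<N. (\<lambda>k. X k $$ (i,j)) \<longlonglongrightarrow> S $$ (i,j)) \<longrightarrow> S \<in> F)"

definition cone :: "complex mat set \<Rightarrow> complex mat set" where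
  "cone F = {complex_of_real l \<cdot>\<^sub>m S | l S. l \<ge> 0 \<and> S \<in> F}"

definition unitary :: "nat \<Rightarrow> complex mat \<Rightarrow> bool" where
  "unitary N U \<longleftrightarrow> U \<in> carrier_mat N N \<and> adj U * U = 1\<^sub>m N"

definition diag_of :: "nat \<Rightarrow> (nat \<Rightarrow> real) \<Rightarrow> complex mat" where
  "diag_of N l = mat N N (\<lambda>(i,j). if i = j then complex_of_real (l i) else 0)"

text \<open>functional calculus for Hermitian matrices via a spectral decomposition A = U diag(l) U^*
  (the result is independent of the chosen decomposition)\<close>
definition mat_fun :: "nat \<Rightarrow> (real \<Rightarrow> real) \<Rightarrow> complex mat \<Rightarrow> complex mat" where
  "mat_fun N f A = (SOME B. \<exists>U l. unitary N U \<and> A = U * diag_of N l * adj U \<and>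
                              B = U * diag_of N (f \<circ> l) * adj U)"

text \<open>matrix logarithm on the support (ln 0 = 0 in Isabelle, i.e. log taken on the support)\<close>
definition mat_log :: "nat \<Rightarrow> complex mat \<Rightarrow> complex mat" where
  "mat_log N A = mat_fun N ln A"

definition rel_ent :: "nat \<Rightarrow> complex mat \<Rightarrow> complex mat \<Rightarrow> ereal" where
  "rel_ent N \<sigma> \<rho> = (if (\<forall>v\<in>carrier_vec N. \<rho> *\<^sub>v v = 0\<^sub>v N \<longrightarrow> \<sigma> *\<^sub>v v = 0\<^sub>v N)
     then ereal (Re (mtrace (\<sigma> * (mat_log N \<sigma> - mat_log N \<rho>)))) else \<infinity>)"

definition DH :: "nat \<Rightarrow> real \<Rightarrow> complex mat \<Rightarrow> complex mat \<Rightarrow> ereal" where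
  "DH N \<epsilon> \<sigma> \<rho> = (let p = Inf {Re (mtrace (M * \<rho>)) | M. psd N M \<and> psd N (1\<^sub>m N - M) \<and>
                                   Re (mtrace ((1\<^sub>m N - M) * \<sigma>)) \<le> \<epsilon>}
                 in if p = 0 then \<infinity> else ereal (- ln p))"

definition DH_set :: "nat \<Rightarrow> real \<Rightarrow> complex mat set \<Rightarrow> complex mat \<Rightarrow> ereal" where
  "DH_set N \<epsilon> F \<omega> = (INF \<sigma>\<in>F. DH N \<epsilon> \<sigma> \<omega>)"

end

(* Fix a free state sigma on n systems; its test may depend on sigma, so no minimax argument is
   needed.  After symmetrising, consider finitely many one-body observables.  If their two-site
   covariances are small, the empirical means concentrate (Chebyshev), and with A the typical
   projector for -log rho and B the one for -log tau, tau close to the one-body marginal omega, the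
   operator A B A accepts sigma almost surely and has rho-expectation at most
   exp (-n (D (omega || rho) - o(1))), where omega is free.  If some covariance is large, measuring
   that observable weakly on the first system leaves, by the compatibility condition, a free
   symmetric state in either case, and raises the average of a bounded potential (the sum of the
   squared one-body expectations) by a fixed amount; so a bounded number of rounds suffices up to
   small probability.  Compactness of F_1 makes the observables uniform in omega.  The converse
   only uses i.i.d. free states: two typical projectors give a strong converse for every
   epsilon < 1. *)
theory Submission
  imports Defs "Jordan_Normal_Form.Schur_Decomposition" "HOL-Analysis.Function_Topology" "HOL-Analysis.L2_Norm"
begin

section \<open>Matrices, adjoints and the spectral theorem\<close>

text \<open>The obstacle is that convexity and tensor closure make mixtures of i.i.d. free states
  free, so systems may stay strongly correlated for every n and no law of large numbers need hold
  for \<open>\<sigma>\<close> itself. A large covariance is nevertheless useful: by the law of total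
  variance, a measurement on one system separates the conditional means on the others, and the
  averaged square of the mean rises by at least the squared covariance. Observables are scaled down
  so that compatibility applies and both outcomes have probability at least 1/4. With k rounds the
  probability of not having stopped is of order 1/k, with k independent of n; the systems spent are
  paid for by a strict gap between two exponents. Since log rho and log tau need not commute, the
  two typical sets have no joint spectral description; in A B A the compression by A bounds rho, and
  the rank of B only counts. Logarithms are regularised near kernels, so that every observable is
  bounded and infinite relative entropy is covered by the same argument.\<close>

lemma mult_index_sum:
  assumes "A \<in> carrier_mat n m" "B \<in> carrier_mat m k" "i < n" "j < k"
  shows "(A * B) $$ (i,j) = (\<Sum>l<m. A $$ (i,l) * B $$ (l,j))"
  using assms by (auto simp: scalar_prod_def lessThan_atLeast0 intro!: sum.cong)

lemma mult_vec_index_sum: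
  assumes "A \<in> carrier_mat n m" "v \<in> carrier_vec m" "i < n"
  shows "(A *\<^sub>v v) $ i = (\<Sum>l<m. A $$ (i,l) * v $ l)"
  using assms by (auto simp: scalar_prod_def lessThan_atLeast0 intro!: sum.cong)

lemma adj_carrier [simp]: "A \<in> carrier_mat n m \<Longrightarrow> adj A \<in> carrier_mat m n"
  by (auto simp: adj_def)

lemma adj_index [simp]: "i < dim_col A \<Longrightarrow> j < dim_row A \<Longrightarrow> adj A $$ (i,j) = cnj (A $$ (j,i))"
  by (simp add: adj_def)

lemma adj_dims [simp]: "dim_row (adj A) = dim_col A" "dim_col (adj A) = dim_row A"
  by (auto simp: adj_def)

lemma adj_adj [simp]: "adj (adj A) = A"
  by (rule eq_matI) auto

lemma adj_mult:
  assumes "A \<in> carrier_mat n m" "B \<in> carrier_mat m k"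
  shows "adj (A * B) = adj B * adj A"
proof (rule eq_matI)
  fix i j assume "i < dim_row (adj B * adj A)" "j < dim_col (adj B * adj A)"
  then have ij: "i < k" "j < n" using assms by auto
  have "adj (A * B) $$ (i,j) = cnj ((A * B) $$ (j,i))" using ij assms by auto
  also have "\<dots> = (\<Sum>l<m. adj B $$ (i,l) * adj A $$ (l,j))"
    using ij assms by (subst mult_index_sum[OF assms ij(2) ij(1)]) (auto intro!: sum.cong)
  also have "\<dots> = (adj B * adj A) $$ (i,j)"
    by (rule mult_index_sum[OF adj_carrier[OF assms(2)] adj_carrier[OF assms(1)] ij, symmetric])
  finally show "adj (A * B) $$ (i,j) = (adj B * adj A) $$ (i,j)" .
qed (use assms in auto)

text \<open>Side conditions on dimensions are computed by simplification, whereas carrier conditions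
  would leave the inner dimensions to be guessed. With \<open>adj_mult_dim\<close> this yields a
  normal form for long products.\<close>

lemma mat_assoc:
  fixes A :: "complex mat"
  assumes "dim_col A = dim_row B" "dim_col B = dim_row C"
  shows "A * B * C = A * (B * C)"
proof -
  have "A \<in> carrier_mat (dim_row A) (dim_row B)" "B \<in> carrier_mat (dim_row B) (dim_row C)"
    "C \<in> carrier_mat (dim_row C) (dim_col C)"
    using assms by (intro carrier_matI; simp)+
  then show ?thesis by (rule assoc_mult_mat)
qed

lemma adj_mult_dim:
  assumes "dim_col A = dim_row B"
  shows "adj (A * B) = adj B * adj A"
proof -
  have "A \<in> carrier_mat (dim_row A) (dim_row B)" "B \<in> carrier_mat (dim_row B) (dim_col B)"
    using assms by (intro carrier_matI; simp)+
  then show ?thesis by (rule adj_mult)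
qed

lemmas mat_norm = mat_assoc adj_mult_dim

lemma adj_add: "A \<in> carrier_mat n m \<Longrightarrow> B \<in> carrier_mat n m \<Longrightarrow> adj (A + B) = adj A + adj B"
  by (rule eq_matI) auto

lemma adj_minus: "A \<in> carrier_mat n m \<Longrightarrow> B \<in> carrier_mat n m \<Longrightarrow> adj (A - B) = adj A - adj B"
  by (rule eq_matI) auto

lemma adj_smult: "adj (c \<cdot>\<^sub>m A) = cnj c \<cdot>\<^sub>m adj A"
  by (rule eq_matI) auto

lemma adj_one [simp]: "adj (1\<^sub>m n) = 1\<^sub>m n"
  by (rule eq_matI) auto

lemma diag_of_carrier [simp]: "diag_of N l \<in> carrier_mat N N"
  by (simp add: diag_of_def)

lemma diag_of_dims [simp]: "dim_row (diag_of N l) = N" "dim_col (diag_of N l) = N"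
  by (simp_all add: diag_of_def)

lemma diag_of_index [simp]:
  "i < N \<Longrightarrow> j < N \<Longrightarrow> diag_of N l $$ (i,j) = (if i = j then complex_of_real (l i) else 0)"
  by (simp add: diag_of_def)

lemma adj_diag_of [simp]: "adj (diag_of N l) = diag_of N l"
  by (rule eq_matI) auto

lemma diag_of_mult: "diag_of N f * diag_of N g = diag_of N (\<lambda>i. f i * g i)"
proof (rule eq_matI)
  fix i j assume "i < dim_row (diag_of N (\<lambda>i. f i * g i))" "j < dim_col (diag_of N (\<lambda>i. f i * g i))"
  then have ij: "i < N" "j < N" by auto
  have "(diag_of N f * diag_of N g) $$ (i,j) = (\<Sum>l<N. diag_of N f $$ (i,l) * diag_of N g $$ (l,j))"
    by (rule mult_index_sum[OF diag_of_carrier diag_of_carrier ij])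
  also have "\<dots> = (\<Sum>l<N. if l = i then (if i = j then complex_of_real (f i * g i) else 0) else 0)"
    using ij by (intro sum.cong) auto
  finally show "(diag_of N f * diag_of N g) $$ (i,j) = diag_of N (\<lambda>i. f i * g i) $$ (i,j)"
    using ij by simp
qed auto

lemma diag_of_one: "diag_of N (\<lambda>_. 1) = 1\<^sub>m N"
  by (rule eq_matI) auto

lemma mtrace_comm:
  assumes "A \<in> carrier_mat n m" "B \<in> carrier_mat m n"
  shows "mtrace (A * B) = mtrace (B * A)"
proof -
  have "mtrace (A * B) = (\<Sum>i<n. \<Sum>l<m. A $$ (i,l) * B $$ (l,i))"
    using assms by (auto simp: mtrace_def mult_index_sum[OF assms] intro!: sum.cong simp del: index_mult_mat(1))
  also have "\<dots> = (\<Sum>l<m. \<Sum>i<n. B $$ (l,i) * A $$ (i,l))"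
    by (subst sum.swap) (simp add: mult.commute)
  also have "\<dots> = mtrace (B * A)"
    using assms by (auto simp: mtrace_def mult_index_sum[OF assms(2,1)] intro!: sum.cong simp del: index_mult_mat(1))
  finally show ?thesis .
qed

lemma mtrace_add: "A \<in> carrier_mat n n \<Longrightarrow> B \<in> carrier_mat n n \<Longrightarrow> mtrace (A + B) = mtrace A + mtrace B"
  by (auto simp: mtrace_def sum.distrib)

lemma mtrace_minus: "A \<in> carrier_mat n n \<Longrightarrow> B \<in> carrier_mat n n \<Longrightarrow> mtrace (A - B) = mtrace A - mtrace B"
  by (auto simp: mtrace_def sum_subtractf)

lemma mtrace_smult: "A \<in> carrier_mat n n \<Longrightarrow> mtrace (c \<cdot>\<^sub>m A) = c * mtrace A"
  by (auto simp: mtrace_def sum_distrib_left)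

lemma mtrace_adj: "A \<in> carrier_mat n n \<Longrightarrow> mtrace (adj A) = cnj (mtrace A)"
  by (auto simp: mtrace_def)

lemma cinner_adj:
  assumes "A \<in> carrier_mat n m" "u \<in> carrier_vec m" "w \<in> carrier_vec n"
  shows "cinner u (adj A *\<^sub>v w) = cinner (A *\<^sub>v u) w"
proof -
  have "cinner u (adj A *\<^sub>v w) = (\<Sum>i<m. \<Sum>l<n. cnj (u $ i) * (cnj (A $$ (l,i)) * w $ l))"
    using assms
    by (auto simp: cinner_def mult_vec_index_sum[of _ m n] sum_distrib_left intro!: sum.cong simp del: index_mult_mat_vec)
  also have "\<dots> = (\<Sum>l<n. \<Sum>i<m. cnj (A $$ (l,i) * u $ i) * w $ l)"
    by (subst sum.swap) (auto intro!: sum.cong)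
  also have "\<dots> = cinner (A *\<^sub>v u) w"
    using assms
    by (auto simp: cinner_def mult_vec_index_sum[of _ n m] sum_distrib_right intro!: sum.cong simp del: index_mult_mat_vec)
  finally show ?thesis .
qed

lemma cinner_self: "cinner v v = complex_of_real ((vnorm v)\<^sup>2)"
  by (simp add: cinner_def vnorm_def sum_nonneg mult.commute complex_norm_square del: of_real_power)

lemma unitary_carrier: "unitary N U \<Longrightarrow> U \<in> carrier_mat N N"
  by (simp add: unitary_def)

lemma unitary_left: "unitary N U \<Longrightarrow> adj U * U = 1\<^sub>m N"
  by (simp add: unitary_def)

lemma unitary_right: "unitary N U \<Longrightarrow> U * adj U = 1\<^sub>m N"
  unfolding unitary_def using mat_mult_left_right_inverse[of "adj U" N U] by auto

lemma unitary_mult: assumes "unitary N U" "unitary N V" shows "unitary N (U * V)"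
proof -
  note c = unitary_carrier[OF assms(1)] unitary_carrier[OF assms(2)]
  have "adj (U * V) * (U * V) = adj V * (adj U * U) * V"
    using c by (auto simp: mat_norm)
  then show ?thesis using c assms by (simp add: unitary_def)
qed

lemma hermitian_carrier: "hermitian N A \<Longrightarrow> A \<in> carrier_mat N N"
  by (simp add: hermitian_def)

section \<open>Positive semidefinite matrices\<close>

lemma psd_hermitian: "psd N A \<Longrightarrow> hermitian N A" by (simp add: psd_def)

lemma psd_carrier: "psd N A \<Longrightarrow> A \<in> carrier_mat N N"
  by (simp add: psd_def hermitian_def)

lemma hermitian_conj:
  assumes "hermitian N A" "Z \<in> carrier_mat N m"
  shows "hermitian m (adj Z * A * Z)"
  using assms by (auto simp: hermitian_def mat_norm)

lemma psd_conj:
  assumes "psd N A" "Z \<in> carrier_mat N m"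
  shows "psd m (adj Z * A * Z)"
  unfolding psd_def
proof (intro conjI ballI)
  note A = psd_carrier[OF assms(1)]
  show "hermitian m (adj Z * A * Z)" using hermitian_conj psd_hermitian assms by blast
  fix v :: "complex vec" assume v: "v \<in> carrier_vec m"
  have "(adj Z * A * Z) *\<^sub>v v = (adj Z * A) *\<^sub>v (Z *\<^sub>v v)"
    by (rule assoc_mult_mat_vec) (use A assms(2) v in auto)
  also have "\<dots> = adj Z *\<^sub>v (A *\<^sub>v (Z *\<^sub>v v))"
    by (rule assoc_mult_mat_vec) (use A assms(2) v in auto)
  finally have "(adj Z * A * Z) *\<^sub>v v = adj Z *\<^sub>v (A *\<^sub>v (Z *\<^sub>v v))" .
  then have "cinner v ((adj Z * A * Z) *\<^sub>v v) = cinner (Z *\<^sub>v v) (A *\<^sub>v (Z *\<^sub>v v))"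
    using cinner_adj[OF assms(2) v, of "A *\<^sub>v (Z *\<^sub>v v)"] A assms(2) v by simp
  then show "0 \<le> Re (cinner v (adj Z * A * Z *\<^sub>v v))"
    using assms A v by (auto simp: psd_def)
qed

lemma psd_one: "psd N (1\<^sub>m N)"
  by (auto simp: psd_def hermitian_def cinner_self)

lemma psd_gram:
  assumes "W \<in> carrier_mat m N"
  shows "psd N (adj W * W)"
  using psd_conj[OF psd_one assms] assms by simp

lemma psd_diag_nonneg:
  assumes "psd N A" "i < N"
  shows "0 \<le> Re (A $$ (i,i))"
proof -
  have "cinner (unit_vec N i) (A *\<^sub>v unit_vec N i) = (\<Sum>j<N. if j = i then A $$ (i,i) else 0)"
    unfolding cinner_def using psd_carrier[OF assms(1)] assms(2)
    by (intro sum.cong) (auto simp: scalar_prod_right_unit[of _ N])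
  then have "cinner (unit_vec N i) (A *\<^sub>v unit_vec N i) = A $$ (i,i)" using assms(2) by simp
  then show ?thesis using assms by (auto simp: psd_def dest!: bspec[of _ _ "unit_vec N i"])
qed

lemma psd_trace_nonneg: "psd N A \<Longrightarrow> 0 \<le> Re (mtrace A)"
  using psd_diag_nonneg[of N A] psd_carrier[of N A] by (auto simp: mtrace_def intro!: sum_nonneg)

lemma mult_vec_add: assumes "A \<in> carrier_mat N N" "B \<in> carrier_mat N N" "v \<in> carrier_vec N"
  shows "cinner v ((A + B) *\<^sub>v v) = cinner v (A *\<^sub>v v) + cinner v (B *\<^sub>v v)"
  using assms by (auto simp: cinner_def add_mult_distrib_mat_vec[of _ N N] sum.distrib algebra_simps)

lemma mult_vec_smult: assumes "A \<in> carrier_mat N N" "v \<in> carrier_vec N"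
  shows "cinner v ((c \<cdot>\<^sub>m A) *\<^sub>v v) = c * cinner v (A *\<^sub>v v)"
  using assms by (auto simp: cinner_def sum_distrib_left intro!: sum.cong)

lemma psd_add: "psd N A \<Longrightarrow> psd N B \<Longrightarrow> psd N (A + B)"
  by (auto simp: psd_def hermitian_def adj_add[of _ N N] mult_vec_add[of _ N])

lemma psd_smult: "psd N A \<Longrightarrow> 0 \<le> c \<Longrightarrow> psd N (complex_of_real c \<cdot>\<^sub>m A)"
  by (auto simp: psd_def hermitian_def adj_smult mult_vec_smult)

lemma psd_diag_of: "(\<And>i. i < N \<Longrightarrow> 0 \<le> f i) \<Longrightarrow> psd N (diag_of N f)"
proof -
  assume f: "\<And>i. i < N \<Longrightarrow> 0 \<le> f i"
  have "diag_of N f = adj (diag_of N (\<lambda>i. sqrt (f i))) * diag_of N (\<lambda>i. sqrt (f i))"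
    by (rule eq_matI) (auto simp: diag_of_mult f)
  then show ?thesis using psd_gram[of "diag_of N (\<lambda>i. sqrt (f i))" N N] by simp
qed

lemma mtrace_unitary_conj:
  assumes "A \<in> carrier_mat N N" "unitary N U"
  shows "mtrace (U * A * adj U) = mtrace A"
proof -
  note U = unitary_carrier[OF assms(2)]
  have "mtrace (U * A * adj U) = mtrace (adj U * (U * A))"
    using U assms(1) by (intro mtrace_comm[of _ N N]) auto
  also have "adj U * (U * A) = (adj U * U) * A"
    using U assms(1) by (auto simp: mat_norm)
  finally show ?thesis using assms unitary_left[OF assms(2)] by simp
qed

text \<open>Complete \<open>v\<close> to a basis, orthogonalise starting from \<open>v\<close>, and
  normalise the columns; \<open>c\<close> is then the reciprocal of \<open>vnorm v\<close>. This is
  the change of basis for one deflation step.\<close>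

lemma unitary_first_column:
  assumes v: "v \<in> carrier_vec (Suc n)" and v0: "v \<noteq> (0\<^sub>v (Suc n) :: complex vec)"
  shows "\<exists>W c. unitary (Suc n) W \<and> (\<forall>i<Suc n. W $$ (i,0) = c * v $ i)"
proof -
  let ?N = "Suc n"
  interpret cof_vec_space ?N "TYPE(complex)" .
  define b where "b = basis_completion v"
  define ws where "ws = gram_schmidt ?N b"
  note bc = basis_completion[OF v v0, folded b_def]
  have ws: "set ws \<subseteq> carrier_vec ?N" "corthogonal ws" "length ws = ?N"
    using gram_schmidt_result[OF bc(2) bc(4) bc(5) ws_def] bc(6) by auto
  have hd: "ws ! 0 = v"
  proof -
    have "hd ws = v" using gram_schmidt_hd[OF v, of "tl b"] bc(6,7) unfolding ws_def by (cases b) auto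
    then show ?thesis using ws(3) by (cases ws) auto
  qed
  have nz: "vnorm (ws ! i) \<noteq> 0" and orth: "i \<noteq> j \<Longrightarrow> j < ?N \<Longrightarrow> cinner (ws ! i) (ws ! j) = 0"
    if i: "i < ?N" for i j
  proof -
    \<comment> \<open>The two inner products conjugate opposite arguments, hence the swap.\<close>
    have conj: "cinner u w = w \<bullet>c u" if "u \<in> carrier_vec ?N" "w \<in> carrier_vec ?N" for u w
      using that by (auto simp: cinner_def scalar_prod_def lessThan_atLeast0 mult.commute intro!: sum.cong)
    have c: "ws ! k \<in> carrier_vec ?N" if "k < ?N" for k using ws that by auto
    have "ws ! i \<bullet>c ws ! i \<noteq> 0" using corthogonalD[OF ws(2), of i i] i ws(3) by auto
    then show "vnorm (ws ! i) \<noteq> 0" using conj[OF c[OF i] c[OF i]] cinner_self[of "ws ! i"] by auto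
    show "i \<noteq> j \<Longrightarrow> j < ?N \<Longrightarrow> cinner (ws ! i) (ws ! j) = 0"
      using corthogonalD[OF ws(2), of j i] i ws(3) conj[OF c[OF i] c[of j]] by auto
  qed
  define W where "W = mat ?N ?N (\<lambda>(i,j). ws ! j $ i / complex_of_real (vnorm (ws ! j)))"
  have W: "W \<in> carrier_mat ?N ?N" by (simp add: W_def)
  have "adj W * W = 1\<^sub>m ?N"
  proof (rule eq_matI)
    fix i j assume "i < dim_row (1\<^sub>m ?N :: complex mat)" "j < dim_col (1\<^sub>m ?N :: complex mat)"
    then have ij: "i < ?N" "j < ?N" by auto
    have cj: "dim_vec (ws ! j) = ?N" using ws ij(2) by (metis carrier_vecD nth_mem subsetD)
    have "(adj W * W) $$ (i,j) = (\<Sum>l<?N. adj W $$ (i,l) * W $$ (l,j))"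
      by (rule mult_index_sum[OF adj_carrier[OF W] W ij])
    also have "\<dots> = cinner (ws ! i) (ws ! j) / (complex_of_real (vnorm (ws ! i)) * complex_of_real (vnorm (ws ! j)))"
      using ij cj W unfolding cinner_def sum_divide_distrib
      by (intro sum.cong) (auto simp: W_def)
    also have "\<dots> = 1\<^sub>m ?N $$ (i,j)"
      using orth[OF ij(1), of j] nz[OF ij(1)] ij by (cases "i = j") (auto simp: cinner_self power2_eq_square)
    finally show "(adj W * W) $$ (i,j) = 1\<^sub>m ?N $$ (i,j)" .
  qed (use W in auto)
  then have "unitary ?N W" using W by (simp add: unitary_def)
  moreover have "\<forall>i<?N. W $$ (i,0) = (1 / complex_of_real (vnorm v)) * v $ i"
    by (auto simp: W_def hd)
  ultimately show ?thesis by blast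
qed

text \<open>Since \<open>B\<close> is Hermitian, a first column vanishing below the corner forces
  the first row to vanish as well, so \<open>B\<close> splits into a real 1 by 1 block and a
  Hermitian block \<open>C\<close>. A diagonalisation \<open>U\<close> of \<open>C\<close> extends
  to \<open>V\<close>, the direct sum of 1 and \<open>U\<close>.\<close>

lemma hermitian_deflate:
  assumes B: "hermitian (Suc n) B" and z: "\<And>i. i < Suc n \<Longrightarrow> i \<noteq> 0 \<Longrightarrow> B $$ (i,0) = 0"
    and IH: "\<And>A. hermitian n A \<Longrightarrow> \<exists>U l. unitary n U \<and> A = U * diag_of n l * adj U"
  shows "\<exists>U l. unitary (Suc n) U \<and> B = U * diag_of (Suc n) l * adj U"
proof -
  have Bc: "B \<in> carrier_mat (Suc n) (Suc n)" using B by (simp add: hermitian_def)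
  have sym: "B $$ (i,j) = cnj (B $$ (j,i))" if "i < Suc n" "j < Suc n" for i j
  proof -
    have "adj B $$ (i,j) = cnj (B $$ (j,i))" using that Bc by auto
    then show ?thesis using B by (simp add: hermitian_def)
  qed
  define C where "C = mat n n (\<lambda>(i,j). B $$ (Suc i, Suc j))"
  have C: "hermitian n C"
    unfolding hermitian_def C_def by (auto intro!: eq_matI simp: sym[symmetric])
  obtain U l where U: "unitary n U" and CU: "C = U * diag_of n l * adj U" using IH[OF C] by auto
  note Uc = unitary_carrier[OF U]
  define V where "V = mat (Suc n) (Suc n) (\<lambda>(i,j). if i = 0 \<or> j = 0 then (if i = j then 1 else 0) else U $$ (i - 1, j - 1))"
  define k where "k = (\<lambda>i. if i = 0 then Re (B $$ (0,0)) else l (i - 1))"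
  have V: "V \<in> carrier_mat (Suc n) (Suc n)" by (simp add: V_def)
  have uV: "adj V * V = 1\<^sub>m (Suc n)"
  proof (rule eq_matI)
    fix i j assume "i < dim_row (1\<^sub>m (Suc n) :: complex mat)" "j < dim_col (1\<^sub>m (Suc n) :: complex mat)"
    then have ij: "i < Suc n" "j < Suc n" by auto
    have *: "(adj V * V) $$ (i,j) = (\<Sum>l<Suc n. adj V $$ (i,l) * V $$ (l,j))"
      by (rule mult_index_sum[OF adj_carrier[OF V] V ij])
    have U1: "(\<Sum>l<n. cnj (U $$ (l, i - 1)) * U $$ (l, j - 1)) = 1\<^sub>m n $$ (i - 1, j - 1)" if "i \<noteq> 0" "j \<noteq> 0"
    proof -
      have "(adj U * U) $$ (i - 1, j - 1) = (\<Sum>l<n. adj U $$ (i - 1,l) * U $$ (l,j - 1))"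
        using that ij by (intro mult_index_sum[OF adj_carrier[OF Uc] Uc]) auto
      then show ?thesis using that ij Uc unitary_left[OF U] by auto
    qed
    show "(adj V * V) $$ (i,j) = 1\<^sub>m (Suc n) $$ (i,j)"
      unfolding * sum.lessThan_Suc_shift using ij V U1
      by (cases "i = 0"; cases "j = 0") (auto simp: V_def)
  qed (use V in auto)
  have "B = V * diag_of (Suc n) k * adj V"
  proof (rule eq_matI)
    fix i j assume "i < dim_row (V * diag_of (Suc n) k * adj V)" "j < dim_col (V * diag_of (Suc n) k * adj V)"
    then have ij: "i < Suc n" "j < Suc n" using V by auto
    have vd: "(V * diag_of (Suc n) k) $$ (i,q) = V $$ (i,q) * complex_of_real (k q)" if "q < Suc n" for q
      using mult_index_sum[OF V diag_of_carrier ij(1) that, of k] that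
      by (simp add: if_distrib[of "\<lambda>x. _ * x"] cong: if_cong)
    have ud: "(U * diag_of n l) $$ (p,q) = U $$ (p,q) * complex_of_real (l q)" if "p < n" "q < n" for p q
      using mult_index_sum[OF Uc diag_of_carrier that, of l] that
      by (simp add: if_distrib[of "\<lambda>x. _ * x"] cong: if_cong)
    have "(V * diag_of (Suc n) k * adj V) $$ (i,j) = (\<Sum>q<Suc n. (V * diag_of (Suc n) k) $$ (i,q) * adj V $$ (q,j))"
      by (rule mult_index_sum[OF _ adj_carrier[OF V] ij]) (use V in auto)
    also have "\<dots> = (\<Sum>q<Suc n. V $$ (i,q) * complex_of_real (k q) * cnj (V $$ (j,q)))"
      using V ij by (intro sum.cong) (auto simp: vd simp del: index_mult_mat(1))
    finally have *: "(V * diag_of (Suc n) k * adj V) $$ (i,j) = (\<Sum>q<Suc n. V $$ (i,q) * complex_of_real (k q) * cnj (V $$ (j,q)))" .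
    have **: "(\<Sum>q<n. U $$ (i - 1,q) * complex_of_real (l q) * cnj (U $$ (j - 1,q))) = B $$ (i,j)"
      if "i \<noteq> 0" "j \<noteq> 0"
    proof -
      have a: "i - 1 < n" "j - 1 < n" using that ij by auto
      have "C $$ (i - 1, j - 1) = (\<Sum>q<n. (U * diag_of n l) $$ (i - 1,q) * adj U $$ (q,j - 1))"
        unfolding CU by (rule mult_index_sum[OF _ adj_carrier[OF Uc] a]) (use Uc in auto)
      also have "\<dots> = (\<Sum>q<n. U $$ (i - 1,q) * complex_of_real (l q) * cnj (U $$ (j - 1,q)))"
        using Uc a by (intro sum.cong) (auto simp: ud simp del: index_mult_mat(1))
      finally show ?thesis using that ij by (auto simp: C_def)
    qed
    have B00: "complex_of_real (Re (B $$ (0,0))) = B $$ (0,0)"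
      using sym[of 0 0] by (simp add: complex_eq_iff)
    have Bz: "B $$ (0,q) = 0" if "q < Suc n" "q \<noteq> 0" for q using sym[of 0 q] z[of q] that by simp
    show "B $$ (i,j) = (V * diag_of (Suc n) k * adj V) $$ (i,j)"
      unfolding * sum.lessThan_Suc_shift using ij ** z[of i] Bz[of j]
      by (cases "i = 0"; cases "j = 0") (auto simp: V_def k_def B00)
  qed (use V Bc in auto)
  then show ?thesis using V uV by (auto simp: unitary_def)
qed

text \<open>A complex root of the characteristic polynomial gives an eigenvector; a unitary having
  it as first column turns the first column of the conjugated matrix into a multiple of the first
  unit vector, and deflation reduces the size.\<close>

theorem hermitian_spectral:
  "hermitian N A \<Longrightarrow> \<exists>U l. unitary N U \<and> A = U * diag_of N l * adj U"
proof (induction N arbitrary: A)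
  case 0
  then have "A = 1\<^sub>m 0 * diag_of 0 (\<lambda>_. 0) * adj (1\<^sub>m 0)" "unitary 0 (1\<^sub>m 0)"
    by (auto simp: hermitian_def unitary_def intro!: eq_matI)
  then show ?case by blast
next
  case (Suc n)
  note Ac = hermitian_carrier[OF Suc.prems]
  obtain e where "eigenvalue A e"
  proof -
    have "degree (char_poly A) = Suc n" using degree_monic_char_poly[OF Ac] by simp
    then have "\<exists>e. poly (char_poly A) e = 0"
      by (intro fundamental_theorem_of_algebra_alt) (auto elim!: degree_eq_zeroE)
    then show ?thesis using that eigenvalue_root_char_poly[OF Ac] by blast
  qed
  then obtain v where v: "v \<in> carrier_vec (Suc n)" "v \<noteq> 0\<^sub>v (Suc n)" and Av: "A *\<^sub>v v = e \<cdot>\<^sub>v v"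
    using Ac by (auto simp: eigenvalue_def eigenvector_def)
  obtain W c where W: "unitary (Suc n) W" and W0: "\<And>i. i < Suc n \<Longrightarrow> W $$ (i,0) = c * v $ i"
    using unitary_first_column[OF v] by blast
  note Wc = unitary_carrier[OF W]
  define B where "B = adj W * A * W"
  have Bh: "hermitian (Suc n) B" unfolding B_def by (rule hermitian_conj[OF Suc.prems Wc])
  have "B $$ (i,0) = 0" if i: "i < Suc n" "i \<noteq> 0" for i
  proof -
    have AW: "(A * W) $$ (q,0) = e * W $$ (q,0)" if q: "q < Suc n" for q
    proof -
      have "(A * W) $$ (q,0) = c * (A *\<^sub>v v) $ q"
        using mult_index_sum[OF Ac Wc q, of 0] mult_vec_index_sum[OF Ac v(1) q]
        by (simp add: W0 sum_distrib_left distrib_left mult.left_commute del: index_mult_mat_vec)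
      then show ?thesis unfolding Av using q v(1) by (simp add: W0)
    qed
    have "B $$ (i,0) = (\<Sum>q<Suc n. adj W $$ (i,q) * (A * W) $$ (q,0))"
      unfolding B_def assoc_mult_mat[OF adj_carrier[OF Wc] Ac Wc]
      by (rule mult_index_sum[OF adj_carrier[OF Wc] _ i(1)]) (use Ac Wc in auto)
    also have "\<dots> = e * (\<Sum>q<Suc n. adj W $$ (i,q) * W $$ (q,0))"
      unfolding sum_distrib_left by (intro sum.cong) (auto simp: AW)
    also have "(\<Sum>q<Suc n. adj W $$ (i,q) * W $$ (q,0)) = (adj W * W) $$ (i,0)"
      by (rule mult_index_sum[OF adj_carrier[OF Wc] Wc i(1), symmetric]) simp
    finally show ?thesis using unitary_left[OF W] i by simp
  qed
  from hermitian_deflate[OF Bh this Suc.IH] obtain V l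
    where V: "unitary (Suc n) V" and BV: "B = V * diag_of (Suc n) l * adj V" by auto
  note Vc = unitary_carrier[OF V]
  have "W * B * adj W = (W * adj W) * A * (W * adj W)"
    unfolding B_def using Wc Ac by (auto simp: mat_norm)
  then have "A = W * B * adj W" using unitary_right[OF W] Ac by simp
  also have "\<dots> = (W * V) * diag_of (Suc n) l * adj (W * V)"
    unfolding BV using Wc Vc
    by (auto simp: mat_norm)
  finally show ?case using unitary_mult[OF W V] by blast
qed

lemma unitary_conj_cancel:
  assumes "unitary N U" "D \<in> carrier_mat N N"
  shows "adj U * (U * D * adj U) * U = D"
proof -
  note U = unitary_carrier[OF assms(1)]
  have "adj U * (U * D * adj U) * U = (adj U * U) * D * (adj U * U)"
    using U assms(2) by (auto simp: mat_norm)
  then show ?thesis using unitary_left[OF assms(1)] assms(2) by simp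
qed

lemma psd_eigenvalue_nonneg:
  assumes "psd N (U * diag_of N l * adj U)" "unitary N U" "i < N"
  shows "0 \<le> l i"
  using psd_diag_nonneg[OF psd_conj[OF assms(1) unitary_carrier[OF assms(2)]] assms(3)] assms(3)
  by (simp add: unitary_conj_cancel[OF assms(2)])

text \<open>\<open>W\<close> is the root of the eigenvalues times \<open>adj U\<close>. The Gram
  form is how positivity is used later: for traces of products, tensor products, bounds on entries,
  and kernels.\<close>

lemma psd_gram_ex:
  assumes "psd N A"
  obtains W where "W \<in> carrier_mat N N" "A = adj W * W"
proof -
  obtain U l where U: "unitary N U" and A: "A = U * diag_of N l * adj U"
    using hermitian_spectral[OF psd_hermitian[OF assms]] by blast
  note Uc = unitary_carrier[OF U]
  define S where "S = diag_of N (\<lambda>i. sqrt (l i))"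
  have S: "S \<in> carrier_mat N N" "adj S = S" by (auto simp: S_def)
  have "S * S = diag_of N l" unfolding S_def diag_of_mult
    using psd_eigenvalue_nonneg[OF _ U] assms A by (intro eq_matI) auto
  then have "adj (S * adj U) * (S * adj U) = A"
    unfolding A using Uc S by (auto simp: mat_norm simp flip: \<open>S * S = _\<close>)
  then show ?thesis using that[of "S * adj U"] S Uc by auto
qed

text \<open>By cyclicity this is the trace of \<open>W * B * adj W\<close>, which is positive
  although \<open>A * B\<close> need not even be Hermitian.\<close>

lemma mtrace_psd_mult_nonneg:
  assumes "psd N A" "psd N B"
  shows "0 \<le> Re (mtrace (A * B))"
proof -
  obtain W where W: "W \<in> carrier_mat N N" "A = adj W * W" using psd_gram_ex[OF assms(1)] .
  note B = psd_carrier[OF assms(2)]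
  have "mtrace (A * B) = mtrace (adj W * (W * B))" using W B by (auto simp: mat_norm)
  also have "\<dots> = mtrace (W * B * adj W)" using W B by (intro mtrace_comm[of _ N N]) auto
  finally show ?thesis using psd_trace_nonneg[OF psd_conj[OF assms(2), of "adj W" N]] W by simp
qed

section \<open>Tensor products\<close>

lemma sum_mult_index:
  fixes f :: "nat \<Rightarrow> 'a::comm_monoid_add"
  shows "(\<Sum>x<m * q. f x) = (\<Sum>a<m. \<Sum>b<q. f (a * q + b))"
proof -
  have "(\<Sum>x<m * q. f x) = (\<Sum>a<m. sum f {a * q..<a * q + q})"
    by (rule sum.nat_group[symmetric])
  also have "\<dots> = (\<Sum>a<m. \<Sum>b<q. f (a * q + b))"
  proof (rule sum.cong[OF refl])
    fix a
    show "sum f {a * q..<a * q + q} = (\<Sum>b<q. f (a * q + b))"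
      by (rule sum.reindex_bij_witness[of _ "\<lambda>b. a * q + b" "\<lambda>x. x - a * q"]) auto
  qed
  finally show ?thesis .
qed

lemma index_mult_less: "(a::nat) < m \<Longrightarrow> b < q \<Longrightarrow> a * q + b < m * q"
proof -
  assume "a < m" "b < q"
  then have "a * q + b < Suc a * q" by simp
  also have "\<dots> \<le> m * q" using \<open>a < m\<close> by (intro mult_le_mono1) simp
  finally show ?thesis .
qed

lemma index_div_mod: "i < n * p \<Longrightarrow> i div p < n \<and> i mod p < (p::nat)"
  by (metis less_mult_imp_div_less mod_less_divisor mult_0_right not_less_zero gr0I)

lemma kron_carrier [simp]:
  "A \<in> carrier_mat n m \<Longrightarrow> B \<in> carrier_mat p q \<Longrightarrow> kron A B \<in> carrier_mat (n * p) (m * q)"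
  by (auto simp: kron_def)

lemma kron_dims [simp]:
  "dim_row (kron A B) = dim_row A * dim_row B" "dim_col (kron A B) = dim_col A * dim_col B"
  by (auto simp: kron_def)

lemma kron_index:
  "i < dim_row A * dim_row B \<Longrightarrow> j < dim_col A * dim_col B \<Longrightarrow>
   kron A B $$ (i,j) = A $$ (i div dim_row B, j div dim_col B) * B $$ (i mod dim_row B, j mod dim_col B)"
  by (simp add: kron_def)

lemma kron_mult:
  assumes "A \<in> carrier_mat n m" "C \<in> carrier_mat m k" "B \<in> carrier_mat p q" "D \<in> carrier_mat q r"
  shows "kron A B * kron C D = kron (A * C) (B * D)"
proof (rule eq_matI)
  fix i j assume "i < dim_row (kron (A * C) (B * D))" "j < dim_col (kron (A * C) (B * D))"
  then have ij: "i < n * p" "j < k * r" using assms by auto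
  note i = index_div_mod[OF ij(1)] and j = index_div_mod[OF ij(2)]
  have "(kron A B * kron C D) $$ (i,j) = (\<Sum>l<m * q. kron A B $$ (i,l) * kron C D $$ (l,j))"
    by (rule mult_index_sum[OF _ _ ij]) (use assms in auto)
  also have "\<dots> = (\<Sum>a<m. \<Sum>b<q. (A $$ (i div p, a) * C $$ (a, j div r)) * (B $$ (i mod p, b) * D $$ (b, j mod r)))"
    unfolding sum_mult_index
    by (intro sum.cong refl) (use assms ij in \<open>auto simp: kron_index index_mult_less\<close>)
  also have "\<dots> = (\<Sum>a<m. A $$ (i div p, a) * C $$ (a, j div r)) * (\<Sum>b<q. B $$ (i mod p, b) * D $$ (b, j mod r))"
    by (simp add: sum_product)
  also have "\<dots> = (A * C) $$ (i div p, j div r) * (B * D) $$ (i mod p, j mod r)"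
    using i j mult_index_sum[OF assms(1,2)] mult_index_sum[OF assms(3,4)] by simp
  also have "\<dots> = kron (A * C) (B * D) $$ (i,j)"
    using assms ij by (subst kron_index) auto
  finally show "(kron A B * kron C D) $$ (i,j) = kron (A * C) (B * D) $$ (i,j)" .
qed (use assms in auto)

lemma adj_kron: "adj (kron A B) = kron (adj A) (adj B)"
proof (rule eq_matI)
  fix i j assume "i < dim_row (kron (adj A) (adj B))" "j < dim_col (kron (adj A) (adj B))"
  then have "i < dim_col A * dim_col B" "j < dim_row A * dim_row B" by auto
  then show "adj (kron A B) $$ (i,j) = kron (adj A) (adj B) $$ (i,j)"
    using index_div_mod[of i "dim_col A"] index_div_mod[of j "dim_row A"] by (simp add: kron_index)
qed auto

lemma kron_one: "kron (1\<^sub>m n) (1\<^sub>m m) = 1\<^sub>m (n * m)"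
proof (rule eq_matI)
  fix i j assume "i < dim_row (1\<^sub>m (n * m) :: complex mat)" "j < dim_col (1\<^sub>m (n * m) :: complex mat)"
  then have ij: "i < n * m" "j < n * m" by auto
  have "i = j \<longleftrightarrow> i div m = j div m \<and> i mod m = j mod m" by (metis div_mult_mod_eq)
  then show "kron (1\<^sub>m n) (1\<^sub>m m) $$ (i,j) = (1\<^sub>m (n * m) :: complex mat) $$ (i,j)"
    using ij index_div_mod[OF ij(1)] index_div_mod[OF ij(2)] by (auto simp: kron_index)
qed auto

lemma kron_one_left: "kron (1\<^sub>m 1) A = A"
  by (rule eq_matI) (auto simp: kron_index)

lemma kron_one_right: "kron A (1\<^sub>m 1) = A"
  by (rule eq_matI) (auto simp: kron_index)

lemma kron_assoc: "kron (kron A B) C = kron A (kron B C)"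
proof (rule eq_matI)
  fix i j assume "i < dim_row (kron A (kron B C))" "j < dim_col (kron A (kron B C))"
  then have ij: "i < dim_row A * dim_row B * dim_row C" "j < dim_col A * dim_col B * dim_col C"
    by (auto simp: mult.assoc)
  then have pos: "i < dim_row A * (dim_row B * dim_row C)" "j < dim_col A * (dim_col B * dim_col C)"
    by (auto simp: mult.assoc)
  have m: "x mod (p * s) div s = x div s mod p" "x mod (p * s) mod s = x mod s" for x p s :: nat
    by (cases "s = 0"; auto simp: mult.commute[of p s] mod_mult2_eq)+
  have d: "x div s div p = x div (p * s)" for x p s :: nat
    by (simp add: div_mult2_eq[symmetric] mult.commute)
  let ?p = "dim_row B" and ?s = "dim_row C" and ?p' = "dim_col B" and ?s' = "dim_col C"
  have "kron (kron A B) C $$ (i,j)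
      = A $$ (i div ?s div ?p, j div ?s' div ?p') * B $$ (i div ?s mod ?p, j div ?s' mod ?p') * C $$ (i mod ?s, j mod ?s')"
    using ij index_div_mod[OF ij(1)] index_div_mod[OF ij(2)] by (simp add: kron_index)
  also have "\<dots> = A $$ (i div (?p * ?s), j div (?p' * ?s')) * (B $$ (i mod (?p * ?s) div ?s, j mod (?p' * ?s') div ?s')
      * C $$ (i mod (?p * ?s) mod ?s, j mod (?p' * ?s') mod ?s'))"
    by (simp only: m d mult.assoc)
  also have "\<dots> = kron A (kron B C) $$ (i,j)"
    using pos index_div_mod[OF pos(1)] index_div_mod[OF pos(2)] by (simp only: kron_index kron_dims)
  finally show "kron (kron A B) C $$ (i,j) = kron A (kron B C) $$ (i,j)" .
qed (auto simp: mult.assoc)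

lemma kron_add_left:
  assumes "A \<in> carrier_mat n m" "B \<in> carrier_mat n m"
  shows "kron (A + B) C = kron A C + kron B C"
proof (rule eq_matI)
  fix i j assume "i < dim_row (kron A C + kron B C)" "j < dim_col (kron A C + kron B C)"
  then have ij: "i < n * dim_row C" "j < m * dim_col C" using assms by auto
  show "(kron (A + B) C) $$ (i,j) = (kron A C + kron B C) $$ (i,j)"
    using ij index_div_mod[OF ij(1)] index_div_mod[OF ij(2)] assms
    by (auto simp: kron_index distrib_right)
qed (use assms in auto)

lemma kron_minus_right:
  assumes "A \<in> carrier_mat n m" "B \<in> carrier_mat n m"
  shows "kron C (A - B) = kron C A - kron C B"
proof (rule eq_matI)
  fix i j assume "i < dim_row (kron C A - kron C B)" "j < dim_col (kron C A - kron C B)"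
  then have ij: "i < dim_row C * n" "j < dim_col C * m" using assms by auto
  show "(kron C (A - B)) $$ (i,j) = (kron C A - kron C B) $$ (i,j)"
    using ij index_div_mod[OF ij(1)] index_div_mod[OF ij(2)] assms
    by (auto simp: kron_index right_diff_distrib)
qed (use assms in auto)

lemma kron_smult_left: "kron (c \<cdot>\<^sub>m A) B = c \<cdot>\<^sub>m kron A B"
proof (rule eq_matI)
  fix i j assume "i < dim_row (c \<cdot>\<^sub>m kron A B)" "j < dim_col (c \<cdot>\<^sub>m kron A B)"
  then have ij: "i < dim_row A * dim_row B" "j < dim_col A * dim_col B" by auto
  show "kron (c \<cdot>\<^sub>m A) B $$ (i,j) = (c \<cdot>\<^sub>m kron A B) $$ (i,j)"
    using ij index_div_mod[OF ij(1)] index_div_mod[OF ij(2)] by (simp add: kron_index)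
qed auto

lemma mtrace_kron:
  assumes "A \<in> carrier_mat n n" "B \<in> carrier_mat m m"
  shows "mtrace (kron A B) = mtrace A * mtrace B"
proof -
  have "mtrace (kron A B) = (\<Sum>a<n. \<Sum>b<m. A $$ (a,a) * B $$ (b,b))"
    using assms unfolding mtrace_def kron_dims
    by (auto simp: sum_mult_index kron_index index_mult_less intro!: sum.cong)
  then show ?thesis using assms by (auto simp: mtrace_def sum_product)
qed

lemma psd_kron:
  assumes "psd n A" "psd m B"
  shows "psd (n * m) (kron A B)"
proof -
  obtain V W where V: "V \<in> carrier_mat n n" "A = adj V * V" and W: "W \<in> carrier_mat m m" "B = adj W * W"
    using psd_gram_ex assms by metis
  have "kron A B = adj (kron V W) * kron V W"
    unfolding adj_kron V W by (rule kron_mult[symmetric]) (use V W in auto)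
  then show ?thesis using psd_gram[of "kron V W" "n * m" "n * m"] V W by simp
qed

lemma kron_diag_of:
  "kron (diag_of N f) (diag_of m g) = diag_of (N * m) (\<lambda>x. f (x div m) * g (x mod m))"
proof (rule eq_matI)
  fix i j assume "i < dim_row (diag_of (N * m) (\<lambda>x. f (x div m) * g (x mod m)))"
    "j < dim_col (diag_of (N * m) (\<lambda>x. f (x div m) * g (x mod m)))"
  then have ij: "i < N * m" "j < N * m" by auto
  have "i = j \<longleftrightarrow> i div m = j div m \<and> i mod m = j mod m" by (metis div_mult_mod_eq)
  then show "kron (diag_of N f) (diag_of m g) $$ (i,j) = diag_of (N * m) (\<lambda>x. f (x div m) * g (x mod m)) $$ (i,j)"
    using ij index_div_mod[OF ij(1)] index_div_mod[OF ij(2)] by (auto simp: kron_index)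
qed auto

text \<open>The partial trace is the adjoint of tensoring with the identity. Conditional states and
  marginals are handled only through this pairing and its twin below.\<close>

lemma mtrace_ptrace_first:
  assumes "B \<in> carrier_mat m m" "S \<in> carrier_mat (n * m) (n * m)"
  shows "mtrace (B * ptrace_first n m S) = mtrace (kron (1\<^sub>m n) B * S)"
proof -
  have p: "ptrace_first n m S \<in> carrier_mat m m" by (simp add: ptrace_first_def)
  have k: "kron (1\<^sub>m n) B \<in> carrier_mat (n * m) (n * m)" using assms by simp
  have "mtrace (kron (1\<^sub>m n) B * S) = (\<Sum>x<n*m. \<Sum>y<n*m. kron (1\<^sub>m n) B $$ (x,y) * S $$ (y,x))"
    using assms(2) k by (auto simp: mtrace_def mult_index_sum[OF k assms(2)] intro!: sum.cong simp del: index_mult_mat(1))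
  also have "\<dots> = (\<Sum>a<n. \<Sum>b<m. \<Sum>c<n. \<Sum>e<m. (if a = c then B $$ (b,e) * S $$ (c * m + e, a * m + b) else 0))"
    unfolding sum_mult_index using assms(1)
    by (intro sum.cong refl) (auto simp: kron_index index_mult_less)
  also have "\<dots> = (\<Sum>a<n. \<Sum>b<m. \<Sum>c<n. if a = c then \<Sum>e<m. B $$ (b,e) * S $$ (c * m + e, a * m + b) else 0)"
    by (intro sum.cong refl) auto
  also have "\<dots> = (\<Sum>a<n. \<Sum>b<m. \<Sum>e<m. B $$ (b,e) * S $$ (a * m + e, a * m + b))"
    by simp
  also have "\<dots> = (\<Sum>b<m. \<Sum>a<n. \<Sum>e<m. B $$ (b,e) * S $$ (a * m + e, a * m + b))"
    by (rule sum.swap)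
  also have "\<dots> = (\<Sum>b<m. \<Sum>e<m. \<Sum>a<n. B $$ (b,e) * S $$ (a * m + e, a * m + b))"
    by (intro sum.cong refl sum.swap)
  also have "\<dots> = (\<Sum>b<m. \<Sum>e<m. B $$ (b,e) * ptrace_first n m S $$ (e,b))"
    by (intro sum.cong refl) (simp add: ptrace_first_def sum_distrib_left)
  also have "\<dots> = mtrace (B * ptrace_first n m S)"
    using assms(1) by (auto simp: mtrace_def mult_index_sum[OF assms(1) p] intro!: sum.cong simp del: index_mult_mat(1))
  finally show ?thesis ..
qed

lemma mtrace_ptrace_last:
  assumes "A \<in> carrier_mat n n" "S \<in> carrier_mat (n * m) (n * m)"
  shows "mtrace (A * ptrace_last n m S) = mtrace (kron A (1\<^sub>m m) * S)"
proof -
  have p: "ptrace_last n m S \<in> carrier_mat n n" by (simp add: ptrace_last_def)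
  have k: "kron A (1\<^sub>m m) \<in> carrier_mat (n * m) (n * m)" using assms by simp
  have "mtrace (kron A (1\<^sub>m m) * S) = (\<Sum>x<n*m. \<Sum>y<n*m. kron A (1\<^sub>m m) $$ (x,y) * S $$ (y,x))"
    using assms(2) k by (auto simp: mtrace_def mult_index_sum[OF k assms(2)] intro!: sum.cong simp del: index_mult_mat(1))
  also have "\<dots> = (\<Sum>a<n. \<Sum>b<m. \<Sum>c<n. \<Sum>e<m. (if b = e then A $$ (a,c) * S $$ (c * m + e, a * m + b) else 0))"
    unfolding sum_mult_index using assms(1)
    by (intro sum.cong refl) (auto simp: kron_index index_mult_less)
  also have "\<dots> = (\<Sum>a<n. \<Sum>b<m. \<Sum>c<n. A $$ (a,c) * S $$ (c * m + b, a * m + b))"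
    by simp
  also have "\<dots> = (\<Sum>a<n. \<Sum>c<n. \<Sum>b<m. A $$ (a,c) * S $$ (c * m + b, a * m + b))"
    by (intro sum.cong refl sum.swap)
  also have "\<dots> = (\<Sum>a<n. \<Sum>c<n. A $$ (a,c) * ptrace_last n m S $$ (c,a))"
    by (intro sum.cong refl) (simp add: ptrace_last_def sum_distrib_left)
  also have "\<dots> = mtrace (A * ptrace_last n m S)"
    using assms(1) by (auto simp: mtrace_def mult_index_sum[OF assms(1) p] intro!: sum.cong simp del: index_mult_mat(1))
  finally show ?thesis ..
qed

section \<open>Product operators with varying factors, and base \<open>d\<close> digits\<close>

fun tensor :: "(nat \<Rightarrow> complex mat) \<Rightarrow> nat \<Rightarrow> complex mat" where
  "tensor As 0 = 1\<^sub>m 1"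
| "tensor As (Suc n) = kron (tensor As n) (As n)"

lemma tensor_carrier [simp]:
  "(\<And>k. k < n \<Longrightarrow> As k \<in> carrier_mat d d) \<Longrightarrow> tensor As n \<in> carrier_mat (d ^ n) (d ^ n)"
  by (induction n) (auto simp: mult.commute[of d] intro!: kron_carrier)

lemma tensor_cong: "(\<And>k. k < n \<Longrightarrow> As k = Bs k) \<Longrightarrow> tensor As n = tensor Bs n"
  by (induction n) auto

lemma tensor_const: "tensor (\<lambda>_. A) n = tpow A n"
  by (induction n) auto

text \<open>The recursion peels off the last factor, but a measurement acts on the first system and
  leaves the others; this is the form in which a measured product operator splits.\<close>

lemma tensor_Cons: "tensor As (Suc n) = kron (As 0) (tensor (\<lambda>k. As (Suc k)) n)"
proof (induction n)
  case (Suc n)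
  have "tensor As (Suc (Suc n)) = kron (kron (As 0) (tensor (\<lambda>k. As (Suc k)) n)) (As (Suc n))"
    by (subst tensor.simps) (simp only: Suc.IH)
  then show ?case by (simp add: kron_assoc)
qed (simp add: kron_one_left[simplified] kron_one_right[simplified])

lemma tensor_mult:
  assumes "\<And>k. k < n \<Longrightarrow> As k \<in> carrier_mat d d" "\<And>k. k < n \<Longrightarrow> Bs k \<in> carrier_mat d d"
  shows "tensor As n * tensor Bs n = tensor (\<lambda>k. As k * Bs k) n"
  using assms
proof (induction n)
  case (Suc n)
  then show ?case
    by (simp add: kron_mult[OF tensor_carrier[of n As d] tensor_carrier[of n Bs d] Suc.prems(1)[of n] Suc.prems(2)[of n]])
qed auto

lemma adj_tensor: "adj (tensor As n) = tensor (\<lambda>k. adj (As k)) n"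
  by (induction n) (auto simp: adj_kron)

lemma mtrace_tensor:
  assumes "\<And>k. k < n \<Longrightarrow> As k \<in> carrier_mat d d"
  shows "mtrace (tensor As n) = (\<Prod>k<n. mtrace (As k))"
  using assms
proof (induction n)
  case (Suc n)
  then show ?case by (simp add: mtrace_kron[OF tensor_carrier[of n As d] Suc.prems[of n]])
qed (auto simp: mtrace_def)

lemma digit_Suc: "k < n \<Longrightarrow> digit d (Suc n) x k = digit d n (x div d) k"
proof -
  assume "k < n"
  then have e: "Suc n - 1 - k = Suc (n - 1 - k)" by simp
  show ?thesis unfolding digit_def e power_Suc div_mult2_eq ..
qed

lemma digit_last: "digit d (Suc n) x n = x mod d"
  by (simp add: digit_def)

lemma digit_less: "0 < d \<Longrightarrow> digit d n x k < d"
  by (simp add: digit_def)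

text \<open>Together with \<open>digit_surj\<close> this identifies the indices below
  \<open>d ^ n\<close> with words of length \<open>n\<close>, on which permutations act by moving
  letters.\<close>

lemma digit_inj:
  "x < d ^ n \<Longrightarrow> y < d ^ n \<Longrightarrow> (\<And>k. k < n \<Longrightarrow> digit d n x k = digit d n y k) \<Longrightarrow> x = y"
proof (induction n arbitrary: x y)
  case (Suc n)
  have "x div d < d ^ n" "y div d < d ^ n"
    using Suc.prems by (auto intro!: less_mult_imp_div_less simp: mult.commute)
  moreover have "digit d n (x div d) k = digit d n (y div d) k" if "k < n" for k
    using Suc.prems(3)[of k] that by (simp add: digit_Suc)
  ultimately have "x div d = y div d" using Suc.IH by blast
  moreover have "x mod d = y mod d" using Suc.prems(3)[of n] by (simp add: digit_last)
  ultimately show ?case by (metis div_mult_mod_eq)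
qed auto

lemma digit_surj:
  "(\<And>k. k < n \<Longrightarrow> e k < d) \<Longrightarrow> \<exists>x<d ^ n. \<forall>k<n. digit d n x k = e k"
proof (induction n)
  case (Suc n)
  then obtain x where x: "x < d ^ n" "\<forall>k<n. digit d n x k = e k" by auto
  have e: "e n < d" using Suc.prems by simp
  have "x * d + e n < d ^ Suc n" using index_mult_less[OF x(1) e] by (simp add: mult.commute)
  moreover have "digit d (Suc n) (x * d + e n) k = e k" if "k < Suc n" for k
    using that x(2) e by (cases "k = n") (auto simp: digit_last digit_Suc)
  ultimately show ?case by blast
qed auto

lemma tensor_index:
  assumes "\<And>k. k < n \<Longrightarrow> As k \<in> carrier_mat d d" "x < d ^ n" "y < d ^ n"
  shows "tensor As n $$ (x,y) = (\<Prod>k<n. As k $$ (digit d n x k, digit d n y k))"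
  using assms
proof (induction n arbitrary: x y)
  case (Suc n)
  have T: "tensor As n \<in> carrier_mat (d ^ n) (d ^ n)" using Suc.prems by simp
  have A: "As n \<in> carrier_mat d d" using Suc.prems by simp
  have lt: "x div d < d ^ n" "y div d < d ^ n"
    using Suc.prems by (auto intro!: less_mult_imp_div_less simp: mult.commute)
  have xy: "x < d ^ n * d" "y < d ^ n * d" using Suc.prems by (auto simp: mult.commute)
  have "tensor As (Suc n) $$ (x,y) = tensor As n $$ (x div d, y div d) * As n $$ (x mod d, y mod d)"
    using T A xy by (simp add: kron_index)
  then show ?case using Suc.IH[OF _ lt] Suc.prems(1) by (simp add: digit_Suc digit_last)
qed auto

lemma tensor_diag_of:
  "tensor (\<lambda>k. diag_of d (h k)) n = diag_of (d ^ n) (\<lambda>x. \<Prod>k<n. h k (digit d n x k))"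
proof (induction n)
  case 0
  show ?case by (rule eq_matI) auto
next
  case (Suc n)
  then show ?case
    by (simp add: kron_diag_of digit_Suc digit_last mult.commute[of _ d])
qed

section \<open>Permutation unitaries\<close>

lemma perm_unitary_carrier [simp]: "perm_unitary d n \<pi> \<in> carrier_mat (d ^ n) (d ^ n)"
  by (simp add: perm_unitary_def)

text \<open>\<open>perm_unitary\<close> is the permutation matrix of a map \<open>h\<close> on
  words, so conjugation merely re-indexes the entries of the product operator; permuting the factors
  of the entry product by \<open>\<pi>\<close> then gives the claim.\<close>

lemma perm_unitary_conj_tensor:
  assumes d: "0 < d" and p: "\<pi> permutes {..<n}" and As: "\<And>k. k < n \<Longrightarrow> As k \<in> carrier_mat d d"
  shows "adj (perm_unitary d n \<pi>) * tensor As n * perm_unitary d n \<pi> = tensor (As \<circ> \<pi>) n"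
proof -
  define P where "P = perm_unitary d n \<pi>"
  have P: "P \<in> carrier_mat (d ^ n) (d ^ n)" by (simp add: P_def perm_unitary_def)
  have T: "tensor As n \<in> carrier_mat (d ^ n) (d ^ n)" using As by simp
  have pl: "\<pi> k < n \<longleftrightarrow> k < n" for k using permutes_in_image[OF p] by simp
  \<comment> \<open>\<open>h x\<close> is the word whose letter at place \<open>\<pi> k\<close> is
    the letter of \<open>x\<close> at place \<open>k\<close>. Surjectivity of digits provides its
    index; injectivity then shows that column \<open>x\<close> has its only nonzero entry
    there.\<close>
  have "\<forall>x. \<exists>y<d ^ n. \<forall>k<n. digit d n y k = digit d n x (inv_into UNIV \<pi> k)"
    using digit_surj[of n "\<lambda>k. digit d n _ (inv_into UNIV \<pi> k)" d] digit_less[OF d] by simp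
  then obtain h where h: "\<And>x. h x < d ^ n" "\<And>x k. k < n \<Longrightarrow> digit d n (h x) k = digit d n x (inv_into UNIV \<pi> k)"
    by metis
  have h\<pi>: "digit d n (h x) (\<pi> k) = digit d n x k" if "k < n" for x k
    using h(2)[of "\<pi> k" x] that pl permutes_inverses(2)[OF p] by simp
  have Pi: "P $$ (y,x) = (if y = h x then 1 else 0)" if "x < d ^ n" "y < d ^ n" for x y
  proof -
    have "y = h x" if yx: "\<forall>k<n. digit d n y (\<pi> k) = digit d n x k"
    proof (rule digit_inj[OF \<open>y < d ^ n\<close> h(1)])
      fix k assume k: "k < n"
      have "inv_into UNIV \<pi> k < n" using k permutes_in_image[OF permutes_inv[OF p], of k] by simp
      then have "digit d n y (\<pi> (inv_into UNIV \<pi> k)) = digit d n x (inv_into UNIV \<pi> k)" using yx by blast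
      then show "digit d n y k = digit d n (h x) k"
        unfolding h(2)[OF k] permutes_inverses(1)[OF p] .
    qed
    then have "(\<forall>k<n. digit d n y (\<pi> k) = digit d n x k) \<longleftrightarrow> y = h x" using h\<pi> by blast
    then show ?thesis unfolding P_def perm_unitary_def using that by simp
  qed
  have TP: "(tensor As n * P) $$ (y,x) = tensor As n $$ (y, h x)" if "x < d ^ n" "y < d ^ n" for x y
  proof -
    have "(tensor As n * P) $$ (y,x) = (\<Sum>z<d ^ n. if z = h x then tensor As n $$ (y, z) else 0)"
      unfolding mult_index_sum[OF T P that(2,1)] using that by (intro sum.cong) (auto simp: Pi)
    then show ?thesis using h by simp
  qed
  have "adj P * tensor As n * P = tensor (As \<circ> \<pi>) n"
  proof (rule eq_matI)
    have T': "tensor (As \<circ> \<pi>) n \<in> carrier_mat (d ^ n) (d ^ n)" using As pl by (intro tensor_carrier) auto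
    show "dim_row (adj P * tensor As n * P) = dim_row (tensor (As \<circ> \<pi>) n)"
      "dim_col (adj P * tensor As n * P) = dim_col (tensor (As \<circ> \<pi>) n)" using T' P by auto
    fix x y assume "x < dim_row (tensor (As \<circ> \<pi>) n)" "y < dim_col (tensor (As \<circ> \<pi>) n)"
    then have xy: "x < d ^ n" "y < d ^ n" using T' by auto
    have "(adj P * tensor As n * P) $$ (x,y) = (adj P * (tensor As n * P)) $$ (x,y)"
      using P T by (simp add: mat_assoc)
    also have "\<dots> = (\<Sum>z<d ^ n. if z = h x then tensor As n $$ (z, h y) else 0)"
      unfolding mult_index_sum[OF adj_carrier[OF P] mult_carrier_mat[OF T P] xy]
      using xy P by (intro sum.cong) (auto simp: Pi TP simp del: index_mult_mat(1))
    also have "\<dots> = tensor As n $$ (h x, h y)" using h by simp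
    also have "\<dots> = (\<Prod>k<n. As k $$ (digit d n (h x) k, digit d n (h y) k))"
      using tensor_index[OF As h(1) h(1)] by simp
    also have "\<dots> = (\<Prod>k<n. As (\<pi> k) $$ (digit d n (h x) (\<pi> k), digit d n (h y) (\<pi> k)))"
      using prod.permute[OF p, of "\<lambda>k. As k $$ (digit d n (h x) k, digit d n (h y) k)"] by simp
    also have "\<dots> = (\<Prod>k<n. (As \<circ> \<pi>) k $$ (digit d n x k, digit d n y k))"
      by (intro prod.cong) (auto simp: h\<pi>)
    also have "\<dots> = tensor (As \<circ> \<pi>) n $$ (x,y)"
      using As pl xy by (intro tensor_index[symmetric]) auto
    finally show "(adj P * tensor As n * P) $$ (x,y) = tensor (As \<circ> \<pi>) n $$ (x,y)" .
  qed
  then show ?thesis by (simp add: P_def)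
qed

lemma mtrace_conj_swap:
  assumes "T \<in> carrier_mat N N" "P \<in> carrier_mat N N" "S \<in> carrier_mat N N"
  shows "mtrace (T * (P * S * adj P)) = mtrace (adj P * T * P * S)"
proof -
  have "mtrace (T * (P * S * adj P)) = mtrace ((T * P * S) * adj P)"
    using assms by (auto simp: mat_assoc)
  also have "\<dots> = mtrace (adj P * (T * P * S))"
    using assms by (intro mtrace_comm[of _ N N]) auto
  finally show ?thesis using assms by (auto simp: mat_assoc)
qed

lemma mtrace_perm_unitary_conj:
  assumes "0 < d" "\<pi> permutes {..<n}" "\<And>k. k < n \<Longrightarrow> As k \<in> carrier_mat d d" "S \<in> carrier_mat (d ^ n) (d ^ n)"
  shows "mtrace (tensor As n * (perm_unitary d n \<pi> * S * adj (perm_unitary d n \<pi>)))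
       = mtrace (tensor (As \<circ> \<pi>) n * S)"
  using assms by (subst mtrace_conj_swap[of _ "d ^ n"]) (auto simp: perm_unitary_conj_tensor simp del: assoc_mult_mat)

lemma tensor_one: "tensor (\<lambda>_. 1\<^sub>m d) n = 1\<^sub>m (d ^ n)"
  using tensor_diag_of[of d "\<lambda>_ _. 1" n] by (simp add: diag_of_one)

text \<open>This is the conjugation formula with every factor equal to the identity.\<close>

lemma unitary_perm_unitary:
  assumes "0 < d" "\<pi> permutes {..<n}"
  shows "unitary (d ^ n) (perm_unitary d n \<pi>)"
  using perm_unitary_conj_tensor[OF assms, of "\<lambda>_. 1\<^sub>m d"]
    right_mult_one_mat[OF adj_carrier[OF perm_unitary_carrier[of d n \<pi>]]]
  by (simp add: unitary_def tensor_one comp_def)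

text \<open>Because of this invariance a permutation can be moved from the free state onto the test
  without changing the second error.\<close>

lemma perm_unitary_conj_tpow:
  assumes "0 < d" "\<pi> permutes {..<n}" "\<rho> \<in> carrier_mat d d"
  shows "perm_unitary d n \<pi> * tpow \<rho> n * adj (perm_unitary d n \<pi>) = tpow \<rho> n"
proof -
  define P where "P = perm_unitary d n \<pi>"
  define R where "R = tpow \<rho> n"
  have P: "P \<in> carrier_mat (d ^ n) (d ^ n)" by (simp add: P_def)
  have R: "R \<in> carrier_mat (d ^ n) (d ^ n)"
    using tensor_carrier[of n "\<lambda>_. \<rho>" d] assms(3) by (simp add: R_def tensor_const)
  have u: "P * adj P = 1\<^sub>m (d ^ n)" unfolding P_def by (rule unitary_right[OF unitary_perm_unitary[OF assms(1,2)]])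
  have "adj P * R * P = R"
    using perm_unitary_conj_tensor[OF assms(1,2), of "\<lambda>_. \<rho>"] assms(3)
    by (simp add: P_def R_def comp_def tensor_const)
  then have "P * R * adj P = P * (adj P * R * P) * adj P" by simp
  also have "\<dots> = (P * adj P) * R * (P * adj P)" using P R by (auto simp: mat_assoc)
  finally show ?thesis using u R by (simp add: P_def R_def)
qed

lemma unitary_tpow:
  assumes "unitary d U" shows "unitary (d ^ n) (tpow U n)"
proof -
  note U = unitary_carrier[OF assms]
  note one = tensor_one[of d n]
  have "adj (tpow U n) * tpow U n = tensor (\<lambda>_. adj U * U) n"
    unfolding tensor_const[symmetric] adj_tensor using U by (subst tensor_mult[of _ _ d]) auto
  then show ?thesis
    using U one unitary_left[OF assms] tensor_carrier[of n "\<lambda>_. U" d] by (simp add: unitary_def tensor_const)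
qed

lemma tensor_unitary_conj:
  assumes "unitary d U"
  shows "tensor (\<lambda>k. U * diag_of d (h k) * adj U) n
       = tpow U n * diag_of (d ^ n) (\<lambda>x. \<Prod>k<n. h k (digit d n x k)) * adj (tpow U n)"
proof -
  note U = unitary_carrier[OF assms]
  have "tpow U n * diag_of (d ^ n) (\<lambda>x. \<Prod>k<n. h k (digit d n x k)) * adj (tpow U n)
    = tensor (\<lambda>_. U) n * tensor (\<lambda>k. diag_of d (h k)) n * tensor (\<lambda>_. adj U) n"
    by (simp add: tensor_diag_of tensor_const[symmetric] adj_tensor)
  also have "\<dots> = tensor (\<lambda>k. U * diag_of d (h k) * adj U) n"
    using U by (simp add: tensor_mult[of _ _ d])
  finally show ?thesis ..
qed

section \<open>Expectation values and functional calculus\<close>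

text \<open>The pairing is linear in both slots and symmetric (\<open>expval_comm\<close>), so the
  state slot also takes tests and unnormalised operators; several trace bounds below consist in
  exchanging the two roles.\<close>

definition expval :: "complex mat \<Rightarrow> complex mat \<Rightarrow> real" where
  "expval S M = Re (mtrace (M * S))"

text \<open>\<open>f\<close> depends on the index of the eigenvector and not on an eigenvalue, so
  everything diagonal in one basis has this form, including the indicator of a typical set of
  indices.\<close>

definition spec :: "nat \<Rightarrow> complex mat \<Rightarrow> (nat \<Rightarrow> real) \<Rightarrow> complex mat" where
  "spec N U f = U * diag_of N f * adj U"

lemma spec_carrier [simp]: "unitary N U \<Longrightarrow> spec N U f \<in> carrier_mat N N"
  using unitary_carrier[of N U] by (auto simp: spec_def)

lemma adj_spec [simp]: assumes "unitary N U" shows "adj (spec N U f) = spec N U f"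
  using unitary_carrier[OF assms] by (auto simp: spec_def mat_norm)

lemma spec_hermitian: "unitary N U \<Longrightarrow> hermitian N (spec N U f)"
  by (simp add: hermitian_def)

lemma spec_mult:
  assumes "unitary N U"
  shows "spec N U f * spec N U g = spec N U (\<lambda>i. f i * g i)"
proof -
  note U = unitary_carrier[OF assms]
  have "spec N U f * spec N U g = U * (diag_of N f * (adj U * U) * diag_of N g) * adj U"
    using U by (auto simp: spec_def mat_norm)
  also have "\<dots> = spec N U (\<lambda>i. f i * g i)"
    unfolding unitary_left[OF assms] spec_def using U by (simp add: diag_of_mult)
  finally show ?thesis .
qed

lemma spec_one: assumes "unitary N U" shows "spec N U (\<lambda>_. 1) = 1\<^sub>m N"
  using unitary_carrier[OF assms] unitary_right[OF assms] by (auto simp: spec_def diag_of_one)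

lemma diag_of_minus: "diag_of N f - diag_of N g = diag_of N (\<lambda>i. f i - g i)"
  by (rule eq_matI) auto

lemma diag_of_smult: "complex_of_real c \<cdot>\<^sub>m diag_of N f = diag_of N (\<lambda>i. c * f i)"
  by (rule eq_matI) auto

lemma spec_minus:
  assumes "unitary N U"
  shows "spec N U f - spec N U g = spec N U (\<lambda>i. f i - g i)"
proof -
  note U = unitary_carrier[OF assms]
  have "spec N U f - spec N U g = (U * diag_of N f - U * diag_of N g) * adj U"
    unfolding spec_def using U by (subst minus_mult_distrib_mat[of _ N N _ _ N]) auto
  also have "U * diag_of N f - U * diag_of N g = U * (diag_of N f - diag_of N g)"
    using U by (subst mult_minus_distrib_mat[of _ N N _ N]) auto
  finally show ?thesis by (simp add: diag_of_minus spec_def)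
qed

lemma spec_smult:
  assumes "unitary N U"
  shows "complex_of_real c \<cdot>\<^sub>m spec N U f = spec N U (\<lambda>i. c * f i)"
proof -
  note U = unitary_carrier[OF assms]
  have "spec N U (\<lambda>i. c * f i) = U * (complex_of_real c \<cdot>\<^sub>m diag_of N f) * adj U"
    by (simp add: spec_def diag_of_smult)
  also have "\<dots> = complex_of_real c \<cdot>\<^sub>m spec N U f"
    using U unfolding spec_def
    by (simp add: mult_smult_distrib[of _ N N _ N] mult_smult_assoc_mat[of _ N N _ N])
  finally show ?thesis ..
qed

lemma spec_psd:
  assumes "unitary N U" "\<And>i. i < N \<Longrightarrow> 0 \<le> f i"
  shows "psd N (spec N U f)"
  using psd_conj[OF psd_diag_of[of N f], of "adj U" N] assms unitary_carrier[OF assms(1)]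
  by (simp add: spec_def)

lemma spec_cong: "(\<And>i. i < N \<Longrightarrow> f i = g i) \<Longrightarrow> spec N U f = spec N U g"
  unfolding spec_def by (rule arg_cong[of _ _ "\<lambda>D. U * D * adj U"], rule eq_matI) auto

lemma mtrace_spec: "unitary N U \<Longrightarrow> mtrace (spec N U f) = complex_of_real (\<Sum>i<N. f i)"
  unfolding spec_def by (subst mtrace_unitary_conj) (auto simp: mtrace_def)

lemma spec_psd_le:
  assumes "unitary N U" "\<And>i. i < N \<Longrightarrow> f i \<le> g i"
  shows "psd N (spec N U g - spec N U f)"
  unfolding spec_minus[OF assms(1)] by (rule spec_psd[OF assms(1)]) (simp add: assms(2))

lemma tensor_spec:
  "unitary d U \<Longrightarrow> tensor (\<lambda>k. spec d U (h k)) n = spec (d ^ n) (tpow U n) (\<lambda>x. \<Prod>k<n. h k (digit d n x k))"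
  using tensor_unitary_conj[of d U h n] by (simp add: spec_def)

lemma tpow_spec:
  "unitary d U \<Longrightarrow> tpow (spec d U l) n = spec (d ^ n) (tpow U n) (\<lambda>x. \<Prod>k<n. l (digit d n x k))"
  using tensor_spec[of d U "\<lambda>_. l" n] by (simp add: tensor_const)

text \<open>For a density matrix the diagonal of \<open>adj U * S * U\<close> is the outcome
  distribution of a measurement in the basis \<open>U\<close>, so statements about observables
  sharing this basis become classical sums.\<close>

lemma expval_spec:
  assumes "unitary N U" "S \<in> carrier_mat N N"
  shows "expval S (spec N U g) = (\<Sum>x<N. g x * Re ((adj U * S * U) $$ (x,x)))"
proof -
  note U = unitary_carrier[OF assms(1)]
  define T where "T = adj U * S * U"
  have T: "T \<in> carrier_mat N N" using U assms(2) by (auto simp: T_def)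
  have "mtrace (spec N U g * S) = mtrace (U * (diag_of N g * (adj U * S)))"
    using U assms(2) by (auto simp: spec_def mat_norm)
  also have "\<dots> = mtrace (diag_of N g * (adj U * S) * U)"
    using U assms(2) by (intro mtrace_comm[of _ N N]) auto
  also have "\<dots> = mtrace (diag_of N g * T)"
    using U assms(2) by (auto simp: T_def mat_norm)
  also have "\<dots> = (\<Sum>x<N. complex_of_real (g x) * T $$ (x,x))"
  proof -
    have "(diag_of N g * T) $$ (x,x) = complex_of_real (g x) * T $$ (x,x)" if "x < N" for x
      unfolding mult_index_sum[OF diag_of_carrier T that that] using that
      by (subst sum.cong[OF refl, of _ _ "\<lambda>l. if l = x then complex_of_real (g x) * T $$ (x,x) else 0"]) auto
    then show ?thesis by (simp add: mtrace_def)
  qed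
  finally show ?thesis by (simp add: expval_def T_def)
qed

section \<open>Linearity and monotonicity of expectation values\<close>

lemma expval_add:
  "A \<in> carrier_mat N N \<Longrightarrow> B \<in> carrier_mat N N \<Longrightarrow> S \<in> carrier_mat N N \<Longrightarrow>
   expval S (A + B) = expval S A + expval S B"
  by (simp add: expval_def add_mult_distrib_mat[of _ N N] mtrace_add[of _ N])

lemma expval_minus:
  "A \<in> carrier_mat N N \<Longrightarrow> B \<in> carrier_mat N N \<Longrightarrow> S \<in> carrier_mat N N \<Longrightarrow>
   expval S (A - B) = expval S A - expval S B"
  by (simp add: expval_def minus_mult_distrib_mat[of _ N N] mtrace_minus[of _ N])

lemma expval_smult:
  "A \<in> carrier_mat N N \<Longrightarrow> S \<in> carrier_mat N N \<Longrightarrow>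
   expval S (complex_of_real c \<cdot>\<^sub>m A) = c * expval S A"
  by (simp add: expval_def mult_smult_assoc_mat[of _ N N] mtrace_smult[of _ N])

lemma expval_nonneg: "psd N M \<Longrightarrow> psd N S \<Longrightarrow> 0 \<le> expval S M"
  unfolding expval_def by (rule mtrace_psd_mult_nonneg)

lemma expval_mono:
  assumes "psd N (B - A)" "psd N S" "A \<in> carrier_mat N N" "B \<in> carrier_mat N N"
  shows "expval S A \<le> expval S B"
  using expval_nonneg[OF assms(1,2)] expval_minus[OF assms(4,3) psd_carrier[OF assms(2)]] by simp

lemma expval_comm:
  "A \<in> carrier_mat N N \<Longrightarrow> S \<in> carrier_mat N N \<Longrightarrow> expval S A = expval A S"
  unfolding expval_def by (subst mtrace_comm[of _ N N]) auto

lemma expval_one: "S \<in> carrier_mat N N \<Longrightarrow> expval S (1\<^sub>m N) = Re (mtrace S)"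
  by (simp add: expval_def)

lemma densityD:
  assumes "S \<in> density N"
  shows "psd N S" "S \<in> carrier_mat N N" "mtrace S = 1" "expval S (1\<^sub>m N) = 1"
  using assms psd_carrier[of N S] expval_one[of S N] by (auto simp: density_def)

text \<open>Real parts are not multiplicative; this is what allows the trace of a tensor product to
  be split into a product of expectation values.\<close>

lemma mtrace_hermitian_mult_real:
  assumes "hermitian N A" "hermitian N S"
  shows "mtrace (A * S) = complex_of_real (expval S A)"
proof -
  note A = hermitian_carrier[OF assms(1)] and S = hermitian_carrier[OF assms(2)]
  have "cnj (mtrace (A * S)) = mtrace (adj (A * S))" using A S by (simp add: mtrace_adj[of _ N])
  also have "\<dots> = mtrace (S * A)"
    using A S assms by (subst adj_mult[of _ N N _ N]) (auto simp: hermitian_def)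
  also have "\<dots> = mtrace (A * S)" using A S by (intro mtrace_comm[of _ N N]) auto
  finally show ?thesis by (auto simp: expval_def complex_eq_iff)
qed

section \<open>Concentration of empirical means\<close>

definition site :: "nat \<Rightarrow> nat \<Rightarrow> complex mat \<Rightarrow> nat \<Rightarrow> complex mat" where
  "site d n A k = tensor ((\<lambda>_. 1\<^sub>m d)(k := A)) n"

definition site2 :: "nat \<Rightarrow> nat \<Rightarrow> complex mat \<Rightarrow> nat \<Rightarrow> complex mat \<Rightarrow> nat \<Rightarrow> complex mat" where
  "site2 d n A k B l = tensor ((\<lambda>_. 1\<^sub>m d)(k := A, l := B)) n"

lemma expval_tensor_spec:
  assumes U: "unitary d U" and S: "S \<in> carrier_mat (d ^ n) (d ^ n)"
  shows "expval S (tensor (\<lambda>k. spec d U (h k)) n)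
    = (\<Sum>x<d ^ n. (\<Prod>k<n. h k (digit d n x k)) * Re ((adj (tpow U n) * S * tpow U n) $$ (x,x)))"
  unfolding tensor_spec[OF U] by (rule expval_spec[OF unitary_tpow[OF U] S])

lemma expval_site_spec:
  assumes U: "unitary d U" and S: "S \<in> carrier_mat (d ^ n) (d ^ n)" and k: "k < n"
  shows "expval S (site d n (spec d U f) k)
    = (\<Sum>x<d ^ n. f (digit d n x k) * Re ((adj (tpow U n) * S * tpow U n) $$ (x,x)))"
proof -
  define h where "h = (\<lambda>j. if j = k then f else (\<lambda>_. 1))"
  have "site d n (spec d U f) k = tensor (\<lambda>j. spec d U (h j)) n"
    unfolding site_def by (rule tensor_cong) (auto simp: h_def spec_one[OF U])
  moreover have "(\<Prod>j<n. h j (digit d n x j)) = f (digit d n x k)" for x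
  proof -
    have "(\<Prod>j<n. h j (digit d n x j)) = (\<Prod>j<n. if j = k then f (digit d n x k) else 1)"
      by (intro prod.cong) (auto simp: h_def)
    then show ?thesis using k by simp
  qed
  ultimately show ?thesis using expval_tensor_spec[OF U S, of h] by simp
qed

lemma expval_site2_spec:
  assumes U: "unitary d U" and S: "S \<in> carrier_mat (d ^ n) (d ^ n)" and k: "k < n" "l < n" "k \<noteq> l"
  shows "expval S (site2 d n (spec d U f) k (spec d U g) l)
    = (\<Sum>x<d ^ n. f (digit d n x k) * g (digit d n x l) * Re ((adj (tpow U n) * S * tpow U n) $$ (x,x)))"
proof -
  define h where "h = (\<lambda>j. if j = l then g else if j = k then f else (\<lambda>_. 1))"
  have "site2 d n (spec d U f) k (spec d U g) l = tensor (\<lambda>j. spec d U (h j)) n"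
    unfolding site2_def by (rule tensor_cong) (auto simp: h_def spec_one[OF U])
  moreover have "(\<Prod>j<n. h j (digit d n x j)) = f (digit d n x k) * g (digit d n x l)" for x
  proof -
    have "(\<Prod>j<n. h j (digit d n x j))
        = (\<Prod>j<n. (if j = k then f (digit d n x k) else 1) * (if j = l then g (digit d n x l) else 1))"
      using k by (intro prod.cong) (auto simp: h_def)
    then show ?thesis using k by (simp add: prod.distrib)
  qed
  ultimately show ?thesis using expval_tensor_spec[OF U S, of h] by simp
qed

definition empirical :: "nat \<Rightarrow> nat \<Rightarrow> (nat \<Rightarrow> real) \<Rightarrow> nat \<Rightarrow> real" where
  "empirical d n f x = (\<Sum>k<n. f (digit d n x k)) / real n"

(* For n = 1 the hypothesis m2 would be vacuous and c arbitrary. *)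
lemma chebyshev_empirical:
  assumes U: "unitary d U" and S: "S \<in> density (d ^ n)" and n: "2 \<le> n" and d: "0 < d" and \<delta>: "0 < \<delta>"
    and K: "\<And>i. i < d \<Longrightarrow> \<bar>f i\<bar> \<le> K"
    and m1: "\<And>k. k < n \<Longrightarrow> expval S (site d n (spec d U f) k) = a"
    and m2: "\<And>k l. k < n \<Longrightarrow> l < n \<Longrightarrow> k \<noteq> l \<Longrightarrow> expval S (site2 d n (spec d U f) k (spec d U f) l) = c"
    and v: "c - a\<^sup>2 \<le> v"
  shows "expval S (spec (d ^ n) (tpow U n) (\<lambda>x. of_bool (\<delta> < \<bar>empirical d n f x - a\<bar>))) \<le> (2 * K\<^sup>2 / real n + v) / \<delta>\<^sup>2"
proof -
  note S' = densityD[OF S] and Un = unitary_tpow[OF U, of n]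
  define p where "p = (\<lambda>x. Re ((adj (tpow U n) * S * tpow U n) $$ (x,x)))"
  have p0: "0 \<le> p x" if "x < d ^ n" for x
    unfolding p_def by (rule psd_diag_nonneg[OF psd_conj[OF S'(1) unitary_carrier[OF Un]] that])
  have ev: "expval S (spec (d ^ n) (tpow U n) g) = (\<Sum>x<d ^ n. g x * p x)" for g
    unfolding p_def by (rule expval_spec[OF Un S'(2)])
  have p1: "(\<Sum>x<d ^ n. p x) = 1" using ev[of "\<lambda>_. 1"] S'(4) spec_one[OF Un] by simp
  define F where "F = (\<lambda>x k. f (digit d n x k))"
  have FK: "\<bar>F x k\<bar> \<le> K" for x k unfolding F_def using K digit_less[OF d] by blast
  have K2: "\<bar>F x k * F x l\<bar> \<le> K\<^sup>2" for x k l
    unfolding abs_mult power2_eq_square by (intro mult_mono FK) (use FK[of x k] in auto)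
  have E1: "(\<Sum>x<d ^ n. F x k * p x) = a" if "k < n" for k
    using m1[OF that] expval_site_spec[OF U S'(2) that, of f] by (simp add: F_def p_def)
  have E2: "(\<Sum>x<d ^ n. F x k * F x l * p x) = c" if "k < n" "l < n" "k \<noteq> l" for k l
    using m2[OF that] expval_site2_spec[OF U S'(2) that, of f f] by (simp add: F_def p_def)
  have bd: "(\<Sum>x<d ^ n. F x k * F x l * p x) \<le> K\<^sup>2" "- K\<^sup>2 \<le> (\<Sum>x<d ^ n. F x k * F x l * p x)" for k l
  proof -
    have "\<bar>\<Sum>x<d ^ n. F x k * F x l * p x\<bar> \<le> (\<Sum>x<d ^ n. K\<^sup>2 * p x)"
      by (rule order_trans[OF sum_abs], rule sum_mono)
         (use K2 p0 in \<open>auto simp: abs_mult intro!: mult_right_mono\<close>)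
    also have "\<dots> = K\<^sup>2" using p1 by (simp flip: sum_distrib_left)
    finally show "(\<Sum>x<d ^ n. F x k * F x l * p x) \<le> K\<^sup>2" "- K\<^sup>2 \<le> (\<Sum>x<d ^ n. F x k * F x l * p x)" by auto
  qed
  have M1: "(\<Sum>x<d ^ n. (\<Sum>k<n. F x k) * p x) = real n * a"
  proof -
    have "(\<Sum>x<d ^ n. (\<Sum>k<n. F x k) * p x) = (\<Sum>k<n. \<Sum>x<d ^ n. F x k * p x)"
      by (subst sum.swap) (simp add: sum_distrib_right)
    then show ?thesis using E1 by simp
  qed
  have M2: "(\<Sum>x<d ^ n. (\<Sum>k<n. F x k)\<^sup>2 * p x) \<le> (real n)\<^sup>2 * c + 2 * real n * K\<^sup>2"
  proof -
    have "(\<Sum>x<d ^ n. (\<Sum>k<n. F x k)\<^sup>2 * p x) = (\<Sum>x<d ^ n. \<Sum>k<n. \<Sum>l<n. F x k * F x l * p x)"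
      by (intro sum.cong refl, subst power2_eq_square, subst sum_product, simp only: sum_distrib_right)
    also have "\<dots> = (\<Sum>k<n. \<Sum>x<d ^ n. \<Sum>l<n. F x k * F x l * p x)" by (rule sum.swap)
    also have "\<dots> = (\<Sum>k<n. \<Sum>l<n. \<Sum>x<d ^ n. F x k * F x l * p x)"
      by (intro sum.cong refl sum.swap)
    \<comment> \<open>The \<open>n\<close> diagonal terms are at most \<open>K\<^sup>2\<close>,
      while \<open>c\<close> is at least \<open>- K\<^sup>2\<close>, so
      \<open>c + 2 * K\<^sup>2\<close> covers them. This is the source of the summand
      \<open>2 * K\<^sup>2 / real n\<close>.\<close>
    also have "\<dots> \<le> (\<Sum>k<n. \<Sum>l<n. c + (if l = k then 2 * K\<^sup>2 else 0))"
    proof (intro sum_mono)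
      fix k l assume kl: "k \<in> {..<n}" "l \<in> {..<n}"
      show "(\<Sum>x<d ^ n. F x k * F x l * p x) \<le> c + (if l = k then 2 * K\<^sup>2 else 0)"
      proof (cases "l = k")
        case True
        have "- K\<^sup>2 \<le> c" using E2[of 0 1] bd(2)[of 0 1] n by simp
        then show ?thesis using bd(1)[of k l] True by simp
      qed (use E2[of k l] kl in auto)
    qed
    also have "\<dots> = (real n)\<^sup>2 * c + 2 * real n * K\<^sup>2"
      by (simp add: sum.distrib power2_eq_square algebra_simps)
    finally show ?thesis .
  qed
  have e: "empirical d n f x = (\<Sum>k<n. F x k) / real n" for x by (simp add: empirical_def F_def)
  have "expval S (spec (d ^ n) (tpow U n) (\<lambda>x. of_bool (\<delta> < \<bar>empirical d n f x - a\<bar>)))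
      \<le> (\<Sum>x<d ^ n. (empirical d n f x - a)\<^sup>2 / \<delta>\<^sup>2 * p x)"
    unfolding ev
  proof (intro sum_mono mult_right_mono)
    fix x assume "x \<in> {..<d ^ n}"
    then show "0 \<le> p x" using p0 by simp
    have "\<delta>\<^sup>2 \<le> (empirical d n f x - a)\<^sup>2" if "\<delta> < \<bar>empirical d n f x - a\<bar>"
      using that \<delta> power_mono[of \<delta> "\<bar>empirical d n f x - a\<bar>" 2] by simp
    then show "of_bool (\<delta> < \<bar>empirical d n f x - a\<bar>) \<le> (empirical d n f x - a)\<^sup>2 / \<delta>\<^sup>2"
      using \<delta> by (simp add: field_simps)
  qed
  also have "\<dots> = ((\<Sum>x<d ^ n. (\<Sum>k<n. F x k)\<^sup>2 * p x) / (real n)\<^sup>2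
      - 2 * a * (\<Sum>x<d ^ n. (\<Sum>k<n. F x k) * p x) / real n + a\<^sup>2 * (\<Sum>x<d ^ n. p x)) / \<delta>\<^sup>2"
    unfolding sum_distrib_left sum_divide_distrib sum_subtractf[symmetric] sum.distrib[symmetric]
    by (intro sum.cong refl)
       (simp add: e power2_diff power_divide add_divide_distrib diff_divide_distrib algebra_simps)
  also have "\<dots> \<le> (2 * K\<^sup>2 / real n + v) / \<delta>\<^sup>2"
  proof (rule divide_right_mono)
    have "(\<Sum>x<d ^ n. (\<Sum>k<n. F x k)\<^sup>2 * p x) / (real n)\<^sup>2 \<le> ((real n)\<^sup>2 * c + 2 * real n * K\<^sup>2) / (real n)\<^sup>2"
      by (rule divide_right_mono[OF M2]) simp
    also have "\<dots> = c + 2 * K\<^sup>2 / real n" using n by (simp add: add_divide_distrib power2_eq_square)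
    finally show "(\<Sum>x<d ^ n. (\<Sum>k<n. F x k)\<^sup>2 * p x) / (real n)\<^sup>2
        - 2 * a * (\<Sum>x<d ^ n. (\<Sum>k<n. F x k) * p x) / real n + a\<^sup>2 * (\<Sum>x<d ^ n. p x) \<le> 2 * K\<^sup>2 / real n + v"
      unfolding M1 p1 using n v by (simp add: power2_eq_square)
  qed simp
  finally show ?thesis .
qed

section \<open>Sequences of almost certain projective measurements\<close>

text \<open>For positive \<open>M\<close> and \<open>S\<close> this is a positive semidefinite
  sesquilinear form in \<open>X\<close> and \<open>Y\<close>; on the diagonal it is the weight that
  \<open>M\<close> finds after \<open>X\<close> has acted on the state.\<close>

definition sandwich :: "complex mat \<Rightarrow> complex mat \<Rightarrow> complex mat \<Rightarrow> complex mat \<Rightarrow> complex" where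
  "sandwich M S X Y = mtrace (M * (X * S * adj Y))"

lemma sandwich_add:
  assumes "M \<in> carrier_mat N N" "S \<in> carrier_mat N N" "X \<in> carrier_mat N N" "Y \<in> carrier_mat N N" "Z \<in> carrier_mat N N"
  shows "sandwich M S (X + Y) Z = sandwich M S X Z + sandwich M S Y Z"
    "sandwich M S Z (X + Y) = sandwich M S Z X + sandwich M S Z Y"
proof -
  have c: "X * S * adj Z \<in> carrier_mat N N" "Y * S * adj Z \<in> carrier_mat N N"
    "Z * S * adj X \<in> carrier_mat N N" "Z * S * adj Y \<in> carrier_mat N N" using assms by auto
  have "(X + Y) * S * adj Z = X * S * adj Z + Y * S * adj Z"
    using assms by (subst add_mult_distrib_mat[of _ N N], simp_all, subst add_mult_distrib_mat[of _ N N], auto)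
  then show "sandwich M S (X + Y) Z = sandwich M S X Z + sandwich M S Y Z"
    using assms c by (simp add: sandwich_def mult_add_distrib_mat[of _ N N _ N] mtrace_add[of _ N] del: assoc_mult_mat)
  have "Z * S * adj (X + Y) = Z * S * adj X + Z * S * adj Y"
    using assms by (subst adj_add[of _ N N], simp_all del: assoc_mult_mat, subst mult_add_distrib_mat[of _ N N _ N], auto)
  then show "sandwich M S Z (X + Y) = sandwich M S Z X + sandwich M S Z Y"
    using assms c by (simp add: sandwich_def mult_add_distrib_mat[of _ N N _ N] mtrace_add[of _ N] del: assoc_mult_mat)
qed

lemma psd_conj': "psd N S \<Longrightarrow> X \<in> carrier_mat N N \<Longrightarrow> psd N (X * S * adj X)"
  using psd_conj[of N S "adj X" N] by simp

lemma sandwich_nonneg: "psd N M \<Longrightarrow> psd N S \<Longrightarrow> X \<in> carrier_mat N N \<Longrightarrow> 0 \<le> Re (sandwich M S X X)"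
  unfolding sandwich_def by (intro mtrace_psd_mult_nonneg[of N] psd_conj')

lemma sandwich_uminus:
  assumes "M \<in> carrier_mat N N" "S \<in> carrier_mat N N" "X \<in> carrier_mat N N" "Y \<in> carrier_mat N N"
  shows "sandwich M S ((-1) \<cdot>\<^sub>m X) Y = - sandwich M S X Y" "sandwich M S Y ((-1) \<cdot>\<^sub>m X) = - sandwich M S Y X"
proof -
  have "((-1) \<cdot>\<^sub>m X) * S * adj Y = (-1) \<cdot>\<^sub>m (X * S * adj Y)" "Y * S * adj ((-1) \<cdot>\<^sub>m X) = (-1) \<cdot>\<^sub>m (Y * S * adj X)"
    using assms by (auto simp: adj_smult mat_norm mult_smult_assoc_mat[of _ N N _ N] mult_smult_distrib[of _ N N _ N])
  moreover have "M * ((-1) \<cdot>\<^sub>m C) = (-1) \<cdot>\<^sub>m (M * C)" if "C \<in> carrier_mat N N" for C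
    using assms that by (auto simp: mult_smult_distrib[of _ N N _ N])
  moreover have "mtrace ((-1) \<cdot>\<^sub>m C) = - mtrace C" if "C \<in> carrier_mat N N" for C
    using mtrace_smult[OF that, of "-1"] by simp
  moreover have "X * S * adj Y \<in> carrier_mat N N" "Y * S * adj X \<in> carrier_mat N N"
    "M * (X * S * adj Y) \<in> carrier_mat N N" "M * (Y * S * adj X) \<in> carrier_mat N N"
    using assms by auto
  ultimately show "sandwich M S ((-1) \<cdot>\<^sub>m X) Y = - sandwich M S X Y" "sandwich M S Y ((-1) \<cdot>\<^sub>m X) = - sandwich M S Y X"
    by (simp_all add: sandwich_def del: assoc_mult_mat)
qed

text \<open>Positivity of the form at the difference of \<open>X\<close> and \<open>Y\<close> bounds
  the cross terms. Compared with Cauchy-Schwarz it costs a factor 2 but keeps all errors linear in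
  the failure probabilities.\<close>

lemma sandwich_parallelogram:
  assumes "psd N M" "psd N S" "X \<in> carrier_mat N N" "Y \<in> carrier_mat N N"
  shows "Re (sandwich M S (X + Y) (X + Y)) \<le> 2 * Re (sandwich M S X X) + 2 * Re (sandwich M S Y Y)"
proof -
  note c = psd_carrier[OF assms(1)] psd_carrier[OF assms(2)]
  have m: "(-1) \<cdot>\<^sub>m Y \<in> carrier_mat N N" using assms by simp
  have "0 \<le> Re (sandwich M S (X + (-1) \<cdot>\<^sub>m Y) (X + (-1) \<cdot>\<^sub>m Y))"
    by (rule sandwich_nonneg[OF assms(1,2)]) (use assms in auto)
  also have "sandwich M S (X + (-1) \<cdot>\<^sub>m Y) (X + (-1) \<cdot>\<^sub>m Y)
     = sandwich M S X X - sandwich M S X Y - sandwich M S Y X + sandwich M S Y Y"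
    using assms m by (simp add: sandwich_add[OF c] sandwich_uminus[OF c])
  finally have "Re (sandwich M S X Y) + Re (sandwich M S Y X) \<le> Re (sandwich M S X X) + Re (sandwich M S Y Y)" by simp
  moreover have "sandwich M S (X + Y) (X + Y) = sandwich M S X X + sandwich M S X Y + sandwich M S Y X + sandwich M S Y Y"
    using assms by (simp add: sandwich_add[OF c])
  ultimately show ?thesis by simp
qed

lemma sandwich_mono:
  assumes "psd N (1\<^sub>m N - M)" "M \<in> carrier_mat N N" "psd N S" "X \<in> carrier_mat N N"
  shows "Re (sandwich M S X X) \<le> Re (sandwich (1\<^sub>m N) S X X)"
  using expval_mono[OF assms(1) psd_conj'[OF assms(3,4)] assms(2) one_carrier_mat]
  by (simp add: expval_def sandwich_def)

section \<open>Projectors and their consecutive use as tests\<close>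

definition projector :: "nat \<Rightarrow> complex mat \<Rightarrow> bool" where
  "projector N P \<longleftrightarrow> P \<in> carrier_mat N N \<and> adj P = P \<and> P * P = P"

lemma projectorD: "projector N P \<Longrightarrow> P \<in> carrier_mat N N" "projector N P \<Longrightarrow> adj P = P" "projector N P \<Longrightarrow> P * P = P"
  by (auto simp: projector_def)

lemma projector_psd: "projector N P \<Longrightarrow> psd N P"
  using psd_gram[of P N N] by (simp add: projector_def)

lemma projector_compl:
  assumes "projector N P" shows "projector N (1\<^sub>m N - P)"
proof -
  note P = projectorD[OF assms]
  have "(1\<^sub>m N - P) * (1\<^sub>m N - P) = 1\<^sub>m N * (1\<^sub>m N - P) - P * (1\<^sub>m N - P)"
    by (rule minus_mult_distrib_mat[of _ N N _ _ N]) (use P in auto)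
  also have "P * (1\<^sub>m N - P) = P * 1\<^sub>m N - P * P"
    by (rule mult_minus_distrib_mat[of _ N N _ N]) (use P in auto)
  also have "\<dots> = 0\<^sub>m N N" using P by auto
  finally have "(1\<^sub>m N - P) * (1\<^sub>m N - P) = 1\<^sub>m N - P" using P by auto
  then show ?thesis using P by (auto simp: projector_def adj_minus[of _ N N])
qed

lemma projector_spec:
  assumes "unitary N U" shows "projector N (spec N U (\<lambda>x. of_bool (T x)))"
  unfolding projector_def using assms by (auto simp: spec_mult intro!: spec_cong)

lemma compl_spec:
  assumes "unitary N U" shows "1\<^sub>m N - spec N U (\<lambda>x. of_bool (T x)) = spec N U (\<lambda>x. of_bool (\<not> T x))"
  unfolding spec_one[OF assms, symmetric] spec_minus[OF assms] by (rule spec_cong) auto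

lemma sandwich_one_projector:
  assumes "projector N P" "psd N S"
  shows "Re (sandwich (1\<^sub>m N) S P P) = expval S P"
proof -
  note P = projectorD[OF assms(1)] and S = psd_carrier[OF assms(2)]
  have "mtrace (P * S * P) = mtrace (P * (P * S))" using P S by (intro mtrace_comm[of _ N N]) auto
  also have "P * (P * S) = P * P * S" using P(1) S by (auto simp: mat_assoc)
  finally have "mtrace (P * S * P) = mtrace (P * S)" using P by simp
  moreover have "1\<^sub>m N * (P * S * P) = P * S * P" using P(1) S by auto
  ultimately show ?thesis using P by (simp add: sandwich_def expval_def)
qed

lemma sandwich_projector_one:
  assumes "M \<in> carrier_mat N N" "S \<in> carrier_mat N N"
  shows "sandwich M S (1\<^sub>m N) (1\<^sub>m N) = mtrace (M * S)"
  using assms by (simp add: sandwich_def)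

lemma psd_one_minus_projector: "projector N P \<Longrightarrow> psd N (1\<^sub>m N - P)"
  using projector_psd projector_compl by blast

(* The error is linear in the two failure probabilities because 1 - ABA = (1 - A) + A(1 - B)A and
   A = 1 - (1 - A), so the parallelogram inequality applies to the last summand. *)
lemma two_projector_test:
  assumes A: "projector N A" and B: "projector N B" and S: "S \<in> density N"
  shows "psd N (A * B * A)" "psd N (1\<^sub>m N - A * B * A)"
    "expval S (1\<^sub>m N - A * B * A) \<le> 3 * expval S (1\<^sub>m N - A) + 2 * expval S (1\<^sub>m N - B)"
proof -
  define P where "P = 1\<^sub>m N - A"
  define Q where "Q = 1\<^sub>m N - B"
  have P: "projector N P" and Q: "projector N Q" unfolding P_def Q_def by (rule projector_compl[OF A], rule projector_compl[OF B])
  note Ac = projectorD[OF A] and Bc = projectorD[OF B] and Pc = projectorD[OF P] and Qc = projectorD[OF Q]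
  note S' = densityD[OF S]
  show "psd N (A * B * A)" using psd_conj[OF projector_psd[OF B] Ac(1)] Ac(2) by simp
  have "A * Q * A = A * (1\<^sub>m N - B) * A" by (simp add: Q_def)
  also have "A * (1\<^sub>m N - B) = A - A * B"
    using Ac Bc by (subst mult_minus_distrib_mat[of _ N N _ N]) auto
  also have "(A - A * B) * A = A * A - A * B * A"
    by (rule minus_mult_distrib_mat[of _ N N _ _ N]) (use Ac Bc in auto)
  finally have AQA: "A * Q * A = A - A * B * A" using Ac by simp
  have ABA: "A * B * A \<in> carrier_mat N N" "A * Q * A \<in> carrier_mat N N" using Ac(1) Bc(1) Qc(1) by auto
  have eq: "1\<^sub>m N - A * B * A = P + A * Q * A"
    unfolding AQA P_def using ABA Ac(1) by (intro eq_matI) auto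
  have pAQA: "psd N (A * Q * A)" using psd_conj[OF projector_psd[OF Q] Ac(1)] Ac(2) by simp
  show "psd N (1\<^sub>m N - A * B * A)" unfolding eq by (rule psd_add[OF projector_psd[OF P] pAQA])
  have mP: "(-1) \<cdot>\<^sub>m P \<in> carrier_mat N N" using Pc by simp
  have AP: "1\<^sub>m N + (-1) \<cdot>\<^sub>m P = A" unfolding P_def using Ac(1) by (intro eq_matI) auto
  have "expval S (A * Q * A) = Re (sandwich Q S A A)"
  proof -
    have "mtrace (A * Q * A * S) = mtrace (A * (Q * A * S))" using Ac(1) Qc(1) S' by (simp add: mat_assoc)
    also have "\<dots> = mtrace (Q * A * S * A)" using Ac(1) Qc(1) S' by (intro mtrace_comm[of _ N N]) auto
    also have "Q * A * S * A = Q * (A * S * A)" using Ac(1) Qc(1) S' by (auto simp: mat_assoc)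
    finally show ?thesis by (simp add: expval_def sandwich_def Ac(2))
  qed
  also have "Re (sandwich Q S A A)
      \<le> 2 * Re (sandwich Q S (1\<^sub>m N) (1\<^sub>m N)) + 2 * Re (sandwich Q S ((-1) \<cdot>\<^sub>m P) ((-1) \<cdot>\<^sub>m P))"
    using sandwich_parallelogram[OF projector_psd[OF Q] S'(1) one_carrier_mat mP] unfolding AP .
  also have "sandwich Q S ((-1) \<cdot>\<^sub>m P) ((-1) \<cdot>\<^sub>m P) = sandwich Q S P P"
    using sandwich_uminus(1)[OF Qc(1) S'(2) Pc(1) mP] sandwich_uminus(2)[OF Qc(1) S'(2) Pc(1) Pc(1)] by simp
  also have "Re (sandwich Q S P P) \<le> expval S P"
    using sandwich_mono[OF psd_one_minus_projector[OF Q] Qc(1) S'(1) Pc(1)] sandwich_one_projector[OF P S'(1)] by simp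
  also have "Re (sandwich Q S (1\<^sub>m N) (1\<^sub>m N)) = expval S Q"
    by (simp add: sandwich_projector_one[OF Qc(1) S'(2)] expval_def)
  finally have "expval S (A * Q * A) \<le> 2 * expval S Q + 2 * expval S P" by simp
  then show "expval S (1\<^sub>m N - A * B * A) \<le> 3 * expval S (1\<^sub>m N - A) + 2 * expval S (1\<^sub>m N - B)"
    unfolding eq P_def[symmetric] Q_def[symmetric] using expval_add[OF Pc(1) ABA(2) S'(2)] by simp
qed

text \<open>Write 1 as AB + (1 - A) + A(1 - B) and apply the parallelogram inequality twice, whence
  the coefficients 2 and 4. In the main term \<open>B\<close> can cap the state and \<open>A\<close>
  can compare with the second state.\<close>

lemma two_projector_converse:
  assumes A: "projector N A" and B: "projector N B" and S: "S \<in> density N"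
    and M: "psd N M" "psd N (1\<^sub>m N - M)"
  shows "expval S M \<le> 2 * Re (sandwich M S (A * B) (A * B)) + 4 * expval S (1\<^sub>m N - A) + 4 * expval S (1\<^sub>m N - B)"
proof -
  define P where "P = 1\<^sub>m N - A"
  define Q where "Q = 1\<^sub>m N - B"
  have P: "projector N P" and Q: "projector N Q" unfolding P_def Q_def by (rule projector_compl[OF A], rule projector_compl[OF B])
  note Ac = projectorD[OF A] and Bc = projectorD[OF B] and Pc = projectorD[OF P] and Qc = projectorD[OF Q]
  note S' = densityD[OF S] and Mc = psd_carrier[OF M(1)]
  have AQ: "A * Q = A - A * B" unfolding Q_def
    using Ac Bc by (subst mult_minus_distrib_mat[of _ N N _ N]) auto
  have ABc: "A * B \<in> carrier_mat N N" "A * Q \<in> carrier_mat N N" using Ac Bc Qc by auto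
  have one: "1\<^sub>m N = A * B + (P + A * Q)" unfolding AQ P_def using ABc Ac(1) by (intro eq_matI) auto
  have PAQ: "P + A * Q \<in> carrier_mat N N" using Pc ABc by auto
  have "expval S M = Re (sandwich M S (1\<^sub>m N) (1\<^sub>m N))"
    by (simp add: sandwich_projector_one[OF Mc S'(2)] expval_def)
  also have "\<dots> \<le> 2 * Re (sandwich M S (A * B) (A * B)) + 2 * Re (sandwich M S (P + A * Q) (P + A * Q))"
    unfolding one by (rule sandwich_parallelogram[OF M(1) S'(1) ABc(1) PAQ])
  also have "Re (sandwich M S (P + A * Q) (P + A * Q)) \<le> Re (sandwich (1\<^sub>m N) S (P + A * Q) (P + A * Q))"
    by (rule sandwich_mono[OF M(2) Mc S'(1) PAQ])
  also have "\<dots> \<le> 2 * Re (sandwich (1\<^sub>m N) S P P) + 2 * Re (sandwich (1\<^sub>m N) S (A * Q) (A * Q))"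
    by (rule sandwich_parallelogram[OF psd_one S'(1) Pc(1) ABc(2)])
  also have "Re (sandwich (1\<^sub>m N) S P P) = expval S P" by (rule sandwich_one_projector[OF P S'(1)])
  \<comment> \<open>Cyclicity removes one of the two outer copies of \<open>A\<close>; the remaining
    one acts as an effect below 1.\<close>
  also have "Re (sandwich (1\<^sub>m N) S (A * Q) (A * Q)) = Re (sandwich A S Q Q)"
  proof -
    have "A * Q * S * adj (A * Q) = A * (Q * S * Q) * A"
      using Ac(1,2) Qc(1,2) S' by (auto simp: mat_norm)
    then have "sandwich (1\<^sub>m N) S (A * Q) (A * Q) = mtrace (A * (Q * S * Q) * A)"
      using Ac(1) Qc(1) S' ABc by (auto simp: sandwich_def)
    also have "\<dots> = mtrace (A * (A * (Q * S * Q)))" using Ac(1) Qc(1) S' by (intro mtrace_comm[of _ N N]) auto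
    also have "A * (A * (Q * S * Q)) = A * A * (Q * S * Q)" using Ac(1) Qc(1) S' by (auto simp: mat_assoc)
    finally show ?thesis using Ac(3) Qc(2) by (simp add: sandwich_def)
  qed
  also have "Re (sandwich A S Q Q) \<le> expval S Q"
    using sandwich_mono[OF psd_one_minus_projector[OF A] Ac(1) S'(1) Qc(1)] sandwich_one_projector[OF Q S'(1)] by simp
  finally show ?thesis unfolding P_def Q_def by simp
qed

section \<open>Typical projectors\<close>

text \<open>The trace of a tensor power of a diagonal matrix, computed in two ways.\<close>

lemma sum_prod_digits:
  "(\<Sum>x<d ^ n. \<Prod>k<n. g (digit d n x k)) = (\<Sum>i<d. g i :: real) ^ n"
proof -
  have "complex_of_real (\<Sum>x<d ^ n. \<Prod>k<n. g (digit d n x k)) = mtrace (tensor (\<lambda>_. diag_of d g) n)"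
    by (simp add: tensor_diag_of mtrace_def)
  also have "\<dots> = complex_of_real ((\<Sum>i<d. g i) ^ n)"
    by (subst mtrace_tensor[of _ _ d]) (auto simp: mtrace_def)
  finally show ?thesis by (simp only: of_real_eq_iff)
qed

lemma prod_exp_digits: "0 < n \<Longrightarrow> (\<Prod>k<n. exp (- f (digit d n x k))) = exp (- (real n * empirical d n f x))"
  by (simp add: empirical_def exp_sum[symmetric] sum_negf)

lemma expval_spec_subadd:
  assumes U: "unitary N U" and S: "psd N S" and le: "\<And>x. x < N \<Longrightarrow> k x \<le> f x + g x"
  shows "expval S (spec N U k) \<le> expval S (spec N U f) + expval S (spec N U g)"
proof -
  have p: "0 \<le> Re ((adj U * S * U) $$ (x,x))" if "x < N" for x
    by (rule psd_diag_nonneg[OF psd_conj[OF S unitary_carrier[OF U]] that])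
  show ?thesis
    unfolding expval_spec[OF U psd_carrier[OF S]] sum.distrib[symmetric] distrib_right[symmetric]
    by (intro sum_mono mult_right_mono) (use le p in auto)
qed

lemma expval_spec_const:
  assumes "unitary N U" "S \<in> carrier_mat N N"
  shows "expval S (spec N U (\<lambda>_. c)) = c * Re (mtrace S)"
proof -
  have "expval S (spec N U (\<lambda>_. c)) = expval S (complex_of_real c \<cdot>\<^sub>m 1\<^sub>m N)"
    using spec_smult[OF assms(1), of c "\<lambda>_. 1"] spec_one[OF assms(1)] by simp
  also have "\<dots> = c * expval S (1\<^sub>m N)" by (rule expval_smult) (use assms in auto)
  finally show ?thesis using expval_one[OF assms(2)] by simp
qed

lemma expval_spec_mono:
  assumes "unitary N U" "psd N S" "\<And>x. x < N \<Longrightarrow> f x \<le> g x"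
  shows "expval S (spec N U f) \<le> expval S (spec N U g)"
  by (rule expval_mono[OF spec_psd_le[OF assms(1,3)] assms(2)]) (use assms in auto)

text \<open>Compressing by \<open>A\<close> caps the power of the second state by
  \<open>exp (- (real n * (a - \<delta>)))\<close>, so its weight in \<open>A * B * A\<close> is at
  most this cap times the rank of \<open>B\<close>. That \<open>exp (- f)\<close> only dominates
  \<open>l\<close>, and that the weights \<open>exp (- h)\<close> only sum to at most 1, makes room
  for regularised logarithms. The factor 5 is 3 + 2 from \<open>two_projector_test\<close>.\<close>

lemma typical_test:
  fixes K v \<delta> :: real
  assumes U: "unitary d U" and V: "unitary d V" and S: "S \<in> density (d ^ n)"
    and n: "2 \<le> n" and d: "0 < d" and \<delta>: "0 < \<delta>"
    and l: "\<And>i. i < d \<Longrightarrow> 0 \<le> l i \<and> l i \<le> exp (- f i)"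
    and h: "(\<Sum>i<d. exp (- h i)) \<le> 1"
    and K: "\<And>i. i < d \<Longrightarrow> \<bar>f i\<bar> \<le> K" "\<And>i. i < d \<Longrightarrow> \<bar>h i\<bar> \<le> K"
    and f1: "\<And>k. k < n \<Longrightarrow> expval S (site d n (spec d U f) k) = a"
    and f2: "\<And>k j. k < n \<Longrightarrow> j < n \<Longrightarrow> k \<noteq> j \<Longrightarrow> expval S (site2 d n (spec d U f) k (spec d U f) j) = ca"
    and h1: "\<And>k. k < n \<Longrightarrow> expval S (site d n (spec d V h) k) = b"
    and h2: "\<And>k j. k < n \<Longrightarrow> j < n \<Longrightarrow> k \<noteq> j \<Longrightarrow> expval S (site2 d n (spec d V h) k (spec d V h) j) = cb"
    and v: "ca - a\<^sup>2 \<le> v" "cb - b\<^sup>2 \<le> v"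
  shows "\<exists>M. psd (d ^ n) M \<and> psd (d ^ n) (1\<^sub>m (d ^ n) - M) \<and>
    expval S (1\<^sub>m (d ^ n) - M) \<le> 5 * ((2 * K\<^sup>2 / real n + v) / \<delta>\<^sup>2) \<and>
    expval (tpow (spec d U l) n) M \<le> exp (- (real n * (a - b - 2 * \<delta>)))"
proof -
  let ?N = "d ^ n"
  define TA where "TA = (\<lambda>x. \<not> \<delta> < \<bar>empirical d n f x - a\<bar>)"
  define TB where "TB = (\<lambda>x. \<not> \<delta> < \<bar>empirical d n h x - b\<bar>)"
  note Un = unitary_tpow[OF U, of n] and Vn = unitary_tpow[OF V, of n]
  define A where "A = spec ?N (tpow U n) (\<lambda>x. of_bool (TA x))"
  define B where "B = spec ?N (tpow V n) (\<lambda>x. of_bool (TB x))"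
  have A: "projector ?N A" unfolding A_def by (rule projector_spec[OF Un])
  have B: "projector ?N B" unfolding B_def by (rule projector_spec[OF Vn])
  note Ac = projectorD[OF A] and Bc = projectorD[OF B]
  note t = two_projector_test[OF A B S]
  have eA: "expval S (1\<^sub>m ?N - A) \<le> (2 * K\<^sup>2 / real n + v) / \<delta>\<^sup>2"
    unfolding A_def compl_spec[OF Un] TA_def not_not
    by (rule chebyshev_empirical[OF U S n d \<delta> K(1) f1 f2 v(1)])
  have eB: "expval S (1\<^sub>m ?N - B) \<le> (2 * K\<^sup>2 / real n + v) / \<delta>\<^sup>2"
    unfolding B_def compl_spec[OF Vn] TB_def not_not
    by (rule chebyshev_empirical[OF V S n d \<delta> K(2) h1 h2 v(2)])
  define r where "r = (\<lambda>x. \<Prod>k<n. l (digit d n x k))"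
  define R where "R = spec ?N (tpow U n) r"
  have Rt: "tpow (spec d U l) n = R" unfolding R_def r_def by (rule tpow_spec[OF U])
  have Rc: "R \<in> carrier_mat ?N ?N" unfolding R_def using Un by simp
  define c where "c = exp (- (real n * (a - \<delta>)))"
  define ARA where "ARA = spec ?N (tpow U n) (\<lambda>x. of_bool (TA x) * r x * of_bool (TA x))"
  have ARA: "A * R * A = ARA" unfolding ARA_def A_def R_def by (simp add: spec_mult[OF Un])
  have ARAc: "ARA \<in> carrier_mat ?N ?N" unfolding ARA_def using Un by simp
  have le: "of_bool (TA x) * r x * of_bool (TA x) \<le> c" for x
  proof (cases "TA x")
    case True
    have "r x \<le> (\<Prod>k<n. exp (- f (digit d n x k)))"
      unfolding r_def by (rule prod_mono) (use l digit_less[OF d] in auto)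
    also have "\<dots> = exp (- (real n * empirical d n f x))" using n by (intro prod_exp_digits) simp
    also have "\<dots> \<le> c" using True unfolding c_def TA_def by (simp add: mult_left_mono)
    finally show ?thesis using True by simp
  qed (simp add: c_def)
  have "mtrace (A * B * A * R) = mtrace (A * (B * A * R))" using Ac(1) Bc(1) Rc by (simp add: mat_assoc)
  also have "\<dots> = mtrace (B * A * R * A)" using Ac(1) Bc(1) Rc by (intro mtrace_comm[of _ ?N ?N]) auto
  also have "B * A * R * A = B * ARA" unfolding ARA[symmetric] using Ac(1) Bc(1) Rc by (auto simp: mat_assoc)
  finally have "expval R (A * B * A) = expval ARA B" by (simp add: expval_def)
  also have "\<dots> = expval B ARA" by (rule expval_comm[OF Bc(1) ARAc])
  also have "\<dots> \<le> expval B (spec ?N (tpow U n) (\<lambda>_. c))"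
    unfolding ARA_def by (rule expval_spec_mono[OF Un projector_psd[OF B] le])
  also have "\<dots> = c * (\<Sum>x<?N. of_bool (TB x))"
    unfolding expval_spec_const[OF Un Bc(1)] by (simp add: B_def mtrace_spec[OF Vn])
  also have "\<dots> \<le> c * exp (real n * (b + \<delta>))"
  proof (rule mult_left_mono)
    \<comment> \<open>Counting argument: an index in \<open>TB\<close> has weight at least
      \<open>exp (- (real n * (b + \<delta>)))\<close> under the product weights
      \<open>exp (- h)\<close>, whose total is at most 1.\<close>
    have "(\<Sum>x<?N. of_bool (TB x)) \<le> (\<Sum>x<?N. exp (real n * (b + \<delta>)) * (\<Prod>k<n. exp (- h (digit d n x k))))"
    proof (rule sum_mono)
      fix x
      have "1 \<le> exp (real n * (b + \<delta>)) * exp (- (real n * empirical d n h x))" if "TB x"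
        using that n unfolding TB_def exp_add[symmetric] by (simp add: mult_left_mono)
      then show "of_bool (TB x) \<le> exp (real n * (b + \<delta>)) * (\<Prod>k<n. exp (- h (digit d n x k)))"
        using n by (simp add: prod_exp_digits)
    qed
    also have "\<dots> = exp (real n * (b + \<delta>)) * (\<Sum>i<d. exp (- h i)) ^ n"
      using sum_prod_digits[of "\<lambda>i. exp (- h i)"] by (simp add: sum_distrib_left[symmetric])
    also have "\<dots> \<le> exp (real n * (b + \<delta>)) * 1"
      by (intro mult_left_mono power_le_one h sum_nonneg) auto
    finally show "(\<Sum>x<?N. of_bool (TB x)) \<le> exp (real n * (b + \<delta>))" by simp
  qed (simp add: c_def)
  also have "\<dots> = exp (- (real n * (a - b - 2 * \<delta>)))"
    unfolding c_def exp_add[symmetric] by (simp add: algebra_simps)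
  finally have "expval (tpow (spec d U l) n) (A * B * A) \<le> exp (- (real n * (a - b - 2 * \<delta>)))" unfolding Rt .
  moreover have "expval S (1\<^sub>m ?N - A * B * A) \<le> 5 * ((2 * K\<^sup>2 / real n + v) / \<delta>\<^sup>2)"
  proof -
    have "x \<le> 5 * e" if "x \<le> 3 * p + 2 * q" "p \<le> e" "q \<le> e" for x p q e :: real using that by simp
    from this[OF t(3) eA eB] show ?thesis .
  qed
  ultimately show ?thesis using t(1,2) by blast
qed

section \<open>Strong converse for tensor powers\<close>

lemma tpow_density:
  assumes "\<sigma> \<in> density d" shows "tpow \<sigma> n \<in> density (d ^ n)"
proof (induction n)
  case 0
  show ?case using psd_one[of 1] by (simp add: density_def mtrace_def)
next
  case (Suc n)
  then show ?case
    using psd_kron[of "d ^ n" "tpow \<sigma> n" d \<sigma>] densityD[OF assms] densityD[OF Suc]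
    by (simp add: density_def mtrace_kron[of _ "d ^ n" _ d] mult.commute)
qed

lemma mtrace_tensor_tpow:
  assumes "\<And>k. k < n \<Longrightarrow> As k \<in> carrier_mat d d" "\<sigma> \<in> carrier_mat d d"
  shows "mtrace (tensor As n * tpow \<sigma> n) = (\<Prod>k<n. mtrace (As k * \<sigma>))"
  unfolding tensor_const[symmetric] using assms
  by (subst tensor_mult[of _ _ d], simp_all, subst mtrace_tensor[of _ _ d], auto intro!: mult_carrier_mat[of _ d d])

lemma expval_site_tpow:
  assumes s: "\<sigma> \<in> density d" and A: "hermitian d A" and k: "k < n"
  shows "expval (tpow \<sigma> n) (site d n A k) = expval \<sigma> A"
proof -
  note s' = densityD[OF s] and Ac = hermitian_carrier[OF A]
  have "mtrace (site d n A k * tpow \<sigma> n) = (\<Prod>j<n. mtrace (((\<lambda>_. 1\<^sub>m d)(k := A)) j * \<sigma>))"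
    unfolding site_def using s' Ac by (intro mtrace_tensor_tpow) auto
  also have "\<dots> = (\<Prod>j<n. if j = k then mtrace (A * \<sigma>) else 1)"
    using s' by (intro prod.cong) auto
  also have "\<dots> = mtrace (A * \<sigma>)" using k by simp
  finally show ?thesis by (simp add: expval_def)
qed

lemma expval_site2_tpow:
  assumes s: "\<sigma> \<in> density d" and A: "hermitian d A" and k: "k < n" "l < n" "k \<noteq> l"
  shows "expval (tpow \<sigma> n) (site2 d n A k A l) = (expval \<sigma> A)\<^sup>2"
proof -
  note s' = densityD[OF s] and Ac = hermitian_carrier[OF A]
  have "mtrace (site2 d n A k A l * tpow \<sigma> n) = (\<Prod>j<n. mtrace (((\<lambda>_. 1\<^sub>m d)(k := A, l := A)) j * \<sigma>))"
    unfolding site2_def using s' Ac by (intro mtrace_tensor_tpow) auto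
  also have "\<dots> = (\<Prod>j<n. (if j = k then mtrace (A * \<sigma>) else 1) * (if j = l then mtrace (A * \<sigma>) else 1))"
    using s' k by (intro prod.cong) auto
  also have "\<dots> = mtrace (A * \<sigma>) * mtrace (A * \<sigma>)" using k by (simp add: prod.distrib)
  also have "\<dots> = complex_of_real ((expval \<sigma> A)\<^sup>2)"
    using mtrace_hermitian_mult_real[OF A psd_hermitian[OF s'(1)]] by (simp add: power2_eq_square)
  finally show ?thesis by (simp add: expval_def)
qed

(* Eigenvalue 0 of rho contributes the junk value ln 0 = 0 to the observable; the hypothesis ker says
   that sigma gives it no weight. *)
lemma stein_converse:
  fixes K \<delta> :: real
  assumes U: "unitary d U" and V: "unitary d V" and \<sigma>: "spec d V s \<in> density d"
    and n: "2 \<le> n" and d: "0 < d" and \<delta>: "0 < \<delta>"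
    and l: "\<And>i. i < d \<Longrightarrow> 0 \<le> l i" and s: "\<And>i. i < d \<Longrightarrow> 0 \<le> s i"
    and ker: "expval (spec d V s) (spec d U (\<lambda>i. of_bool (l i = 0))) = 0"
    and K: "\<And>i. i < d \<Longrightarrow> \<bar>ln (l i)\<bar> \<le> K" "\<And>i. i < d \<Longrightarrow> \<bar>ln (s i)\<bar> \<le> K"
    and a: "a = expval (spec d V s) (spec d U (\<lambda>i. - ln (l i)))"
    and b: "b = expval (spec d V s) (spec d V (\<lambda>i. - ln (s i)))"
    and M: "psd (d ^ n) M" "psd (d ^ n) (1\<^sub>m (d ^ n) - M)"
  shows "expval (tpow (spec d V s) n) M
    \<le> 2 * exp (real n * (a - b + 2 * \<delta>)) * expval (tpow (spec d U l) n) M + 16 * K\<^sup>2 / (real n * \<delta>\<^sup>2)"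
proof -
  let ?N = "d ^ n"
  define S where "S = tpow (spec d V s) n"
  have S: "S \<in> density ?N" unfolding S_def by (rule tpow_density[OF \<sigma>])
  note S' = densityD[OF S]
  note Un = unitary_tpow[OF U, of n] and Vn = unitary_tpow[OF V, of n]
  define f where "f = (\<lambda>i. - ln (l i))"
  define h where "h = (\<lambda>i. - ln (s i))"
  define r where "r = (\<lambda>x. \<Prod>k<n. l (digit d n x k))"
  define R where "R = spec ?N (tpow U n) r"
  have Rt: "tpow (spec d U l) n = R" unfolding R_def r_def by (rule tpow_spec[OF U])
  define q where "q = (\<lambda>x. \<Prod>k<n. s (digit d n x k))"
  have Sq: "S = spec ?N (tpow V n) q" unfolding S_def q_def by (rule tpow_spec[OF V])
  have r0: "0 \<le> r x" "0 \<le> q x" for x unfolding r_def q_def by (rule prod_nonneg, use l s digit_less[OF d] in auto)+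
  \<comment> \<open>Indices with \<open>r x = 0\<close> are excluded: there \<open>f\<close> is
    built from the value 0 of \<open>ln 0\<close>, and the lower bound on \<open>r\<close> would
    fail.\<close>
  define TA where "TA = (\<lambda>x. \<not> \<delta> < \<bar>empirical d n f x - a\<bar> \<and> r x \<noteq> 0)"
  define TB where "TB = (\<lambda>x. \<not> \<delta> < \<bar>empirical d n h x - b\<bar>)"
  define A where "A = spec ?N (tpow U n) (\<lambda>x. of_bool (TA x))"
  define B where "B = spec ?N (tpow V n) (\<lambda>x. of_bool (TB x))"
  have A: "projector ?N A" unfolding A_def by (rule projector_spec[OF Un])
  have B: "projector ?N B" unfolding B_def by (rule projector_spec[OF Vn])
  note Ac = projectorD[OF A] and Bc = projectorD[OF B] and Mc = psd_carrier[OF M(1)]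
  let ?e = "(2 * K\<^sup>2 / real n + 0) / \<delta>\<^sup>2"
  \<comment> \<open>In a tensor power the two-site moment is exactly the square of the one-site
    moment, so Chebyshev applies with covariance bound 0.\<close>
  have eB: "expval S (1\<^sub>m ?N - B) \<le> ?e"
    unfolding B_def compl_spec[OF Vn] TB_def not_not
    by (rule chebyshev_empirical[OF V S n d \<delta>, of h K b "b\<^sup>2" 0])
       (auto simp: S_def expval_site_tpow[OF \<sigma> spec_hermitian[OF V]] expval_site2_tpow[OF \<sigma> spec_hermitian[OF V]] b h_def K)
  have eA1: "expval S (spec ?N (tpow U n) (\<lambda>x. of_bool (\<delta> < \<bar>empirical d n f x - a\<bar>))) \<le> ?e"
    by (rule chebyshev_empirical[OF U S n d \<delta>, of f K a "a\<^sup>2" 0])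
       (auto simp: S_def expval_site_tpow[OF \<sigma> spec_hermitian[OF U]] expval_site2_tpow[OF \<sigma> spec_hermitian[OF U]] a f_def K)
  \<comment> \<open>Union bound over sites: a vanishing product has a vanishing factor, and by
    \<open>ker\<close> no site carries weight there.\<close>
  have eA2: "expval S (spec ?N (tpow U n) (\<lambda>x. of_bool (r x = 0))) \<le> 0"
  proof -
    define p where "p = (\<lambda>x. Re ((adj (tpow U n) * S * tpow U n) $$ (x,x)))"
    have p0: "0 \<le> p x" if "x < ?N" for x
      unfolding p_def by (rule psd_diag_nonneg[OF psd_conj[OF S'(1) unitary_carrier[OF Un]] that])
    have "expval S (spec ?N (tpow U n) (\<lambda>x. of_bool (r x = 0))) = (\<Sum>x<?N. of_bool (r x = 0) * p x)"
      unfolding p_def by (rule expval_spec[OF Un S'(2)])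
    also have "\<dots> \<le> (\<Sum>x<?N. (\<Sum>k<n. of_bool (l (digit d n x k) = 0)) * p x)"
    proof (intro sum_mono mult_right_mono)
      fix x assume "x \<in> {..<?N}"
      then show "0 \<le> p x" using p0 by simp
      show "of_bool (r x = 0) \<le> (\<Sum>k<n. of_bool (l (digit d n x k) = 0) :: real)"
      proof (cases "r x = 0")
        case True
        then obtain k where k: "k < n" "l (digit d n x k) = 0" by (auto simp: r_def)
        then have "(1::real) = of_bool (l (digit d n x k) = 0)" by simp
        also have "\<dots> \<le> (\<Sum>k<n. of_bool (l (digit d n x k) = 0))"
          by (rule member_le_sum) (use k in auto)
        finally show ?thesis using True by simp
      qed (simp add: sum_nonneg)
    qed
    also have "\<dots> = (\<Sum>k<n. \<Sum>x<?N. of_bool (l (digit d n x k) = 0) * p x)"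
      by (subst sum.swap) (simp only: sum_distrib_right)
    also have "\<dots> = (\<Sum>k<n. expval S (site d n (spec d U (\<lambda>i. of_bool (l i = 0))) k))"
      unfolding p_def by (intro sum.cong refl expval_site_spec[OF U S'(2), symmetric]) auto
    also have "\<dots> = 0"
      by (simp add: S_def expval_site_tpow[OF \<sigma> spec_hermitian[OF U]] ker)
    finally show ?thesis .
  qed
  have eA: "expval S (1\<^sub>m ?N - A) \<le> ?e"
  proof -
    have "expval S (1\<^sub>m ?N - A) \<le> expval S (spec ?N (tpow U n) (\<lambda>x. of_bool (\<delta> < \<bar>empirical d n f x - a\<bar>)))
       + expval S (spec ?N (tpow U n) (\<lambda>x. of_bool (r x = 0)))"
      unfolding A_def compl_spec[OF Un] TA_def
      by (rule expval_spec_subadd[OF Un S'(1)]) auto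
    then show ?thesis using eA1 eA2 by simp
  qed
  define c where "c = exp (- (real n * (a + \<delta>)))"
  define c' where "c' = exp (- (real n * (b - \<delta>)))"
  define BSB where "BSB = spec ?N (tpow V n) (\<lambda>x. of_bool (TB x) * q x * of_bool (TB x))"
  have BSB: "B * S * B = BSB" unfolding BSB_def B_def Sq by (simp add: spec_mult[OF Vn])
  have BSBc: "BSB \<in> carrier_mat ?N ?N" unfolding BSB_def using Vn by simp
  \<comment> \<open>Where the product is nonzero every factor is positive, so each \<open>ln\<close>
    is genuine and the product is the exponential of an empirical mean.\<close>
  have explog: "(\<Prod>k<n. g (digit d n x k)) = exp (- (real n * empirical d n (\<lambda>i. - ln (g i)) x))"
    if "(\<Prod>k<n. g (digit d n x k)) \<noteq> 0" "\<And>i. i < d \<Longrightarrow> 0 \<le> g i" for g x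
  proof -
    have "0 < g (digit d n x k)" if "k < n" for k
      using that \<open>(\<Prod>k<n. g (digit d n x k)) \<noteq> 0\<close> \<open>\<And>i. i < d \<Longrightarrow> 0 \<le> g i\<close>[OF digit_less[OF d, of n x k]]
      by (auto simp: less_le)
    then have "(\<Prod>k<n. g (digit d n x k)) = (\<Prod>k<n. exp (- (- ln (g (digit d n x k)))))"
      by (intro prod.cong) auto
    also have "\<dots> = exp (- (real n * empirical d n (\<lambda>i. - ln (g i)) x))"
      using n by (intro prod_exp_digits) simp
    finally show ?thesis .
  qed
  have qle: "of_bool (TB x) * q x * of_bool (TB x) \<le> c'" for x
  proof (cases "TB x \<and> q x \<noteq> 0")
    case True
    then have "q x = exp (- (real n * empirical d n h x))"
      unfolding q_def h_def by (intro explog s) auto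
    also have "\<dots> \<le> c'" using True unfolding c'_def TB_def by (simp, intro mult_left_mono) auto
    finally show ?thesis using True by simp
  qed (auto simp: c'_def)
  have rge: "c * of_bool (TA x) \<le> r x" for x
  proof (cases "TA x")
    case True
    then have "r x = exp (- (real n * empirical d n f x))"
      unfolding r_def f_def TA_def by (intro explog l) auto
    moreover have "c \<le> exp (- (real n * empirical d n f x))"
      using True unfolding c_def TA_def by (simp, intro mult_left_mono) auto
    ultimately show ?thesis using True by simp
  qed (simp add: r0)
  have AMA: "psd ?N (A * M * A)" using psd_conj[OF M(1) Ac(1)] Ac(2) by simp
  have "sandwich M S (A * B) (A * B) = mtrace (M * (A * BSB * A))"
    unfolding sandwich_def BSB[symmetric] using Ac(1,2) Bc(1,2) Mc S'(2) by (auto simp: mat_norm)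
  also have "\<dots> = mtrace (M * A * BSB * A)" using Ac(1) Mc BSBc by (auto simp: mat_assoc)
  also have "\<dots> = mtrace (A * (M * A * BSB))" using Ac(1) Mc BSBc by (intro mtrace_comm[of _ ?N ?N]) auto
  also have "A * (M * A * BSB) = A * M * A * BSB" using Ac(1) Mc BSBc by (auto simp: mat_assoc)
  finally have "Re (sandwich M S (A * B) (A * B)) = expval BSB (A * M * A)" by (simp add: expval_def)
  also have "\<dots> = expval (A * M * A) BSB" by (rule expval_comm[OF psd_carrier[OF AMA] BSBc])
  \<comment> \<open>\<open>BSB\<close> is at most \<open>c'\<close>, and \<open>c\<close> times
    \<open>A\<close> is at most \<open>R\<close>; the quotient \<open>c' / c\<close> is the
    exponential factor in the claim.\<close>
  also have "\<dots> \<le> expval (A * M * A) (spec ?N (tpow V n) (\<lambda>_. c'))"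
    unfolding BSB_def by (rule expval_spec_mono[OF Vn AMA qle])
  also have "\<dots> = c' * Re (mtrace (A * M * A))" by (rule expval_spec_const[OF Vn psd_carrier[OF AMA]])
  also have "mtrace (A * M * A) = mtrace (A * (A * M))" using Ac(1) Mc by (intro mtrace_comm[of _ ?N ?N]) auto
  also have "A * (A * M) = A * A * M" using Ac(1) Mc by (auto simp: mat_assoc)
  finally have s1: "Re (sandwich M S (A * B) (A * B)) \<le> c' * expval M A" using Ac(3) by (simp add: expval_def)
  have "c * expval M A = expval M (spec ?N (tpow U n) (\<lambda>x. c * of_bool (TA x)))"
    unfolding A_def spec_smult[OF Un, symmetric] by (rule expval_smult[symmetric]) (use Un Mc in auto)
  also have "\<dots> \<le> expval M R" unfolding R_def by (rule expval_spec_mono[OF Un M(1) rge])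
  also have "\<dots> = expval R M" by (rule expval_comm) (use Un Mc R_def in auto)
  finally have "expval M A \<le> expval R M / c" by (simp add: c_def field_simps)
  then have "c' * expval M A \<le> c' * (expval R M / c)" by (intro mult_left_mono) (auto simp: c'_def)
  also have "\<dots> = exp (real n * (a - b + 2 * \<delta>)) * expval R M"
    unfolding c_def c'_def by (simp add: exp_minus[symmetric] exp_diff[symmetric] divide_inverse exp_add[symmetric] algebra_simps)
  finally have s2: "Re (sandwich M S (A * B) (A * B)) \<le> exp (real n * (a - b + 2 * \<delta>)) * expval R M" using s1 by simp
  have "expval S M \<le> 2 * Re (sandwich M S (A * B) (A * B)) + 4 * expval S (1\<^sub>m ?N - A) + 4 * expval S (1\<^sub>m ?N - B)"
    by (rule two_projector_converse[OF A B S M])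
  also have "\<dots> \<le> 2 * (exp (real n * (a - b + 2 * \<delta>)) * expval R M) + 4 * ?e + 4 * ?e"
  proof -
    have "2 * w + 4 * p + 4 * q \<le> 2 * z + 4 * e + 4 * e" if "w \<le> z" "p \<le> e" "q \<le> e" for w p q z e :: real
      using that by simp
    from this[OF s2 eA eB] show ?thesis .
  qed
  also have "\<dots> = 2 * exp (real n * (a - b + 2 * \<delta>)) * expval R M + 16 * K\<^sup>2 / (real n * \<delta>\<^sup>2)"
    using n \<delta> by (simp add: field_simps)
  finally show ?thesis unfolding S_def Rt .
qed

section \<open>Compactness of the set of free states\<close>

text \<open>Writing the state as a Gram matrix, trace 1 says that the squared entries of
  \<open>W\<close> sum to 1. The bound is crude, but any bound that is uniform over states gives
  compactness.\<close>

lemma density_entry_bound: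
  assumes "S \<in> density N" "i < N" "j < N"
  shows "cmod (S $$ (i,j)) \<le> real N"
proof -
  obtain W where W: "W \<in> carrier_mat N N" "S = adj W * W"
    using psd_gram_ex[OF densityD(1)[OF assms(1)]] .
  have e: "S $$ (i,j) = (\<Sum>k<N. cnj (W $$ (k,i)) * W $$ (k,j))" if "i < N" "j < N" for i j
    unfolding W(2) mult_index_sum[OF adj_carrier[OF W(1)] W(1) that] using W(1) that by (intro sum.cong) auto
  have "mtrace S = (\<Sum>i<N. S $$ (i,i))" using densityD(2)[OF assms(1)] by (simp add: mtrace_def)
  also have "\<dots> = complex_of_real (\<Sum>i<N. \<Sum>k<N. (cmod (W $$ (k,i)))\<^sup>2)"
    by (simp add: e mult.commute complex_norm_square del: of_real_power)
  finally have s1: "(\<Sum>i<N. \<Sum>k<N. (cmod (W $$ (k,i)))\<^sup>2) = 1"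
    using densityD(3)[OF assms(1)] by (metis of_real_eq_1_iff)
  have w1: "cmod (W $$ (k,i)) \<le> 1" if "k < N" "i < N" for k i
  proof -
    have "(cmod (W $$ (k,i)))\<^sup>2 \<le> (\<Sum>k<N. (cmod (W $$ (k,i)))\<^sup>2)"
      by (rule member_le_sum) (use that in auto)
    also have "\<dots> \<le> (\<Sum>i<N. \<Sum>k<N. (cmod (W $$ (k,i)))\<^sup>2)"
      by (rule member_le_sum[of i "{..<N}" "\<lambda>i. \<Sum>k<N. (cmod (W $$ (k,i)))\<^sup>2"]) (use that in \<open>auto intro: sum_nonneg\<close>)
    finally have "(cmod (W $$ (k,i)))\<^sup>2 \<le> 1" using s1 by simp
    then show ?thesis by (simp add: abs_square_le_1)
  qed
  have "cmod (S $$ (i,j)) \<le> (\<Sum>k<N. cmod (cnj (W $$ (k,i)) * W $$ (k,j)))"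
    unfolding e[OF assms(2,3)] by (rule norm_sum)
  also have "\<dots> \<le> (\<Sum>k<N. 1)"
    by (rule sum_mono) (use w1 assms in \<open>auto simp: norm_mult intro!: mult_le_one\<close>)
  finally show ?thesis by simp
qed

text \<open>The real coordinates enter linearly, so a strict inequality between an expectation value
  and a constant is an open condition.\<close>

lemma expval_index_sum:
  assumes "G \<in> carrier_mat N N" "S \<in> carrier_mat N N"
  shows "expval S G = (\<Sum>a<N. \<Sum>b<N. Re (G $$ (a,b)) * Re (S $$ (b,a)) - Im (G $$ (a,b)) * Im (S $$ (b,a)))"
proof -
  have "mtrace (G * S) = (\<Sum>a<N. \<Sum>b<N. G $$ (a,b) * S $$ (b,a))"
    using assms by (auto simp: mtrace_def mult_index_sum[OF assms] intro!: sum.cong simp del: index_mult_mat(1))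
  then show ?thesis by (simp add: expval_def)
qed

text \<open>A closed bounded set of matrices is compact and expectation values are continuous.
  States are embedded as real functions on index triples, with a flag for real or imaginary part and
  padding by 0, so that the surrounding box is compact by Tychonoff and closedness can be tested
  along sequences as in \<open>closed_set\<close>.\<close>

lemma finite_expval_cover:
  assumes F: "F \<subseteq> density N" "closed_set N F" and G: "\<And>i. i \<in> I \<Longrightarrow> G i \<in> carrier_mat N N"
    and cov: "\<And>\<omega>. \<omega> \<in> F \<Longrightarrow> \<exists>i\<in>I. t < expval \<omega> (G i)"
  shows "\<exists>J. finite J \<and> J \<subseteq> I \<and> (\<forall>\<omega>\<in>F. \<exists>i\<in>J. t < expval \<omega> (G i))"
proof -
  define emb :: "complex mat \<Rightarrow> nat \<times> nat \<times> bool \<Rightarrow> real" where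
    "emb = (\<lambda>\<omega> (i,j,c). if i < N \<and> j < N then (if c then Re (\<omega> $$ (i,j)) else Im (\<omega> $$ (i,j))) else 0)"
  define K where "K = emb ` F"
  have "compactin (product_topology (\<lambda>_. euclidean) UNIV) (Pi\<^sub>E UNIV (\<lambda>_ :: nat \<times> nat \<times> bool. {- real N..real N}))"
    unfolding compactin_PiE by (simp add: compact_Icc)
  then have cP: "compact (Pi\<^sub>E UNIV (\<lambda>_ :: nat \<times> nat \<times> bool. {- real N..real N}))"
    by (simp add: euclidean_product_topology)
  have bd: "\<bar>emb \<omega> (i,j,c)\<bar> \<le> real N" if "\<omega> \<in> F" for \<omega> i j c
    using density_entry_bound[of \<omega> N i j] abs_Re_le_cmod[of "\<omega> $$ (i,j)"] abs_Im_le_cmod[of "\<omega> $$ (i,j)"] F(1) that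
    by (auto simp: emb_def)
  have sub: "K \<subseteq> Pi\<^sub>E UNIV (\<lambda>_. {- real N..real N})"
  proof
    fix g assume "g \<in> K"
    then obtain \<omega> where w: "\<omega> \<in> F" "g = emb \<omega>" by (auto simp: K_def)
    have "g k \<in> {- real N..real N}" for k
      using bd[OF w(1)] w(2) by (cases k) (auto simp: abs_le_iff minus_le_iff)
    then show "g \<in> Pi\<^sub>E UNIV (\<lambda>_. {- real N..real N})" by (simp add: PiE_iff)
  qed
  have "closed K"
    unfolding closed_sequential_limits
  proof (intro allI impI, elim conjE)
    fix x l assume x: "\<forall>n. x n \<in> K" and lim: "x \<longlonglongrightarrow> l"
    have "\<forall>n. \<exists>X. X \<in> F \<and> x n = emb X" using x by (auto simp: K_def)
    then obtain X where X: "\<And>n. X n \<in> F" "\<And>n. x n = emb (X n)" by metis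
    have co: "(\<lambda>n. x n k) \<longlonglongrightarrow> l k" for k
      by (rule continuous_on_tendsto_compose[OF continuous_on_product_coordinates lim]) auto
    define S where "S = mat N N (\<lambda>(i,j). Complex (l (i,j,True)) (l (i,j,False)))"
    have "(\<lambda>n. X n $$ (i,j)) \<longlonglongrightarrow> S $$ (i,j)" if "i < N" "j < N" for i j
      using co[of "(i,j,True)"] co[of "(i,j,False)"] that
      by (simp add: X emb_def S_def tendsto_complex_iff)
    then have "S \<in> F" using F(2) X(1) unfolding closed_set_def S_def by fastforce
    moreover have "l = emb S"
    proof
      fix k :: "nat \<times> nat \<times> bool"
      obtain i j c where k: "k = (i,j,c)" by (cases k) auto
      show "l k = emb S k"
      proof (cases "i < N \<and> j < N")
        \<comment> \<open>Outside the block all coordinates along the sequence are 0, hence so is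
          the limit; this keeps the limit in the image of \<open>emb\<close>.\<close>
        case False
        then have "(\<lambda>n. x n k) = (\<lambda>n. 0)" by (auto simp: X emb_def k)
        then have "l k = 0" using co[of k] LIMSEQ_unique tendsto_const by metis
        then show ?thesis using False by (auto simp: emb_def k)
      qed (auto simp: emb_def S_def k)
    qed
    ultimately show "l \<in> K" by (simp add: K_def)
  qed
  then have "compact K" using compact_Int_closed[OF cP, of K] sub by (simp add: Int_absorb1 inf.absorb2)
  moreover define B where "B = (\<lambda>i. {g :: nat \<times> nat \<times> bool \<Rightarrow> real.
      t < (\<Sum>a<N. \<Sum>b<N. Re (G i $$ (a,b)) * g (b,a,True) - Im (G i $$ (a,b)) * g (b,a,False))})"
  have "open (B i)" for i
    unfolding B_def
    by (intro open_Collect_less continuous_intros continuous_on_product_coordinates)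
  have ev: "emb \<omega> \<in> B i \<longleftrightarrow> t < expval \<omega> (G i)" if "\<omega> \<in> F" "i \<in> I" for \<omega> i
    using expval_index_sum[OF G[OF that(2)], of \<omega>] densityD(2)[of \<omega> N] F(1) that
    by (auto simp: B_def emb_def)
  have "K \<subseteq> (\<Union>i\<in>I. B i)" using cov ev by (fastforce simp: K_def)
  ultimately obtain J where J: "J \<subseteq> I" "finite J" "K \<subseteq> (\<Union>i\<in>J. B i)"
    using compactE_image[of K I B] \<open>\<And>i. open (B i)\<close> by metis
  have "\<exists>i\<in>J. t < expval \<omega> (G i)" if "\<omega> \<in> F" for \<omega>
  proof -
    have "emb \<omega> \<in> K" using that by (simp add: K_def)
    then obtain i where "i \<in> J" "emb \<omega> \<in> B i" using J(3) by blast
    then show ?thesis using ev[OF that, of i] J(1) by blast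
  qed
  then show ?thesis using J by blast
qed

section \<open>Relative entropy\<close>

text \<open>The choice operator in \<open>mat_fun\<close> fixes some diagonalisation; extracting it
  together with the matrix puts \<open>A\<close> and its logarithm into one common basis.\<close>

lemma mat_log_spec:
  assumes "psd N A"
  obtains U l where "unitary N U" "\<And>i. i < N \<Longrightarrow> 0 \<le> l i" "A = spec N U l"
    "mat_log N A = spec N U (\<lambda>i. ln (l i))"
proof -
  let ?P = "\<lambda>B. \<exists>U l. unitary N U \<and> A = U * diag_of N l * adj U \<and> B = U * diag_of N (ln \<circ> l) * adj U"
  have "\<exists>B. ?P B" using hermitian_spectral[OF psd_hermitian[OF assms]] by blast
  then have "?P (mat_log N A)" unfolding mat_log_def mat_fun_def by (rule someI_ex)
  then obtain U l where U: "unitary N U" and A: "A = U * diag_of N l * adj U"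
    and L: "mat_log N A = U * diag_of N (ln \<circ> l) * adj U" by blast
  show ?thesis
    by (rule that[OF U, of l]) (use psd_eigenvalue_nonneg[OF _ U] assms A L in \<open>auto simp: spec_def comp_def\<close>)
qed

text \<open>With \<open>S = adj W * W\<close> the diagonal entry at \<open>i\<close> is the squared
  norm of \<open>W\<close> applied to the eigenvector, so it vanishes only if \<open>S\<close>
  annihilates that eigenvector. Inclusion of kernels thus reduces to finitely many diagonal
  entries.\<close>

lemma kernel_weight:
  assumes U: "unitary N U" and S: "psd N S"
  shows "(\<forall>v\<in>carrier_vec N. spec N U l *\<^sub>v v = 0\<^sub>v N \<longrightarrow> S *\<^sub>v v = 0\<^sub>v N)
    \<longleftrightarrow> (\<forall>i<N. l i = 0 \<longrightarrow> Re ((adj U * S * U) $$ (i,i)) = 0)"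
    (is "?L \<longleftrightarrow> ?R")
proof -
  note Uc = unitary_carrier[OF U] and Sc = psd_carrier[OF S]
  obtain W where W: "W \<in> carrier_mat N N" "S = adj W * W" using psd_gram_ex[OF S] .
  define Z where "Z = W * U"
  have Zc: "Z \<in> carrier_mat N N" using W Uc by (auto simp: Z_def)
  have "adj U * S * U = adj Z * Z" unfolding W(2) Z_def using W(1) Uc by (auto simp: mat_norm)
  then have q: "Re ((adj U * S * U) $$ (i,i)) = (\<Sum>k<N. (cmod (Z $$ (k,i)))\<^sup>2)" if "i < N" for i
    using mult_index_sum[OF adj_carrier[OF Zc] Zc that that] Zc that
    by (simp add: cmod_power2 flip: power2_eq_square)
  have sv: "(spec N U l *\<^sub>v v = 0\<^sub>v N) \<longleftrightarrow> (\<forall>i<N. l i = 0 \<or> (adj U *\<^sub>v v) $ i = 0)" if v: "v \<in> carrier_vec N" for v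
  proof -
    define w where "w = adj U *\<^sub>v v"
    have w: "w \<in> carrier_vec N" unfolding w_def using Uc v by (intro mult_mat_vec_carrier[of _ N N]) auto
    have Dw: "diag_of N l *\<^sub>v w \<in> carrier_vec N" using w by (intro mult_mat_vec_carrier[of _ N N]) auto
    have Di: "(diag_of N l *\<^sub>v w) $ i = complex_of_real (l i) * w $ i" if "i < N" for i
      unfolding mult_vec_index_sum[OF diag_of_carrier w that] using that
      by (subst sum.cong[OF refl, of _ _ "\<lambda>j. if j = i then complex_of_real (l i) * w $ i else 0"]) auto
    have "spec N U l *\<^sub>v v = (U * diag_of N l) *\<^sub>v w"
      unfolding spec_def w_def by (rule assoc_mult_mat_vec[of _ N N _ N]) (use Uc v in auto)
    also have "\<dots> = U *\<^sub>v (diag_of N l *\<^sub>v w)"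
      by (rule assoc_mult_mat_vec[of _ N N _ N]) (use Uc w in auto)
    finally have e: "spec N U l *\<^sub>v v = U *\<^sub>v (diag_of N l *\<^sub>v w)" .
    have "spec N U l *\<^sub>v v = 0\<^sub>v N \<longleftrightarrow> diag_of N l *\<^sub>v w = 0\<^sub>v N"
    proof
      assume "spec N U l *\<^sub>v v = 0\<^sub>v N"
      then have "adj U *\<^sub>v (U *\<^sub>v (diag_of N l *\<^sub>v w)) = adj U *\<^sub>v 0\<^sub>v N" using e by simp
      moreover have "adj U *\<^sub>v (U *\<^sub>v (diag_of N l *\<^sub>v w)) = (adj U * U) *\<^sub>v (diag_of N l *\<^sub>v w)"
        by (rule assoc_mult_mat_vec[symmetric, of _ N N _ N]) (use Uc Dw in auto)
      moreover have "adj U *\<^sub>v 0\<^sub>v N = 0\<^sub>v N" using Uc by (intro eq_vecI) auto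
      ultimately show "diag_of N l *\<^sub>v w = 0\<^sub>v N" using unitary_left[OF U] Dw by simp
    next
      assume "diag_of N l *\<^sub>v w = 0\<^sub>v N"
      then show "spec N U l *\<^sub>v v = 0\<^sub>v N" unfolding e using Uc by (intro eq_vecI) auto
    qed
    also have "\<dots> \<longleftrightarrow> (\<forall>i<N. (diag_of N l *\<^sub>v w) $ i = 0)"
      using Dw by (auto intro!: eq_vecI simp del: index_mult_mat_vec)
    also have "\<dots> \<longleftrightarrow> (\<forall>i<N. l i = 0 \<or> w $ i = 0)" by (simp add: Di del: index_mult_mat_vec)
    finally show ?thesis by (simp add: w_def)
  qed
  show ?thesis
  proof
    assume L: ?L
    show ?R
    proof (intro allI impI)
      fix i assume i: "i < N" "l i = 0"
      define v where "v = col U i"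
      have v: "v \<in> carrier_vec N" using Uc i by (auto simp: v_def)
      have "(adj U *\<^sub>v v) $ j = (adj U * U) $$ (j,i)" if "j < N" for j
        using Uc i that by (simp add: v_def)
      then have "spec N U l *\<^sub>v v = 0\<^sub>v N"
        unfolding sv[OF v] using i unitary_left[OF U] by (auto simp del: index_mult_mat_vec)
      then have Sv: "S *\<^sub>v v = 0\<^sub>v N" using L v by blast
      have SU: "(S * U) $$ (k,i) = 0" if "k < N" for k
      proof -
        have "(S * U) $$ (k,i) = (S *\<^sub>v v) $ k" using Sc Uc i that by (simp add: v_def)
        then show ?thesis using Sv that by simp
      qed
      have "adj U * S * U = adj U * (S * U)" using Uc Sc by (auto simp: mat_assoc)
      then have "(adj U * S * U) $$ (i,i) = (\<Sum>k<N. adj U $$ (i,k) * (S * U) $$ (k,i))"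
        using mult_index_sum[OF adj_carrier[OF Uc] mult_carrier_mat[OF Sc Uc] i(1) i(1)] by simp
      then show "Re ((adj U * S * U) $$ (i,i)) = 0" by (simp add: SU del: index_mult_mat(1))
    qed
  next
    assume R: ?R
    show ?L
    proof (intro ballI impI)
      fix v assume v: "v \<in> carrier_vec N" and rv: "spec N U l *\<^sub>v v = 0\<^sub>v N"
      define w where "w = adj U *\<^sub>v v"
      have w: "w \<in> carrier_vec N" unfolding w_def using Uc v by (intro mult_mat_vec_carrier[of _ N N]) auto
      have z: "Z $$ (k,i) * w $ i = 0" if "k < N" "i < N" for k i
      proof (cases "l i = 0")
        case True
        then have "(\<Sum>k<N. (cmod (Z $$ (k,i)))\<^sup>2) = 0" using R q that by simp
        then have "Z $$ (k,i) = 0" using that by (simp add: sum_nonneg_eq_0_iff del: index_mult_mat(1))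
        then show ?thesis by simp
      next
        case False
        then show ?thesis using rv that unfolding sv[OF v] w_def by auto
      qed
      have "v = U *\<^sub>v w"
        unfolding w_def using assoc_mult_mat_vec[of U N N "adj U" N v] Uc v unitary_right[OF U] by simp
      then have "W *\<^sub>v v = Z *\<^sub>v w" unfolding Z_def using assoc_mult_mat_vec[of W N N U N w] W(1) Uc w by simp
      also have "\<dots> = 0\<^sub>v N"
        using Zc w z by (intro eq_vecI) (auto simp: mult_vec_index_sum[OF Zc w] intro!: sum.neutral simp del: index_mult_mat_vec)
      finally have "W *\<^sub>v v = 0\<^sub>v N" .
      moreover have "S *\<^sub>v v = adj W *\<^sub>v (W *\<^sub>v v)"
        unfolding W(2) by (rule assoc_mult_mat_vec[of _ N N _ N]) (use W(1) v in auto)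
      ultimately show "S *\<^sub>v v = 0\<^sub>v N" using W(1) by (auto intro!: eq_vecI)
    qed
  qed
qed

lemma rel_ent_finite:
  assumes S: "\<sigma> \<in> density N" and R: "unitary N U" "\<rho> = spec N U l" "mat_log N \<rho> = spec N U (\<lambda>i. ln (l i))"
    and V: "unitary N V" "\<sigma> = spec N V s" "mat_log N \<sigma> = spec N V (\<lambda>i. ln (s i))"
    and fin: "rel_ent N \<sigma> \<rho> \<noteq> \<infinity>"
  shows "rel_ent N \<sigma> \<rho> = ereal (expval \<sigma> (spec N U (\<lambda>i. - ln (l i))) - expval \<sigma> (spec N V (\<lambda>i. - ln (s i))))"
    "\<And>i. i < N \<Longrightarrow> l i = 0 \<Longrightarrow> Re ((adj U * \<sigma> * U) $$ (i,i)) = 0"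
proof -
  note S' = densityD[OF S]
  have c: "\<forall>v\<in>carrier_vec N. \<rho> *\<^sub>v v = 0\<^sub>v N \<longrightarrow> \<sigma> *\<^sub>v v = 0\<^sub>v N"
    using fin by (auto simp: rel_ent_def split: if_splits)
  then show "\<And>i. i < N \<Longrightarrow> l i = 0 \<Longrightarrow> Re ((adj U * \<sigma> * U) $$ (i,i)) = 0"
    using kernel_weight[OF R(1) S'(1), of l] R(2) by simp
  have cc: "mat_log N \<sigma> \<in> carrier_mat N N" "mat_log N \<rho> \<in> carrier_mat N N" unfolding R V using R V by auto
  have "rel_ent N \<sigma> \<rho> = ereal (Re (mtrace (\<sigma> * (mat_log N \<sigma> - mat_log N \<rho>))))" using c by (simp add: rel_ent_def)
  also have "Re (mtrace (\<sigma> * (mat_log N \<sigma> - mat_log N \<rho>))) = expval \<sigma> (mat_log N \<sigma> - mat_log N \<rho>)"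
    unfolding expval_def using S' cc by (subst mtrace_comm[of _ N N]) auto
  also have "\<dots> = expval \<sigma> (spec N V (\<lambda>i. ln (s i))) - expval \<sigma> (spec N U (\<lambda>i. ln (l i)))"
    using expval_minus[OF cc S'(2)] R(3) V(3) by simp
  also have "\<dots> = expval \<sigma> (spec N U (\<lambda>i. - ln (l i))) - expval \<sigma> (spec N V (\<lambda>i. - ln (s i)))"
    by (simp add: expval_spec[OF R(1) S'(2)] expval_spec[OF V(1) S'(2)] sum_negf)
  finally show "rel_ent N \<sigma> \<rho> = ereal (expval \<sigma> (spec N U (\<lambda>i. - ln (l i))) - expval \<sigma> (spec N V (\<lambda>i. - ln (s i))))" .
qed

lemma expval_spec_self:
  assumes "unitary N V" "\<sigma> = spec N V s"
  shows "expval \<sigma> (spec N V g) = (\<Sum>i<N. g i * s i)"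
  unfolding assms(2) expval_def spec_mult[OF assms(1)] mtrace_spec[OF assms(1)] by simp

text \<open>The gap between the two expectation values is linear in the state, so a pair found at
  one state still works nearby. Compactness needs exactly this, whereas the relative entropy itself
  is not linear and may be infinite.\<close>

lemma rel_ent_witness:
  assumes S: "\<omega> \<in> density d" and R: "\<rho> \<in> density d" "unitary d U" "\<rho> = spec d U l" "mat_log d \<rho> = spec d U (\<lambda>i. ln (l i))"
    and l0: "\<And>i. i < d \<Longrightarrow> 0 \<le> l i"
    and d: "0 < d" and t: "ereal t < rel_ent d \<omega> \<rho>"
  shows "\<exists>f V h. unitary d V \<and> (\<forall>i<d. l i \<le> exp (- f i)) \<and> (\<Sum>i<d. exp (- h i)) \<le> (1::real) \<and>
    t < expval \<omega> (spec d U f) - expval \<omega> (spec d V h)"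
proof -
  note S' = densityD[OF S]
  obtain V s where V: "unitary d V" and s0: "\<And>i. i < d \<Longrightarrow> 0 \<le> s i" and \<omega>: "\<omega> = spec d V s"
    and logw: "mat_log d \<omega> = spec d V (\<lambda>i. ln (s i))" using mat_log_spec[OF S'(1)] by metis
  define q where "q = (\<lambda>i. Re ((adj U * \<omega> * U) $$ (i,i)))"
  have q0: "0 \<le> q i" if "i < d" for i
    unfolding q_def by (rule psd_diag_nonneg[OF psd_conj[OF S'(1) unitary_carrier[OF R(2)]] that])
  (* Regularised logarithms: bounded for each \<kappa>, and recovering the relative entropy, including
     the value \<infinity>, as \<kappa> tends to 0. *)
  define f where "f = (\<lambda>\<kappa> i. - ln (max (l i) \<kappa>))"
  define h where "h = (\<lambda>\<kappa> i. - ln ((1 - \<kappa>) * s i + \<kappa> / real d))"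
  have l1: "l i \<le> 1" if "i < d" for i
  proof -
    have "l i \<le> (\<Sum>i<d. l i)" by (rule member_le_sum) (use that l0 in auto)
    also have "\<dots> = 1" using densityD(3)[OF R(1)] unfolding R(3) mtrace_spec[OF R(2)] by (metis of_real_eq_1_iff)
    finally show ?thesis .
  qed
  have sum_s: "(\<Sum>i<d. s i) = 1" using S'(3) unfolding \<omega> mtrace_spec[OF V] by (metis of_real_eq_1_iff)
  have ev_f: "expval \<omega> (spec d U g) = (\<Sum>i<d. g i * q i)" for g
    unfolding q_def by (rule expval_spec[OF R(2) S'(2)])
  have ev_h: "expval \<omega> (spec d V g) = (\<Sum>i<d. g i * s i)" for g by (rule expval_spec_self[OF V \<omega>])
  have hlim: "((\<lambda>\<kappa>. expval \<omega> (spec d V (h \<kappa>))) \<longlongrightarrow> (\<Sum>i<d. - ln (s i) * s i)) (at_right 0)"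
    unfolding ev_h h_def
  proof (rule tendsto_sum)
    fix i assume i: "i \<in> {..<d}"
    show "((\<lambda>\<kappa>. - ln ((1 - \<kappa>) * s i + \<kappa> / real d) * s i) \<longlongrightarrow> - ln (s i) * s i) (at_right 0)"
    \<comment> \<open>At an eigenvalue 0 the factor \<open>s i\<close> kills the term for every
      \<open>\<kappa>\<close>, in accordance with the convention for 0 log 0.\<close>
    proof (cases "s i = 0")
      case False
      have "((\<lambda>\<kappa>. - ln ((1 - \<kappa>) * s i + \<kappa> / real d) * s i) \<longlongrightarrow> - ln ((1 - 0) * s i + 0 / real d) * s i) (at_right 0)"
        by (intro tendsto_intros) (use False d in auto)
      then show ?thesis by simp
    qed simp
  qed
  have flim: "((\<lambda>\<kappa>. f \<kappa> i * q i) \<longlongrightarrow> - ln (l i) * q i) (at_right 0)" if "i < d" "l i = 0 \<longrightarrow> q i = 0" for i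
  proof (cases "l i = 0")
    case False
    have "((\<lambda>\<kappa>. f \<kappa> i * q i) \<longlongrightarrow> - ln (max (l i) 0) * q i) (at_right 0)"
      unfolding f_def by (intro tendsto_intros tendsto_max) (use False l0[OF that(1)] in auto)
    then show ?thesis using l0[OF that(1)] by (simp add: max_absorb1)
  qed (use that in auto)
  have "\<forall>\<^sub>F \<kappa> in at_right 0. t < expval \<omega> (spec d U (f \<kappa>)) - expval \<omega> (spec d V (h \<kappa>))"
  proof (cases "rel_ent d \<omega> \<rho> = \<infinity>")
    case False
    note fin = rel_ent_finite[OF S R(2-4) V \<omega> logw False]
    have "((\<lambda>\<kappa>. expval \<omega> (spec d U (f \<kappa>)) - expval \<omega> (spec d V (h \<kappa>))) \<longlongrightarrow>
       (\<Sum>i<d. - ln (l i) * q i) - (\<Sum>i<d. - ln (s i) * s i)) (at_right 0)"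
      unfolding ev_f by (intro tendsto_diff hlim tendsto_sum flim) (use fin(2) in \<open>auto simp: q_def\<close>)
    moreover have "t < (\<Sum>i<d. - ln (l i) * q i) - (\<Sum>i<d. - ln (s i) * s i)"
      using t unfolding fin(1) ev_f ev_h by simp
    ultimately show ?thesis by (rule order_tendstoD(1))
  next
    case True
    then have "\<not> (\<forall>v\<in>carrier_vec d. \<rho> *\<^sub>v v = 0\<^sub>v d \<longrightarrow> \<omega> *\<^sub>v v = 0\<^sub>v d)"
      by (auto simp: rel_ent_def split: if_splits)
    \<comment> \<open>At \<open>j\<close> the state has weight where \<open>\<rho>\<close> has none;
      there \<open>f\<close> becomes \<open>- ln \<kappa>\<close> and diverges, while the entropy
      term converges.\<close>
    then obtain j where j: "j < d" "l j = 0" "q j \<noteq> 0"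
      using kernel_weight[OF R(2) S'(1), of l] R(3) by (auto simp: q_def)
    have qj: "0 < q j" using q0[OF j(1)] j(3) by simp
    have "filterlim (\<lambda>\<kappa>::real. - ln \<kappa>) at_top (at_right 0)"
      using ln_at_0 by (simp add: filterlim_uminus_at_top_at_bot filterlim_uminus_at_bot)
    then have "filterlim (\<lambda>\<kappa>::real. - ln \<kappa> * q j) at_top (at_right 0)"
      by (rule filterlim_at_top_mult_tendsto_pos[OF tendsto_const qj])
    then have "filterlim (\<lambda>\<kappa>. - expval \<omega> (spec d V (h \<kappa>)) + - ln \<kappa> * q j) at_top (at_right 0)"
      by (rule filterlim_tendsto_add_at_top[OF tendsto_minus[OF hlim]])
    then have "\<forall>\<^sub>F \<kappa> in at_right 0. t < - expval \<omega> (spec d V (h \<kappa>)) + - ln \<kappa> * q j"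
      by (simp add: filterlim_at_top_dense)
    moreover have "\<forall>\<^sub>F \<kappa> in at_right (0::real). \<kappa> < 1" by (intro order_tendstoD(2)[OF tendsto_ident_at]) simp
    moreover have "\<forall>\<^sub>F \<kappa> in at_right (0::real). 0 < \<kappa>" by (simp add: eventually_at_right_less)
    ultimately show ?thesis
    proof eventually_elim
      case (elim \<kappa>)
      \<comment> \<open>The other summands are nonnegative because \<open>\<kappa>\<close> and the
        eigenvalues of \<open>\<rho>\<close> are at most 1.\<close>
      have "f \<kappa> j * q j \<le> (\<Sum>i<d. f \<kappa> i * q i)"
      proof (rule member_le_sum)
        fix i assume i: "i \<in> {..<d} - {j}"
        have "ln (max (l i) \<kappa>) \<le> 0" using elim l1[of i] i by (subst ln_le_zero_iff) auto
        then show "0 \<le> f \<kappa> i * q i" unfolding f_def using q0[of i] i by (intro mult_nonneg_nonneg) auto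
      qed (use j in auto)
      moreover have "f \<kappa> j = - ln \<kappa>" using j elim by (simp add: f_def)
      ultimately show ?case using elim by (simp add: ev_f)
    qed
  qed
  moreover have "\<forall>\<^sub>F \<kappa> in at_right (0::real). \<kappa> < 1" by (intro order_tendstoD(2)[OF tendsto_ident_at]) simp
  moreover have "\<forall>\<^sub>F \<kappa> in at_right (0::real). 0 < \<kappa>" by (simp add: eventually_at_right_less)
  ultimately have "\<forall>\<^sub>F \<kappa> in at_right 0. t < expval \<omega> (spec d U (f \<kappa>)) - expval \<omega> (spec d V (h \<kappa>)) \<and> \<kappa> < 1 \<and> 0 < \<kappa>"
    by eventually_elim auto
  then obtain \<kappa> where \<kappa>: "t < expval \<omega> (spec d U (f \<kappa>)) - expval \<omega> (spec d V (h \<kappa>))" "\<kappa> < 1" "0 < \<kappa>"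
    using eventually_happens'[of "at_right (0::real)"] by auto
  have "l i \<le> exp (- f \<kappa> i)" if "i < d" for i
    using \<kappa> by (simp add: f_def exp_ln less_max_iff_disj)
  moreover have "(\<Sum>i<d. exp (- h \<kappa> i)) \<le> 1"
  proof -
    have "exp (- h \<kappa> i) = (1 - \<kappa>) * s i + \<kappa> / real d" if "i < d" for i
    proof -
      have "0 < (1 - \<kappa>) * s i + \<kappa> / real d" using \<kappa> s0[OF that] d by (intro add_nonneg_pos) auto
      then show ?thesis by (simp add: h_def)
    qed
    then have "(\<Sum>i<d. exp (- h \<kappa> i)) = (\<Sum>i<d. (1 - \<kappa>) * s i + \<kappa> / real d)" by (intro sum.cong) auto
    also have "\<dots> = 1" using d by (simp add: sum.distrib sum_distrib_left[symmetric] sum_s)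
    finally show ?thesis by simp
  qed
  ultimately show ?thesis using V \<kappa>(1) by blast
qed

text \<open>The basis \<open>U\<close> diagonalises \<open>\<rho>\<close> and is shared by all
  triples, while \<open>V\<close> comes from the state at which the triple was found and is kept for
  its whole neighbourhood. Finitely many triples mean finitely many observables to monitor.\<close>

lemma finite_rel_ent_witnesses:
  assumes F: "F \<subseteq> density d" "closed_set d F" and R: "\<rho> \<in> density d" and d: "0 < d"
    and t: "\<forall>\<omega>\<in>F. ereal t < rel_ent d \<omega> \<rho>"
  shows "\<exists>U l (J :: ((nat \<Rightarrow> real) \<times> complex mat \<times> (nat \<Rightarrow> real)) set).
    unitary d U \<and> \<rho> = spec d U l \<and> (\<forall>i<d. 0 \<le> l i) \<and> finite J \<and>
    (\<forall>(f,V,h)\<in>J. unitary d V \<and> (\<forall>i<d. l i \<le> exp (- f i)) \<and> (\<Sum>i<d. exp (- h i)) \<le> 1) \<and>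
    (\<forall>\<omega>\<in>F. \<exists>(f,V,h)\<in>J. t < expval \<omega> (spec d U f) - expval \<omega> (spec d V h))"
proof -
  obtain U l where U: "unitary d U" and l0: "\<And>i. i < d \<Longrightarrow> 0 \<le> l i" and \<rho>: "\<rho> = spec d U l"
    and logr: "mat_log d \<rho> = spec d U (\<lambda>i. ln (l i))" using mat_log_spec[OF densityD(1)[OF R]] by metis
  define I where "I = {(f,V,h). unitary d V \<and> (\<forall>i<d. l i \<le> exp (- f i)) \<and> (\<Sum>i<d. exp (- h i)) \<le> (1::real)}"
  define G where "G = (\<lambda>(f,V,h). spec d U f - spec d V h)"
  have cov: "\<exists>i\<in>I. t < expval \<omega> (G i)" if w: "\<omega> \<in> F" for \<omega>
  proof -
    have \<omega>: "\<omega> \<in> density d" using F w by auto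
    obtain f V h where *: "unitary d V" "\<forall>i<d. l i \<le> exp (- f i)" "(\<Sum>i<d. exp (- h i)) \<le> (1::real)"
      "t < expval \<omega> (spec d U f) - expval \<omega> (spec d V h)"
      using rel_ent_witness[OF \<omega> R U \<rho> logr _ d bspec[OF t w]] l0 by blast
    have "expval \<omega> (G (f,V,h)) = expval \<omega> (spec d U f) - expval \<omega> (spec d V h)"
      unfolding G_def prod.case by (rule expval_minus[of _ d]) (use U * densityD(2)[OF \<omega>] in auto)
    then show ?thesis using * by (intro bexI[of _ "(f,V,h)"]) (auto simp: I_def)
  qed
  have Gc: "G i \<in> carrier_mat d d" if "i \<in> I" for i using that U by (auto simp: I_def G_def intro!: minus_carrier_mat)
  obtain J where J: "finite J" "J \<subseteq> I" "\<forall>\<omega>\<in>F. \<exists>i\<in>J. t < expval \<omega> (G i)"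
    using finite_expval_cover[OF F, of I G t] Gc cov by blast
  have "\<exists>(f,V,h)\<in>J. t < expval \<omega> (spec d U f) - expval \<omega> (spec d V h)" if w: "\<omega> \<in> F" for \<omega>
  proof -
    obtain f V h where i: "(f,V,h) \<in> J" "t < expval \<omega> (G (f,V,h))" using J(3) w by fast
    have "unitary d V" using i(1) J(2) by (auto simp: I_def)
    then have "expval \<omega> (G (f,V,h)) = expval \<omega> (spec d U f) - expval \<omega> (spec d V h)"
      unfolding G_def prod.case by (intro expval_minus[of _ d]) (use U w F densityD(2) in auto)
    then show ?thesis using i by (intro bexI[OF _ i(1)]) simp
  qed
  then show ?thesis using U \<rho> l0 J(1,2) unfolding I_def
    by (intro exI[of _ U] exI[of _ l] exI[of _ J] conjI) auto
qed

section \<open>Scaling observables\<close>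

text \<open>A norm that scales exactly and dominates both \<open>opnorm\<close> and the quadratic
  form, so that one rescaling meets every smallness requirement.\<close>

definition entry_sum :: "complex mat \<Rightarrow> real" where
  "entry_sum X = (\<Sum>i<dim_row X. \<Sum>j<dim_col X. cmod (X $$ (i,j)))"

lemma entry_sum_nonneg: "0 \<le> entry_sum X"
  by (simp add: entry_sum_def sum_nonneg)

lemma entry_sum_smult: "entry_sum (c \<cdot>\<^sub>m X) = cmod c * entry_sum X"
  by (simp add: entry_sum_def norm_mult sum_distrib_left)

lemma vnorm_index: "i < dim_vec v \<Longrightarrow> cmod (v $ i) \<le> vnorm v"
  unfolding vnorm_def by (rule real_le_rsqrt, rule member_le_sum) auto

lemma vnorm_le_sum: "vnorm v \<le> (\<Sum>i<dim_vec v. cmod (v $ i))"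
  using L2_set_le_sum[of "{..<dim_vec v}" "\<lambda>i. cmod (v $ i)"] by (simp add: vnorm_def L2_set_def)

lemma vnorm_nonneg: "0 \<le> vnorm v"
  by (simp add: vnorm_def sum_nonneg)

lemma mult_vec_index_bound:
  assumes X: "X \<in> carrier_mat N N" and v: "v \<in> carrier_vec N" and i: "i < N"
  shows "cmod ((X *\<^sub>v v) $ i) \<le> (\<Sum>j<N. cmod (X $$ (i,j))) * vnorm v"
proof -
  have "cmod ((X *\<^sub>v v) $ i) \<le> (\<Sum>j<N. cmod (X $$ (i,j) * v $ j))"
    unfolding mult_vec_index_sum[OF X v i] by (rule norm_sum)
  also have "\<dots> \<le> (\<Sum>j<N. cmod (X $$ (i,j)) * vnorm v)"
    using v by (intro sum_mono) (auto simp: norm_mult intro!: mult_left_mono vnorm_index)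
  finally show ?thesis by (simp add: sum_distrib_right)
qed

lemma vnorm_mult_vec_le:
  assumes X: "X \<in> carrier_mat N N" and v: "v \<in> carrier_vec N"
  shows "vnorm (X *\<^sub>v v) \<le> entry_sum X * vnorm v"
proof -
  have "vnorm (X *\<^sub>v v) \<le> (\<Sum>i<N. cmod ((X *\<^sub>v v) $ i))" using vnorm_le_sum[of "X *\<^sub>v v"] X by simp
  also have "\<dots> \<le> (\<Sum>i<N. (\<Sum>j<N. cmod (X $$ (i,j))) * vnorm v)"
    by (intro sum_mono mult_vec_index_bound[OF X v]) auto
  also have "\<dots> = entry_sum X * vnorm v" using X by (simp add: entry_sum_def sum_distrib_right)
  finally show ?thesis .
qed

lemma opnorm_le_entry_sum:
  assumes X: "X \<in> carrier_mat N N" and N: "0 < N"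
  shows "opnorm X \<le> entry_sum X"
  unfolding opnorm_def
proof (rule cSup_least)
  \<comment> \<open>The supremum must range over a nonempty set; this is where \<open>0 < N\<close>
    enters.\<close>
  have "vnorm (unit_vec N 0) = 1"
  proof -
    have "(\<Sum>i<N. (cmod (unit_vec N 0 $ i :: complex))\<^sup>2) = (\<Sum>i<N. if i = 0 then 1 else 0)"
      by (intro sum.cong) auto
    then show ?thesis using N by (simp add: vnorm_def)
  qed
  then show "{vnorm (X *\<^sub>v v) | v. v \<in> carrier_vec (dim_col X) \<and> vnorm v = 1} \<noteq> {}"
    using X by (auto intro!: exI[of _ "unit_vec N 0"])
  fix y assume "y \<in> {vnorm (X *\<^sub>v v) | v. v \<in> carrier_vec (dim_col X) \<and> vnorm v = 1}"
  then obtain v where v: "v \<in> carrier_vec N" "vnorm v = 1" "y = vnorm (X *\<^sub>v v)" using X by auto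
  show "y \<le> entry_sum X" using vnorm_mult_vec_le[OF X v(1)] v by simp
qed

lemma psd_shift:
  assumes X: "hermitian N X" and e: "entry_sum X \<le> e"
  shows "psd N (complex_of_real e \<cdot>\<^sub>m 1\<^sub>m N + X)"
  unfolding psd_def
proof (intro conjI ballI)
  note Xc = hermitian_carrier[OF X]
  show "hermitian N (complex_of_real e \<cdot>\<^sub>m 1\<^sub>m N + X)"
    using X by (auto simp: hermitian_def adj_add[of _ N N] adj_smult)
  fix v :: "complex vec" assume v: "v \<in> carrier_vec N"
  have "cmod (cinner v (X *\<^sub>v v)) \<le> (\<Sum>i<N. cmod (cnj (v $ i) * (X *\<^sub>v v) $ i))"
    unfolding cinner_def using Xc by (intro order_trans[OF norm_sum]) auto
  also have "\<dots> \<le> (\<Sum>i<N. vnorm v * ((\<Sum>j<N. cmod (X $$ (i,j))) * vnorm v))"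
    unfolding norm_mult complex_mod_cnj using v
    by (intro sum_mono mult_mono mult_vec_index_bound[OF Xc v] vnorm_index vnorm_nonneg) auto
  also have "\<dots> = entry_sum X * (vnorm v)\<^sup>2"
    using Xc by (simp add: entry_sum_def sum_distrib_left sum_distrib_right power2_eq_square mult_ac)
  also have "\<dots> \<le> e * (vnorm v)\<^sup>2" by (rule mult_right_mono[OF e]) simp
  finally have "- (e * (vnorm v)\<^sup>2) \<le> Re (cinner v (X *\<^sub>v v))"
    using abs_Re_le_cmod[of "cinner v (X *\<^sub>v v)"] by linarith
  moreover have "cinner v ((complex_of_real e \<cdot>\<^sub>m 1\<^sub>m N + X) *\<^sub>v v)
      = complex_of_real e * complex_of_real ((vnorm v)\<^sup>2) + cinner v (X *\<^sub>v v)"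
    using v Xc by (subst mult_vec_add[of _ N]) (auto simp: mult_vec_smult[of _ N] cinner_self)
  ultimately show "0 \<le> Re (cinner v ((complex_of_real e \<cdot>\<^sub>m 1\<^sub>m N + X) *\<^sub>v v))" by simp
qed

text \<open>The bound on \<open>opnorm\<close> is what compatibility asks for. The bound 1/2 keeps
  the mean of \<open>Y\<close> in a free state within 1/2, so that both outcome probabilities lie
  between 1/4 and 3/4.\<close>

definition weak_observable :: "nat \<Rightarrow> real \<Rightarrow> complex mat \<Rightarrow> bool" where
  "weak_observable d r Y \<longleftrightarrow> hermitian d Y \<and> opnorm Y \<le> r \<and> entry_sum Y \<le> 1/2"

lemma weak_observable_psd:
  assumes Y: "weak_observable d r Y" and s: "s \<in> {1, -1}" and e: "1/2 \<le> e"
  shows "psd d (complex_of_real e \<cdot>\<^sub>m 1\<^sub>m d + complex_of_real s \<cdot>\<^sub>m Y)"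
proof (rule psd_shift)
  show "hermitian d (complex_of_real s \<cdot>\<^sub>m Y)"
    using Y by (auto simp: weak_observable_def hermitian_def adj_smult)
  show "entry_sum (complex_of_real s \<cdot>\<^sub>m Y) \<le> e"
    using Y s e by (auto simp: weak_observable_def entry_sum_smult)
qed

text \<open>All smaller scales are included so that finitely many observables can share one.\<close>

lemma weak_observable_scale:
  assumes X: "hermitian d X" and d: "0 < d" and r: "0 < r"
  shows "\<exists>c0>0. \<forall>c. 0 < c \<and> c \<le> c0 \<longrightarrow> weak_observable d r (complex_of_real c \<cdot>\<^sub>m X)"
proof -
  \<comment> \<open>The summand 1 keeps the denominator positive when \<open>X\<close>
    vanishes.\<close>
  define c0 where "c0 = min r (1/2) / (entry_sum X + 1)"
  have p: "0 < entry_sum X + 1" using entry_sum_nonneg[of X] by simp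
  have "weak_observable d r (complex_of_real c \<cdot>\<^sub>m X)" if c: "0 < c" "c \<le> c0" for c
  proof -
    have "entry_sum (complex_of_real c \<cdot>\<^sub>m X) = c * entry_sum X" using c by (simp add: entry_sum_smult)
    also have "\<dots> \<le> c0 * (entry_sum X + 1)" using c entry_sum_nonneg[of X] by (intro mult_mono) auto
    also have "\<dots> = min r (1/2)" using p by (simp add: c0_def)
    finally have "entry_sum (complex_of_real c \<cdot>\<^sub>m X) \<le> min r (1/2)" .
    moreover have "opnorm (complex_of_real c \<cdot>\<^sub>m X) \<le> entry_sum (complex_of_real c \<cdot>\<^sub>m X)"
      using hermitian_carrier[OF X] d by (intro opnorm_le_entry_sum[of _ d]) auto
    ultimately show ?thesis
      using X by (auto simp: weak_observable_def hermitian_def adj_smult)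
  qed
  moreover have "0 < c0" using p r by (simp add: c0_def)
  ultimately show ?thesis by blast
qed

section \<open>Free states\<close>

(* Permutation invariance tested on product operators only: in this form it passes directly to the
   conditional states of the remaining systems. *)
definition symmetric_state :: "nat \<Rightarrow> nat \<Rightarrow> complex mat \<Rightarrow> bool" where
  "symmetric_state d n \<sigma> \<longleftrightarrow> (\<forall>As \<pi>. (\<forall>k<n. As k \<in> carrier_mat d d) \<longrightarrow> \<pi> permutes {..<n} \<longrightarrow>
     mtrace (tensor As n * \<sigma>) = mtrace (tensor (As \<circ> \<pi>) n * \<sigma>))"

lemma symmetric_stateD:
  "symmetric_state d n \<sigma> \<Longrightarrow> (\<And>k. k < n \<Longrightarrow> As k \<in> carrier_mat d d) \<Longrightarrow> \<pi> permutes {..<n} \<Longrightarrow>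
     mtrace (tensor As n * \<sigma>) = mtrace (tensor (As \<circ> \<pi>) n * \<sigma>)"
  unfolding symmetric_state_def by blast

lemma symmetric_site:
  assumes "symmetric_state d n \<sigma>" "A \<in> carrier_mat d d" "k < n"
  shows "expval \<sigma> (site d n A k) = expval \<sigma> (site d n A 0)"
proof -
  let ?\<pi> = "transpose 0 k"
  have "((\<lambda>_. 1\<^sub>m d)(k := A)) \<circ> ?\<pi> = (\<lambda>_. 1\<^sub>m d)(0 := A)"
    by (auto simp: fun_eq_iff transpose_def)
  moreover have "mtrace (tensor ((\<lambda>_. 1\<^sub>m d)(k := A)) n * \<sigma>) = mtrace (tensor (((\<lambda>_. 1\<^sub>m d)(k := A)) \<circ> ?\<pi>) n * \<sigma>)"
    by (rule symmetric_stateD[OF assms(1)]) (use assms in \<open>auto intro!: permutes_swap_id\<close>)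
  ultimately show ?thesis by (simp add: site_def expval_def)
qed

lemma symmetric_site2:
  assumes "symmetric_state d n \<sigma>" "A \<in> carrier_mat d d" "B \<in> carrier_mat d d" "k < n" "l < n" "k \<noteq> l"
  shows "expval \<sigma> (site2 d n A k B l) = expval \<sigma> (site2 d n A 0 B 1)"
proof -
  \<comment> \<open>The product of transpositions must send 0 to \<open>k\<close> and 1 to
    \<open>l\<close>. Pulling \<open>l\<close> back through the outer transposition covers the case
    \<open>l = 0\<close>.\<close>
  define m where "m = transpose 0 k l"
  define \<pi> where "\<pi> = transpose 0 k \<circ> transpose 1 m"
  have m: "m \<noteq> 0" "m < n" using assms by (auto simp: m_def transpose_def)
  have \<pi>: "\<pi> permutes {..<n}" unfolding \<pi>_def
    by (intro permutes_compose permutes_swap_id) (use m assms in auto)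
  have "transpose 1 m 0 = 0" using m by (intro transpose_apply_other) auto
  then have \<pi>0: "\<pi> 0 = k" "\<pi> 1 = l" by (simp_all add: \<pi>_def) (simp add: m_def)
  have inj: "\<pi> i = \<pi> j \<longleftrightarrow> i = j" for i j using permutes_inj[OF \<pi>] by (auto dest: injD)
  have "((\<lambda>_. 1\<^sub>m d)(k := A, l := B)) \<circ> \<pi> = (\<lambda>_. 1\<^sub>m d)(0 := A, 1 := B)"
    unfolding \<pi>0[symmetric] by (auto simp: fun_eq_iff inj)
  moreover have "mtrace (tensor ((\<lambda>_. 1\<^sub>m d)(k := A, l := B)) n * \<sigma>) = mtrace (tensor (((\<lambda>_. 1\<^sub>m d)(k := A, l := B)) \<circ> \<pi>) n * \<sigma>)"
    by (rule symmetric_stateD[OF assms(1) _ \<pi>]) (use assms in auto)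
  ultimately show ?thesis by (simp add: site2_def expval_def)
qed

text \<open>A permutation of the remaining systems, viewed as one that fixes the measured first
  system.\<close>

lemma permutes_lift:
  assumes "\<pi> permutes {..<n}"
  shows "(\<lambda>i. case i of 0 \<Rightarrow> 0 | Suc j \<Rightarrow> Suc (\<pi> j)) permutes {..<Suc n}" (is "?p permutes _")
proof (rule bij_imp_permutes)
  have lt: "\<pi> j < n \<longleftrightarrow> j < n" for j using permutes_in_image[OF assms] by simp
  have inj: "\<pi> i = \<pi> j \<longleftrightarrow> i = j" for i j using permutes_inj[OF assms] by (meson injD)
  have "inj_on ?p {..<Suc n}"
  proof (rule inj_onI)
    fix x y assume "?p x = ?p y" then show "x = y" by (cases x; cases y) (simp_all add: inj)
  qed
  moreover have "?p ` {..<Suc n} \<subseteq> {..<Suc n}"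
  proof
    fix y assume "y \<in> ?p ` {..<Suc n}"
    then obtain x where "x < Suc n" "y = ?p x" by blast
    then show "y \<in> {..<Suc n}" by (cases x) (simp_all add: lt)
  qed
  ultimately show "bij_betw ?p {..<Suc n} {..<Suc n}" by (simp add: bij_betw_def endo_inj_surj)
  show "?p x = x" if "x \<notin> {..<Suc n}" for x
    using that permutes_not_in[OF assms] by (cases x) simp_all
qed

text \<open>The setting for the lower bound on the exponent. \<open>compat\<close> is the condition
  for measuring a single system, so \<open>r\<close> stands for the bound at one system.\<close>

locale free_states =
  fixes d :: nat and F :: "nat \<Rightarrow> complex mat set" and r :: real
  assumes states: "1 \<le> n \<Longrightarrow> F n \<subseteq> density (d ^ n)"
    and convex: "1 \<le> n \<Longrightarrow> convex_set (F n)"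
    and ptr: "1 \<le> n \<Longrightarrow> \<sigma> \<in> F (n + 1) \<Longrightarrow> ptrace_last (d ^ n) d \<sigma> \<in> F n"
    and perm: "1 \<le> n \<Longrightarrow> \<pi> permutes {..<n} \<Longrightarrow> \<sigma> \<in> F n \<Longrightarrow>
      perm_unitary d n \<pi> * \<sigma> * adj (perm_unitary d n \<pi>) \<in> F n"
    and d_pos: "0 < d" and r_pos: "0 < r"
    and compat: "1 \<le> m \<Longrightarrow> hermitian d X \<Longrightarrow> opnorm X \<le> r \<Longrightarrow> s \<in> {1, -1} \<Longrightarrow> \<sigma> \<in> F (Suc m) \<Longrightarrow>
      ptrace_first d (d ^ m) (kron ((1/2) \<cdot>\<^sub>m (1\<^sub>m d + complex_of_real s \<cdot>\<^sub>m X)) (1\<^sub>m (d ^ m)) * \<sigma>) \<in> cone (F m)"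
begin

lemma free_density: "1 \<le> n \<Longrightarrow> \<sigma> \<in> F n \<Longrightarrow> \<sigma> \<in> density (d ^ n)"
  using states by blast

text \<open>Two-point convexity is iterated. The mixture is described by its trace pairings, which
  is the form read off in the symmetrisation.\<close>

lemma uniform_mixture:
  assumes n: "1 \<le> n" and A: "finite A" "A \<noteq> {}" and f: "\<And>i. i \<in> A \<Longrightarrow> f i \<in> F n"
  shows "\<exists>\<tau>\<in>F n. \<forall>T\<in>carrier_mat (d ^ n) (d ^ n). mtrace (T * \<tau>) = (\<Sum>i\<in>A. mtrace (T * f i)) / of_nat (card A)"
  using A f
proof (induction A rule: finite_ne_induct)
  case (singleton x)
  then show ?case by (intro bexI[of _ "f x"]) auto
next
  case (insert x A)
  then obtain \<tau> where \<tau>: "\<tau> \<in> F n"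
    "\<And>T. T \<in> carrier_mat (d ^ n) (d ^ n) \<Longrightarrow> mtrace (T * \<tau>) = (\<Sum>i\<in>A. mtrace (T * f i)) / of_nat (card A)" by auto
  \<comment> \<open>The weight of the new member, chosen so that all members end up with equal
    weight.\<close>
  define t where "t = 1 / (real (card A) + 1)"
  have cA: "0 < card A" using insert by (simp add: card_gt_0_iff)
  have t: "0 \<le> t" "t \<le> 1" "1 - t = real (card A) / (real (card A) + 1)" by (auto simp: t_def field_simps)
  have fx: "f x \<in> F n" using insert by simp
  note c = densityD(2)[OF free_density[OF n fx]] densityD(2)[OF free_density[OF n \<tau>(1)]]
  have "complex_of_real t \<cdot>\<^sub>m f x + complex_of_real (1 - t) \<cdot>\<^sub>m \<tau> \<in> F n"
    using convex[OF n] fx \<tau>(1) t unfolding convex_set_def by blast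
  moreover have "mtrace (T * (complex_of_real t \<cdot>\<^sub>m f x + complex_of_real (1 - t) \<cdot>\<^sub>m \<tau>))
      = (\<Sum>i\<in>insert x A. mtrace (T * f i)) / of_nat (card (insert x A))" if T: "T \<in> carrier_mat (d ^ n) (d ^ n)" for T
  proof -
    have "mtrace (T * (complex_of_real t \<cdot>\<^sub>m f x + complex_of_real (1 - t) \<cdot>\<^sub>m \<tau>))
      = complex_of_real t * mtrace (T * f x) + complex_of_real (1 - t) * mtrace (T * \<tau>)"
      using T c by (simp add: mult_add_distrib_mat[of _ "d ^ n" "d ^ n" _ "d ^ n"] mtrace_add[of _ "d ^ n"]
          mult_smult_distrib[of _ "d ^ n" "d ^ n" _ "d ^ n"] mtrace_smult[of _ "d ^ n"] del: of_real_diff)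
    also have "\<dots> = (mtrace (T * f x) + (\<Sum>i\<in>A. mtrace (T * f i))) / (of_nat (card A) + 1)"
      unfolding \<tau>(2)[OF T] t(3) using cA by (simp add: t_def add_divide_distrib)
    finally show ?thesis using insert by (simp add: add.commute)
  qed
  ultimately show ?case by blast
qed

text \<open>The average over all permutations is free and symmetric. The last clause is the way
  back: a minimum is at most the average, so the error of a test on the average bounds its error on
  some permuted copy of \<open>\<sigma>\<close>.\<close>

lemma symmetrize:
  assumes n: "1 \<le> n" and s: "\<sigma> \<in> F n"
  shows "\<exists>\<tau>\<in>F n. symmetric_state d n \<tau> \<and> (\<forall>T\<in>carrier_mat (d ^ n) (d ^ n).
    \<exists>\<pi>. \<pi> permutes {..<n} \<and> expval (perm_unitary d n \<pi> * \<sigma> * adj (perm_unitary d n \<pi>)) T \<le> expval \<tau> T)"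
proof -
  let ?P = "{\<pi>. \<pi> permutes {..<n}}"
  define f where "f = (\<lambda>\<pi>. perm_unitary d n \<pi> * \<sigma> * adj (perm_unitary d n \<pi>))"
  have "id \<in> ?P" by (simp add: permutes_id)
  then have "?P \<noteq> {}" by blast
  moreover have "finite ?P" by (simp add: finite_permutations)
  ultimately have fin: "finite ?P" "?P \<noteq> {}" by blast+
  have f: "f \<pi> \<in> F n" if "\<pi> \<in> ?P" for \<pi> using perm[OF n _ s] that by (simp add: f_def)
  have sc: "\<sigma> \<in> carrier_mat (d ^ n) (d ^ n)" using densityD(2)[OF free_density[OF n s]] .
  obtain \<tau> where \<tau>: "\<tau> \<in> F n"
    "\<And>T. T \<in> carrier_mat (d ^ n) (d ^ n) \<Longrightarrow> mtrace (T * \<tau>) = (\<Sum>\<pi>\<in>?P. mtrace (T * f \<pi>)) / of_nat (card ?P)"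
    using uniform_mixture[OF n fin, of f] f by blast
  have tr: "mtrace (tensor As n * \<tau>) = (\<Sum>\<pi>\<in>?P. mtrace (tensor (As \<circ> \<pi>) n * \<sigma>)) / of_nat (card ?P)"
    if As: "\<And>k. k < n \<Longrightarrow> As k \<in> carrier_mat d d" for As
  proof -
    have "mtrace (tensor As n * f \<pi>) = mtrace (tensor (As \<circ> \<pi>) n * \<sigma>)" if "\<pi> \<in> ?P" for \<pi>
      unfolding f_def by (rule mtrace_perm_unitary_conj[OF d_pos _ As sc]) (use that in auto)
    then show ?thesis using \<tau>(2)[OF tensor_carrier[OF As]] by simp
  qed
  have "symmetric_state d n \<tau>"
    unfolding symmetric_state_def
  proof (intro allI impI)
    fix As :: "nat \<Rightarrow> complex mat" and \<pi> assume As: "\<forall>k<n. As k \<in> carrier_mat d d" and p: "\<pi> permutes {..<n}"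
    have "As (\<pi> k) \<in> carrier_mat d d" if "k < n" for k
      using As permutes_in_image[OF p, of k] that by simp
    then have "mtrace (tensor (As \<circ> \<pi>) n * \<tau>) = (\<Sum>\<pi>'\<in>?P. mtrace (tensor (As \<circ> (\<pi> \<circ> \<pi>')) n * \<sigma>)) / of_nat (card ?P)"
      using tr[of "As \<circ> \<pi>"] by (simp add: comp_assoc)
    \<comment> \<open>Composition with \<open>\<pi>\<close> is a bijection of the permutation
      group.\<close>
    also have "(\<Sum>\<pi>'\<in>?P. mtrace (tensor (As \<circ> (\<pi> \<circ> \<pi>')) n * \<sigma>)) = (\<Sum>\<pi>'\<in>?P. mtrace (tensor (As \<circ> \<pi>') n * \<sigma>))"
      by (rule sum.reindex_bij_witness[of _ "\<lambda>q. inv_into UNIV \<pi> \<circ> q" "\<lambda>q. \<pi> \<circ> q"])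
         (use p permutes_inv[OF p] in \<open>auto simp: permutes_inverses[OF p] comp_def fun_eq_iff intro: permutes_compose[unfolded comp_def]\<close>)
    also have "\<dots> / of_nat (card ?P) = mtrace (tensor As n * \<tau>)" using tr[of As] As by simp
    finally show "mtrace (tensor As n * \<tau>) = mtrace (tensor (As \<circ> \<pi>) n * \<tau>)" ..
  qed
  moreover have "\<exists>\<pi>. \<pi> permutes {..<n} \<and> expval (f \<pi>) T \<le> expval \<tau> T" if T: "T \<in> carrier_mat (d ^ n) (d ^ n)" for T
  proof (rule ccontr)
    assume "\<nexists>\<pi>. \<pi> permutes {..<n} \<and> expval (f \<pi>) T \<le> expval \<tau> T"
    then have "(\<Sum>\<pi>\<in>?P. expval \<tau> T) < (\<Sum>\<pi>\<in>?P. expval (f \<pi>) T)"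
      using fin by (intro sum_strict_mono) auto
    also have "(\<Sum>\<pi>\<in>?P. expval (f \<pi>) T) = Re (\<Sum>\<pi>\<in>?P. mtrace (T * f \<pi>))" by (simp add: expval_def)
    also have "(\<Sum>\<pi>\<in>?P. mtrace (T * f \<pi>)) = of_nat (card ?P) * mtrace (T * \<tau>)"
      using \<tau>(2)[OF T] fin by (simp add: card_eq_0_iff)
    finally show False by (simp add: expval_def)
  qed
  ultimately show ?thesis using \<tau>(1) unfolding f_def by blast
qed

text \<open>Partial traces discard the last system, so the first one survives until it is alone.
  That the marginal is free is what brings the infimum over \<open>F 1\<close> into the
  exponent.\<close>

lemma site_marginal:
  assumes "1 \<le> n" "\<sigma> \<in> F n"
  shows "\<exists>\<omega>\<in>F 1. \<forall>A\<in>carrier_mat d d. expval \<sigma> (site d n A 0) = expval \<omega> A"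
  using assms
proof (induction n arbitrary: \<sigma> rule: nat_induct_at_least)
  case base
  have "site d 1 A 0 = A" for A by (simp add: site_def kron_one_left[simplified])
  then show ?case using base by auto
next
  case (Suc n)
  define \<sigma>' where "\<sigma>' = ptrace_last (d ^ n) d \<sigma>"
  have "\<sigma>' \<in> F n" using ptr[OF Suc.hyps(1)] Suc.prems by (simp add: \<sigma>'_def)
  then obtain \<omega> where \<omega>: "\<omega> \<in> F 1" "\<forall>A\<in>carrier_mat d d. expval \<sigma>' (site d n A 0) = expval \<omega> A"
    using Suc.IH by blast
  have sc: "\<sigma> \<in> carrier_mat (d ^ n * d) (d ^ n * d)"
    using densityD(2)[OF free_density[OF _ Suc.prems]] by (simp add: mult.commute)
  have "expval \<sigma> (site d (Suc n) A 0) = expval \<sigma>' (site d n A 0)" if A: "A \<in> carrier_mat d d" for A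
  proof -
    have "site d (Suc n) A 0 = kron (site d n A 0) (1\<^sub>m d)" using Suc.hyps by (simp add: site_def)
    moreover have "site d n A 0 \<in> carrier_mat (d ^ n) (d ^ n)" unfolding site_def using A by (intro tensor_carrier) auto
    ultimately show ?thesis
      unfolding expval_def \<sigma>'_def using mtrace_ptrace_last[OF _ sc] by simp
  qed
  then show ?case using \<omega> by auto
qed

text \<open>Pair the free marginal with the positive operators 1/2 + Y and 1/2 - Y.\<close>

lemma site_density_bound:
  assumes n: "1 \<le> n" and s: "\<sigma> \<in> F n" and Y: "weak_observable d r Y"
  shows "\<bar>expval \<sigma> (site d n Y 0)\<bar> \<le> 1/2"
proof -
  have Yc: "Y \<in> carrier_mat d d" using Y hermitian_carrier by (auto simp: weak_observable_def)
  obtain \<omega> where \<omega>: "\<omega> \<in> F 1" "expval \<sigma> (site d n Y 0) = expval \<omega> Y"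
    using site_marginal[OF n s] Yc by blast
  have w: "\<omega> \<in> density d" using free_density[OF _ \<omega>(1)] by simp
  note w' = densityD[OF w]
  have "0 \<le> 1/2 + t * expval \<omega> Y" if "t \<in> {1, -1}" for t
  proof -
    have "0 \<le> expval \<omega> (complex_of_real (1/2) \<cdot>\<^sub>m 1\<^sub>m d + complex_of_real t \<cdot>\<^sub>m Y)"
      by (rule expval_nonneg[OF weak_observable_psd[OF Y that] w'(1)]) simp
    also have "\<dots> = 1/2 + t * expval \<omega> Y"
    proof -
      have "expval \<omega> (complex_of_real (1/2) \<cdot>\<^sub>m 1\<^sub>m d + complex_of_real t \<cdot>\<^sub>m Y)
          = expval \<omega> (complex_of_real (1/2) \<cdot>\<^sub>m 1\<^sub>m d) + expval \<omega> (complex_of_real t \<cdot>\<^sub>m Y)"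
        by (rule expval_add) (use Yc w' in auto)
      then show ?thesis unfolding expval_smult[OF one_carrier_mat w'(2)] expval_smult[OF Yc w'(2)] w'(4) by simp
    qed
    finally show ?thesis .
  qed
  from this[of 1] this[of "-1"] show ?thesis using \<omega>(2) by (simp add: abs_le_iff)
qed

text \<open>\<open>compat\<close> makes the post-measurement operator a nonnegative multiple of a
  free state; pairing with the identity identifies the multiple as the outcome probability. Symmetry
  is inherited from permutations that fix the measured system, after division by this
  probability.\<close>

lemma conditional_state:
  assumes n: "1 \<le> n" and s: "\<sigma> \<in> F (Suc n)" and sym: "symmetric_state d (Suc n) \<sigma>"
    and Y: "weak_observable d r Y" and t: "t \<in> {1, -1}"
  defines "E \<equiv> (1/2) \<cdot>\<^sub>m (1\<^sub>m d + complex_of_real t \<cdot>\<^sub>m Y)"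
  shows "\<exists>q \<tau>. \<tau> \<in> F n \<and> symmetric_state d n \<tau> \<and> q = 1/2 + t/2 * expval \<sigma> (site d (Suc n) Y 0) \<and>
    (\<forall>B\<in>carrier_mat (d ^ n) (d ^ n). q * expval \<tau> B = expval \<sigma> (kron E B))"
proof -
  have Yh: "hermitian d Y" "opnorm Y \<le> r" using Y by (auto simp: weak_observable_def)
  note Yc = hermitian_carrier[OF Yh(1)]
  have Ec: "E \<in> carrier_mat d d" using Yc by (auto simp: E_def)
  have sc: "\<sigma> \<in> carrier_mat (d * d ^ n) (d * d ^ n)"
    using densityD(2)[OF free_density[OF _ s]] by simp
  define T where "T = ptrace_first d (d ^ n) (kron E (1\<^sub>m (d ^ n)) * \<sigma>)"
  have "T \<in> cone (F n)" unfolding T_def E_def by (rule compat[OF n Yh t s])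
  then obtain q \<tau> where \<tau>: "\<tau> \<in> F n" "0 \<le> q" "T = complex_of_real q \<cdot>\<^sub>m \<tau>" by (auto simp: cone_def)
  note \<tau>' = densityD[OF free_density[OF n \<tau>(1)]]
  have tr: "complex_of_real q * mtrace (B * \<tau>) = mtrace (kron E B * \<sigma>)" if B: "B \<in> carrier_mat (d ^ n) (d ^ n)" for B
  proof -
    have "complex_of_real q * mtrace (B * \<tau>) = mtrace (B * T)"
      unfolding \<tau>(3) using B \<tau>'(2) by (simp add: mult_smult_distrib[of _ "d ^ n" "d ^ n" _ "d ^ n"] mtrace_smult[of _ "d ^ n"])
    also have "\<dots> = mtrace (kron (1\<^sub>m d) B * (kron E (1\<^sub>m (d ^ n)) * \<sigma>))"
      unfolding T_def by (rule mtrace_ptrace_first[OF B]) (rule mult_carrier_mat[of _ _ "d * d ^ n"], use Ec sc in auto)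
    also have "kron (1\<^sub>m d) B * (kron E (1\<^sub>m (d ^ n)) * \<sigma>) = kron (1\<^sub>m d) B * kron E (1\<^sub>m (d ^ n)) * \<sigma>"
      by (rule assoc_mult_mat[symmetric, of _ "d * d ^ n" "d * d ^ n" _ "d * d ^ n" _ "d * d ^ n"]) (use B Ec sc in auto)
    also have "kron (1\<^sub>m d) B * kron E (1\<^sub>m (d ^ n)) = kron E B"
      using kron_mult[OF one_carrier_mat Ec B one_carrier_mat] Ec B by simp
    finally show ?thesis .
  qed
  have ev: "q * expval \<tau> B = expval \<sigma> (kron E B)" if "B \<in> carrier_mat (d ^ n) (d ^ n)" for B
    using arg_cong[OF tr[OF that], of Re] by (simp add: expval_def)
  have s0: "site d (Suc n) A 0 = kron A (1\<^sub>m (d ^ n))" for A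
    by (simp add: site_def tensor_Cons tensor_one del: tensor.simps)
  have "kron E (1\<^sub>m (d ^ n)) = complex_of_real (1/2) \<cdot>\<^sub>m (1\<^sub>m (d * d ^ n) + complex_of_real t \<cdot>\<^sub>m site d (Suc n) Y 0)"
    unfolding E_def s0 using Yc by (simp add: kron_smult_left kron_add_left[of _ d d] kron_one)
  moreover have Y0: "site d (Suc n) Y 0 \<in> carrier_mat (d * d ^ n) (d * d ^ n)" unfolding s0 using Yc by simp
  moreover have "expval \<sigma> (1\<^sub>m (d * d ^ n)) = 1" using densityD(4)[OF free_density[OF _ s]] by simp
  ultimately have "expval \<sigma> (kron E (1\<^sub>m (d ^ n))) = 1/2 * (1 + t * expval \<sigma> (site d (Suc n) Y 0))"
    using sc by (simp only: expval_smult[of _ "d * d ^ n"] expval_add[of _ "d * d ^ n"] smult_carrier_mat add_carrier_mat one_carrier_mat)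
  then have q: "q = 1/2 + t/2 * expval \<sigma> (site d (Suc n) Y 0)"
    using ev[OF one_carrier_mat] \<tau>'(4) by (simp add: field_simps)
  \<comment> \<open>The bound makes both outcomes possible, so the conditional state is determined
    by its pairings.\<close>
  have "\<bar>expval \<sigma> (site d (Suc n) Y 0)\<bar> \<le> 1/2" by (rule site_density_bound[OF _ s Y]) simp
  then have q0: "q \<noteq> 0" unfolding q using t by auto
  have "symmetric_state d n \<tau>"
    unfolding symmetric_state_def
  proof (intro allI impI)
    fix As :: "nat \<Rightarrow> complex mat" and \<pi> assume As: "\<forall>k<n. As k \<in> carrier_mat d d" and p: "\<pi> permutes {..<n}"
    let ?q = "\<lambda>i. case i of 0 \<Rightarrow> 0 | Suc j \<Rightarrow> Suc (\<pi> j)"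
    have As': "(As \<circ> \<pi>) k \<in> carrier_mat d d" if "k < n" for k
      using As permutes_in_image[OF p, of k] that by simp
    have k: "kron E (tensor Bs n) = tensor (case_nat E Bs) (Suc n)" for Bs
      by (simp add: tensor_Cons del: tensor.simps)
    have "complex_of_real q * mtrace (tensor As n * \<tau>) = mtrace (tensor (case_nat E As) (Suc n) * \<sigma>)"
      unfolding k[symmetric] by (rule tr) (use As in auto)
    also have "\<dots> = mtrace (tensor (case_nat E As \<circ> ?q) (Suc n) * \<sigma>)"
      by (rule symmetric_stateD[OF sym _ permutes_lift[OF p]]) (use As Ec in \<open>auto split: nat.splits\<close>)
    also have "case_nat E As \<circ> ?q = case_nat E (As \<circ> \<pi>)" by (auto simp: fun_eq_iff split: nat.splits)
    also have "mtrace (tensor (case_nat E (As \<circ> \<pi>)) (Suc n) * \<sigma>) = complex_of_real q * mtrace (tensor (As \<circ> \<pi>) n * \<tau>)"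
      unfolding k[symmetric] by (rule tr[symmetric]) (use As' in auto)
    finally show "mtrace (tensor As n * \<tau>) = mtrace (tensor (As \<circ> \<pi>) n * \<tau>)" using q0 by simp
  qed
  then show ?thesis using \<tau>(1) q ev by blast
qed

end

section \<open>Adaptive tests\<close>

text \<open>Law of total variance for a two-outcome measurement: \<open>a\<close> and
  \<open>b\<close> are the conditional means, \<open>z\<close> the overall mean, \<open>u\<close>
  the mean of the measured observable, \<open>c\<close> the two-site moment. With outcome
  probabilities p and m the variance of the conditional mean is p m (a - b)^2, the covariance is 2 p
  m (a - b), and p m is at most 1/4.\<close>

lemma conditional_second_moment:
  fixes z u c a b :: real
  assumes u: "\<bar>u\<bar> \<le> 1/2" and a: "(1/2 + u/2) * a = (z + c) / 2" and b: "(1/2 - u/2) * b = (z - c) / 2"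
  shows "z\<^sup>2 + (c - u * z)\<^sup>2 \<le> (1/2 + u/2) * a\<^sup>2 + (1/2 - u/2) * b\<^sup>2"
proof -
  define p m where "p = 1/2 + u/2" and "m = 1/2 - u/2"
  have pm: "0 < p" "0 < m" "p + m = 1" using u by (auto simp: p_def m_def)
  have zz: "p * a + m * b = z" using a b by (simp add: p_def m_def)
  have pmu: "p * m = 1/4 - u\<^sup>2/4" by (simp add: p_def m_def field_simps power2_eq_square)
  have pm4: "0 < p * m" "p * m \<le> 1/4" using mult_pos_pos[OF pm(1,2)] by (simp, simp add: pmu)
  have "p * m * (a - b) = m * (p * a) - p * (m * b)" by (simp add: algebra_simps)
  also have "\<dots> = (c - u * z) / 2" unfolding p_def m_def a b by (simp add: field_simps)
  finally have d: "c - u * z = 2 * (p * m * (a - b))" by simp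
  have "(c - u * z)\<^sup>2 = 4 * (p * m) * (p * m * (a - b)\<^sup>2)" unfolding d by (simp add: power2_eq_square)
  also have "\<dots> \<le> 1 * (p * m * (a - b)\<^sup>2)" using pm4 by (intro mult_right_mono) auto
  finally have g: "(c - u * z)\<^sup>2 \<le> p * m * (a - b)\<^sup>2" by simp
  have "p * a\<^sup>2 + m * b\<^sup>2 = (p * a + m * b)\<^sup>2 + p * m * (a - b)\<^sup>2"
  proof -
    have m: "m = 1 - p" using pm by simp
    show ?thesis unfolding m by (simp add: power2_eq_square algebra_simps)
  qed
  then show ?thesis using g zz by (simp add: p_def m_def)
qed

lemma psd_zero: "psd N (0\<^sub>m N N)"
proof -
  have "complex_of_real 0 \<cdot>\<^sub>m 1\<^sub>m N = 0\<^sub>m N N" by (rule eq_matI) auto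
  then show ?thesis using psd_smult[OF psd_one order_refl, of N] by metis
qed

context free_states
begin

definition potential :: "complex mat set \<Rightarrow> nat \<Rightarrow> complex mat \<Rightarrow> real" where
  "potential Obs n \<sigma> = (\<Sum>Y\<in>Obs. (expval \<sigma> (site d n Y 0))\<^sup>2)"

lemma potential_le:
  assumes "1 \<le> n" "\<sigma> \<in> F n" "\<And>Y. Y \<in> Obs \<Longrightarrow> weak_observable d r Y"
  shows "potential Obs n \<sigma> \<le> real (card Obs)"
proof -
  have "(expval \<sigma> (site d n Y 0))\<^sup>2 \<le> 1" if "Y \<in> Obs" for Y
    using site_density_bound[OF assms(1,2) assms(3)[OF that]] by (simp add: abs_square_le_1)
  then show ?thesis unfolding potential_def using sum_bounded_above[of Obs _ "1::real"] by simp
qed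

text \<open>For every observable the averaged square can only grow, and for the measured
  \<open>Y\<close> it grows by the squared covariance. Removing the first system turns site 1 into
  site 0, and symmetry makes the mean there agree with the earlier mean at site 0.\<close>

lemma measurement_step:
  assumes n: "1 \<le> n" and s: "\<sigma> \<in> F (Suc n)" and sym: "symmetric_state d (Suc n) \<sigma>"
    and Y: "Y \<in> Obs" and Obs: "finite Obs" "\<And>Y. Y \<in> Obs \<Longrightarrow> weak_observable d r Y"
  obtains E1 E2 p1 p2 \<tau>1 \<tau>2 where
    "psd d E1" "psd d E2" "E1 + E2 = 1\<^sub>m d" "0 \<le> p1" "0 \<le> p2" "p1 + p2 = 1"
    "\<tau>1 \<in> F n" "\<tau>2 \<in> F n" "symmetric_state d n \<tau>1" "symmetric_state d n \<tau>2"
    "\<And>B. B \<in> carrier_mat (d ^ n) (d ^ n) \<Longrightarrow> expval \<sigma> (kron E1 B) = p1 * expval \<tau>1 B"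
    "\<And>B. B \<in> carrier_mat (d ^ n) (d ^ n) \<Longrightarrow> expval \<sigma> (kron E2 B) = p2 * expval \<tau>2 B"
    "potential Obs (Suc n) \<sigma> + (expval \<sigma> (site2 d (Suc n) Y 0 Y 1) - (expval \<sigma> (site d (Suc n) Y 0))\<^sup>2)\<^sup>2
      \<le> p1 * potential Obs n \<tau>1 + p2 * potential Obs n \<tau>2"
proof -
  note Yw = Obs(2)[OF Y]
  have herm: "hermitian d Z" if "Z \<in> Obs" for Z using Obs(2)[OF that] by (simp add: weak_observable_def)
  note Yc = hermitian_carrier[OF herm[OF Y]]
  define E where "E = (\<lambda>t. (1/2) \<cdot>\<^sub>m (1\<^sub>m d + complex_of_real t \<cdot>\<^sub>m Y))"
  define u where "u = expval \<sigma> (site d (Suc n) Y 0)"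
  have sc: "\<sigma> \<in> carrier_mat (d * d ^ n) (d * d ^ n)" using densityD(2)[OF free_density[OF _ s]] by simp
  have Ec: "E t \<in> carrier_mat d d" for t using Yc by (simp add: E_def)
  have Epsd: "psd d (E t)" if "t \<in> {1,-1}" for t
  proof -
    have "psd d (complex_of_real (1/2) \<cdot>\<^sub>m (complex_of_real 1 \<cdot>\<^sub>m 1\<^sub>m d + complex_of_real t \<cdot>\<^sub>m Y))"
      by (intro psd_smult weak_observable_psd[OF Yw that]) auto
    moreover have "complex_of_real 1 \<cdot>\<^sub>m 1\<^sub>m d = (1\<^sub>m d :: complex mat)" by (rule eq_matI) auto
    ultimately show ?thesis by (simp add: E_def)
  qed
  have Esum: "E 1 + E (-1) = 1\<^sub>m d" using Yc by (intro eq_matI) (auto simp: E_def field_simps)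
  have u: "\<bar>u\<bar> \<le> 1/2" unfolding u_def by (rule site_density_bound[OF _ s Yw]) simp
  obtain \<tau>1 where t1: "\<tau>1 \<in> F n" "symmetric_state d n \<tau>1"
    "\<And>B. B \<in> carrier_mat (d ^ n) (d ^ n) \<Longrightarrow> expval \<sigma> (kron (E 1) B) = (1/2 + u/2) * expval \<tau>1 B"
    using conditional_state[OF n s sym Yw, of 1] unfolding E_def u_def by auto
  obtain \<tau>2 where t2: "\<tau>2 \<in> F n" "symmetric_state d n \<tau>2"
    "\<And>B. B \<in> carrier_mat (d ^ n) (d ^ n) \<Longrightarrow> expval \<sigma> (kron (E (-1)) B) = (1/2 - u/2) * expval \<tau>2 B"
    using conditional_state[OF n s sym Yw, of "-1"] unfolding E_def u_def by auto
  define z where "z = (\<lambda>Z. expval \<sigma> (site d (Suc n) Z 0))"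
  define c where "c = (\<lambda>Z. expval \<sigma> (site2 d (Suc n) Y 0 Z 1))"
  have kE: "expval \<sigma> (kron (E t) (site d n Z 0)) = (z Z + t * c Z) / 2" if Z: "Z \<in> Obs" for t Z
  proof -
    note Zc = hermitian_carrier[OF herm[OF Z]]
    define B where "B = site d n Z 0"
    have B: "B \<in> carrier_mat (d ^ n) (d ^ n)" unfolding B_def site_def using Zc by (intro tensor_carrier) auto
    have f1: "kron (1\<^sub>m d) B = site d (Suc n) Z 1"
      unfolding B_def site_def tensor_Cons by (auto intro!: arg_cong[of _ _ "\<lambda>As. kron (1\<^sub>m d) (tensor As n)"])
    have f2: "kron Y B = site2 d (Suc n) Y 0 Z 1"
      unfolding B_def site_def site2_def tensor_Cons by (auto intro!: arg_cong[of _ _ "\<lambda>As. kron Y (tensor As n)"])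
    have "kron (E t) B = complex_of_real (1/2) \<cdot>\<^sub>m (kron (1\<^sub>m d) B + complex_of_real t \<cdot>\<^sub>m kron Y B)"
      unfolding E_def using Yc by (simp add: kron_smult_left kron_add_left[of _ d d])
    moreover have c: "kron (1\<^sub>m d) B \<in> carrier_mat (d * d ^ n) (d * d ^ n)" "kron Y B \<in> carrier_mat (d * d ^ n) (d * d ^ n)"
      using B Yc by auto
    ultimately have "expval \<sigma> (kron (E t) B) = 1/2 * (expval \<sigma> (kron (1\<^sub>m d) B) + t * expval \<sigma> (kron Y B))"
      using sc by (simp only: expval_smult[of _ "d * d ^ n"] expval_add[of _ "d * d ^ n"] smult_carrier_mat add_carrier_mat)
    also have "expval \<sigma> (kron (1\<^sub>m d) B) = z Z"
      unfolding f1 z_def by (rule symmetric_site[OF sym Zc]) (use n in auto)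
    finally have "expval \<sigma> (kron (E t) B) = 1/2 * (z Z + t * expval \<sigma> (kron Y B))" .
    then show ?thesis unfolding f2 by (simp add: c_def B_def)
  qed
  have gain: "(z Z)\<^sup>2 + (c Z - u * z Z)\<^sup>2 \<le> (1/2 + u/2) * (expval \<tau>1 (site d n Z 0))\<^sup>2 + (1/2 - u/2) * (expval \<tau>2 (site d n Z 0))\<^sup>2"
    if Z: "Z \<in> Obs" for Z
  proof (rule conditional_second_moment[OF u])
    have B: "site d n Z 0 \<in> carrier_mat (d ^ n) (d ^ n)"
      unfolding site_def using hermitian_carrier[OF herm[OF Z]] by (intro tensor_carrier) auto
    show "(1/2 + u/2) * expval \<tau>1 (site d n Z 0) = (z Z + c Z) / 2" using kE[OF Z, of 1] t1(3)[OF B] by simp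
    show "(1/2 - u/2) * expval \<tau>2 (site d n Z 0) = (z Z - c Z) / 2" using kE[OF Z, of "-1"] t2(3)[OF B] by simp
  qed
  have "potential Obs (Suc n) \<sigma> = (\<Sum>Z\<in>Obs. (z Z)\<^sup>2)" by (simp add: potential_def z_def)
  moreover have "(c Y - u * z Y)\<^sup>2 \<le> (\<Sum>Z\<in>Obs. (c Z - u * z Z)\<^sup>2)"
    using member_le_sum[of Y Obs "\<lambda>Z. (c Z - u * z Z)\<^sup>2"] Y Obs(1) by simp
  ultimately have "potential Obs (Suc n) \<sigma> + (c Y - u * z Y)\<^sup>2 \<le> (\<Sum>Z\<in>Obs. (z Z)\<^sup>2 + (c Z - u * z Z)\<^sup>2)"
    by (simp add: sum.distrib)
  also have "\<dots> \<le> (1/2 + u/2) * potential Obs n \<tau>1 + (1/2 - u/2) * potential Obs n \<tau>2"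
    unfolding potential_def sum_distrib_left sum.distrib[symmetric] by (intro sum_mono gain)
  finally have pot: "potential Obs (Suc n) \<sigma> + (c Y - u * z Y)\<^sup>2 \<le> (1/2 + u/2) * potential Obs n \<tau>1 + (1/2 - u/2) * potential Obs n \<tau>2" .
  have zu: "u * z Y = (expval \<sigma> (site d (Suc n) Y 0))\<^sup>2" by (simp add: u_def z_def power2_eq_square)
  have p: "0 \<le> 1/2 + u/2" "0 \<le> 1/2 - u/2" "(1/2 + u/2) + (1/2 - u/2) = (1::real)" using u by auto
  show ?thesis
    by (rule that[OF Epsd Epsd Esum p t1(1) t2(1) t1(2) t2(2) t1(3) t2(3)]) (use pot zu in \<open>auto simp: c_def\<close>)
qed

(* With k rounds left the error is at most \<eta> + (card Obs - potential) / (g\<^sup>2 k); multiplied out,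
   the bound also holds for k = 0, by the test that never accepts. *)
lemma adaptive_test:
  assumes Obs: "finite Obs" "\<And>Y. Y \<in> Obs \<Longrightarrow> weak_observable d r Y" and \<rho>: "\<rho> \<in> density d"
    and t: "0 \<le> t" and \<eta>: "0 \<le> \<eta>" and g: "0 \<le> g" and n0: "1 \<le> n0"
    and stop: "\<And>n \<sigma>. n0 \<le> n \<Longrightarrow> \<sigma> \<in> F n \<Longrightarrow> symmetric_state d n \<sigma> \<Longrightarrow>
      (\<And>Y. Y \<in> Obs \<Longrightarrow> expval \<sigma> (site2 d n Y 0 Y 1) - (expval \<sigma> (site d n Y 0))\<^sup>2 \<le> g) \<Longrightarrow>
      \<exists>M. psd (d ^ n) M \<and> psd (d ^ n) (1\<^sub>m (d ^ n) - M) \<and> expval \<sigma> (1\<^sub>m (d ^ n) - M) \<le> \<eta> \<and>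
        expval (tpow \<rho> n) M \<le> exp (- (real n * t))"
  shows "n0 + k \<le> n \<Longrightarrow> \<sigma> \<in> F n \<Longrightarrow> symmetric_state d n \<sigma> \<Longrightarrow>
    \<exists>M. psd (d ^ n) M \<and> psd (d ^ n) (1\<^sub>m (d ^ n) - M) \<and>
      g\<^sup>2 * real k * (expval \<sigma> (1\<^sub>m (d ^ n) - M) - \<eta>) \<le> real (card Obs) - potential Obs n \<sigma> \<and>
      expval (tpow \<rho> n) M \<le> exp (- (real (n - k) * t))"
proof (induction k arbitrary: n \<sigma>)
  case 0
  have n: "1 \<le> n" using 0 n0 by simp
  have R: "tpow \<rho> n \<in> carrier_mat (d ^ n) (d ^ n)" using densityD(2)[OF tpow_density[OF \<rho>]] .
  have "1\<^sub>m (d ^ n) - 0\<^sub>m (d ^ n) (d ^ n) = (1\<^sub>m (d ^ n) :: complex mat)" by (rule eq_matI) auto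
  moreover have "expval (tpow \<rho> n) (0\<^sub>m (d ^ n) (d ^ n)) = 0" using R by (simp add: expval_def mtrace_def)
  ultimately show ?case
    using potential_le[OF n 0(2) Obs(2)] psd_zero psd_one by (intro exI[of _ "0\<^sub>m (d ^ n) (d ^ n)"]) simp
next
  case (Suc k)
  have n1: "1 \<le> n" using Suc.prems n0 by simp
  show ?case
  proof (cases "\<forall>Y\<in>Obs. expval \<sigma> (site2 d n Y 0 Y 1) - (expval \<sigma> (site d n Y 0))\<^sup>2 \<le> g")
    case True
    then obtain M where M: "psd (d ^ n) M" "psd (d ^ n) (1\<^sub>m (d ^ n) - M)" "expval \<sigma> (1\<^sub>m (d ^ n) - M) \<le> \<eta>"
      "expval (tpow \<rho> n) M \<le> exp (- (real n * t))"
      using stop[of n \<sigma>] Suc.prems by auto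
    have "g\<^sup>2 * real (Suc k) * (expval \<sigma> (1\<^sub>m (d ^ n) - M) - \<eta>) \<le> 0"
      using M(3) by (intro mult_nonneg_nonpos) auto
    also have "\<dots> \<le> real (card Obs) - potential Obs n \<sigma>" using potential_le[OF n1 Suc.prems(2) Obs(2)] by simp
    finally have 1: "g\<^sup>2 * real (Suc k) * (expval \<sigma> (1\<^sub>m (d ^ n) - M) - \<eta>) \<le> real (card Obs) - potential Obs n \<sigma>" .
    have "exp (- (real n * t)) \<le> exp (- (real (n - Suc k) * t))" using t by (simp add: mult_right_mono)
    then have "expval (tpow \<rho> n) M \<le> exp (- (real (n - Suc k) * t))" by (rule order_trans[OF M(4)])
    then show ?thesis using M(1,2) 1 by blast
  next
    case False
    then obtain Y where Y: "Y \<in> Obs" "g < expval \<sigma> (site2 d n Y 0 Y 1) - (expval \<sigma> (site d n Y 0))\<^sup>2" by auto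
    obtain m where m: "n = Suc m" "n0 + k \<le> m" using Suc.prems(1) by (cases n) auto
    have m1: "1 \<le> m" using m n0 by simp
    have \<sigma>: "\<sigma> \<in> F (Suc m)" "symmetric_state d (Suc m) \<sigma>" using Suc.prems m by auto
    obtain E1 E2 p1 p2 \<tau>1 \<tau>2 where E: "psd d E1" "psd d E2" "E1 + E2 = 1\<^sub>m d" and p: "0 \<le> p1" "0 \<le> p2" "p1 + p2 = 1"
      and \<tau>: "\<tau>1 \<in> F m" "\<tau>2 \<in> F m" "symmetric_state d m \<tau>1" "symmetric_state d m \<tau>2"
      and e1: "\<And>B. B \<in> carrier_mat (d ^ m) (d ^ m) \<Longrightarrow> expval \<sigma> (kron E1 B) = p1 * expval \<tau>1 B"
      and e2: "\<And>B. B \<in> carrier_mat (d ^ m) (d ^ m) \<Longrightarrow> expval \<sigma> (kron E2 B) = p2 * expval \<tau>2 B"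
      and pot: "potential Obs (Suc m) \<sigma> + (expval \<sigma> (site2 d (Suc m) Y 0 Y 1) - (expval \<sigma> (site d (Suc m) Y 0))\<^sup>2)\<^sup>2
        \<le> p1 * potential Obs m \<tau>1 + p2 * potential Obs m \<tau>2"
      using measurement_step[OF m1 \<sigma> Y(1) Obs] by blast
    let ?N = "d ^ m" and ?K = "real (card Obs)"
    obtain M1 where M1: "psd ?N M1" "psd ?N (1\<^sub>m ?N - M1)"
      "g\<^sup>2 * real k * (expval \<tau>1 (1\<^sub>m ?N - M1) - \<eta>) \<le> ?K - potential Obs m \<tau>1"
      "expval (tpow \<rho> m) M1 \<le> exp (- (real (m - k) * t))" using Suc.IH[OF m(2) \<tau>(1,3)] by blast
    obtain M2 where M2: "psd ?N M2" "psd ?N (1\<^sub>m ?N - M2)"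
      "g\<^sup>2 * real k * (expval \<tau>2 (1\<^sub>m ?N - M2) - \<eta>) \<le> ?K - potential Obs m \<tau>2"
      "expval (tpow \<rho> m) M2 \<le> exp (- (real (m - k) * t))" using Suc.IH[OF m(2) \<tau>(2,4)] by blast
    note Ec = psd_carrier[OF E(1)] psd_carrier[OF E(2)] and Mc = psd_carrier[OF M1(1)] psd_carrier[OF M2(1)]
    \<comment> \<open>Measure the first system and continue with the test that belongs to the
      outcome; \<open>M'\<close> is the same procedure with rejection in place of
      acceptance.\<close>
    define M where "M = kron E1 M1 + kron E2 M2"
    define M' where "M' = kron E1 (1\<^sub>m ?N - M1) + kron E2 (1\<^sub>m ?N - M2)"
    have kc: "kron E1 M1 \<in> carrier_mat (d * ?N) (d * ?N)" "kron E2 M2 \<in> carrier_mat (d * ?N) (d * ?N)"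
      "kron E1 (1\<^sub>m ?N - M1) \<in> carrier_mat (d * ?N) (d * ?N)" "kron E2 (1\<^sub>m ?N - M2) \<in> carrier_mat (d * ?N) (d * ?N)"
      using Ec Mc by (auto intro!: kron_carrier minus_carrier_mat)
    have Mpsd: "psd (d * ?N) M" unfolding M_def by (intro psd_add psd_kron E M1 M2)
    have M'psd: "psd (d * ?N) M'" unfolding M'_def by (intro psd_add psd_kron E M1 M2)
    have "kron E1 (1\<^sub>m ?N) + kron E2 (1\<^sub>m ?N) = 1\<^sub>m (d * ?N)"
      using kron_add_left[OF Ec, of "1\<^sub>m ?N"] E(3) by (simp add: kron_one)
    then have "1\<^sub>m (d * ?N) - M = kron E1 (1\<^sub>m ?N) + kron E2 (1\<^sub>m ?N) - (kron E1 M1 + kron E2 M2)" by (simp add: M_def)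
    also have "\<dots> = (kron E1 (1\<^sub>m ?N) - kron E1 M1) + (kron E2 (1\<^sub>m ?N) - kron E2 M2)"
      using Ec Mc by (intro eq_matI) auto
    also have "\<dots> = M'" unfolding M'_def
      using kron_minus_right[OF one_carrier_mat Mc(1), of E1] kron_minus_right[OF one_carrier_mat Mc(2), of E2] by simp
    finally have compl: "1\<^sub>m (d * ?N) - M = M'" .
    have sc: "\<sigma> \<in> carrier_mat (d * ?N) (d * ?N)" using densityD(2)[OF free_density[OF _ \<sigma>(1)]] by simp
    define x1 x2 where "x1 = expval \<tau>1 (1\<^sub>m ?N - M1)" and "x2 = expval \<tau>2 (1\<^sub>m ?N - M2)"
    have err: "expval \<sigma> M' = p1 * x1 + p2 * x2"
      unfolding M'_def expval_add[OF kc(3,4) sc] x1_def x2_def 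
      using e1[OF minus_carrier_mat[OF Mc(1)]] e2[OF minus_carrier_mat[OF Mc(2)]] by simp
    have "x1 \<le> 1" "x2 \<le> 1"
      unfolding x1_def x2_def
      using expval_minus[OF one_carrier_mat Mc(1)] expval_minus[OF one_carrier_mat Mc(2)]
        expval_nonneg[OF M1(1)] expval_nonneg[OF M2(1)] densityD[OF free_density[OF m1 \<tau>(1)]] densityD[OF free_density[OF m1 \<tau>(2)]]
      by auto
    then have err1: "p1 * x1 + p2 * x2 \<le> 1"
      using p mult_left_mono[of x1 1 p1] mult_left_mono[of x2 1 p2] by linarith
    define G where "G = g\<^sup>2"
    have G: "0 \<le> G" by (simp add: G_def)
    have "G \<le> (expval \<sigma> (site2 d (Suc m) Y 0 Y 1) - (expval \<sigma> (site d (Suc m) Y 0))\<^sup>2)\<^sup>2"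
      unfolding G_def using Y(2) g m(1) by (intro power_mono) auto
    then have pot': "potential Obs (Suc m) \<sigma> + G \<le> p1 * potential Obs m \<tau>1 + p2 * potential Obs m \<tau>2" using pot by simp
    have "p1 * (G * real k * (x1 - \<eta>)) + p2 * (G * real k * (x2 - \<eta>))
        \<le> p1 * (?K - potential Obs m \<tau>1) + p2 * (?K - potential Obs m \<tau>2)"
      unfolding x1_def x2_def G_def by (intro add_mono mult_left_mono M1(3) M2(3) p)
    also have "\<dots> = (p1 + p2) * ?K - (p1 * potential Obs m \<tau>1 + p2 * potential Obs m \<tau>2)" by (simp add: algebra_simps)
    also have "\<dots> \<le> ?K - potential Obs (Suc m) \<sigma> - G" using pot' p(3) by simp
    also have "p1 * (G * real k * (x1 - \<eta>)) + p2 * (G * real k * (x2 - \<eta>))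
        = G * real k * (p1 * x1 + p2 * x2 - (p1 + p2) * \<eta>)" by (simp add: algebra_simps)
    finally have i1: "G * real k * (p1 * x1 + p2 * x2 - \<eta>) \<le> ?K - potential Obs (Suc m) \<sigma> - G" using p(3) by simp
    \<comment> \<open>One more round adds another multiple \<open>G\<close> of the excess error. As
      errors are at most 1, the gain \<open>G\<close> in potential pays for it.\<close>
    have "G * (p1 * x1 + p2 * x2 - \<eta>) \<le> G * 1" using err1 \<eta> G by (intro mult_left_mono) auto
    then have "G * real (Suc k) * (p1 * x1 + p2 * x2 - \<eta>) \<le> ?K - potential Obs (Suc m) \<sigma>"
      using i1 by (simp add: algebra_simps)
    then have r1: "g\<^sup>2 * real (Suc k) * (expval \<sigma> M' - \<eta>) \<le> ?K - potential Obs (Suc m) \<sigma>" unfolding err G_def .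
    note \<rho>' = densityD[OF \<rho>] and \<rho>m = densityD[OF tpow_density[OF \<rho>, of m]]
    have tp: "tpow \<rho> (Suc m) = kron \<rho> (tpow \<rho> m)"
      using tensor_Cons[of "\<lambda>_. \<rho>" m] by (simp only: tensor_const)
    have ke: "expval (tpow \<rho> (Suc m)) (kron E' B) = expval \<rho> E' * expval (tpow \<rho> m) B"
      if "psd d E'" "psd ?N B" for E' B
    proof -
      note c = psd_carrier[OF that(1)] psd_carrier[OF that(2)]
      have "mtrace (kron E' B * kron \<rho> (tpow \<rho> m)) = mtrace (E' * \<rho>) * mtrace (B * tpow \<rho> m)"
        using kron_mult[OF c(1) \<rho>'(2) c(2) \<rho>m(2)] mtrace_kron[of "E' * \<rho>" d "B * tpow \<rho> m" ?N] c \<rho>'(2) \<rho>m(2)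
        by (metis mult_carrier_mat)
      also have "\<dots> = complex_of_real (expval \<rho> E' * expval (tpow \<rho> m) B)"
        using mtrace_hermitian_mult_real[OF psd_hermitian[OF that(1)] psd_hermitian[OF \<rho>'(1)]]
          mtrace_hermitian_mult_real[OF psd_hermitian[OF that(2)] psd_hermitian[OF \<rho>m(1)]] by simp
      finally show ?thesis unfolding tp by (simp add: expval_def)
    qed
    have Rc: "tpow \<rho> (Suc m) \<in> carrier_mat (d * ?N) (d * ?N)" using densityD(2)[OF tpow_density[OF \<rho>, of "Suc m"]] by simp
    let ?b = "exp (- (real (m - k) * t))"
    \<comment> \<open>For \<open>\<rho>\<close> the two outcomes have total probability 1, so the
      second error is an average over the branches. The exponent fits because \<open>m - k\<close>
      equals \<open>n - Suc k\<close>.\<close>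
    have "expval (tpow \<rho> (Suc m)) M = expval \<rho> E1 * expval (tpow \<rho> m) M1 + expval \<rho> E2 * expval (tpow \<rho> m) M2"
      unfolding M_def expval_add[OF kc(1,2) Rc] using ke E M1 M2 by simp
    also have "\<dots> \<le> expval \<rho> E1 * ?b + expval \<rho> E2 * ?b"
      by (intro add_mono mult_left_mono M1(4) M2(4) expval_nonneg[OF E(1) \<rho>'(1)] expval_nonneg[OF E(2) \<rho>'(1)])
    also have "\<dots> = (expval \<rho> E1 + expval \<rho> E2) * ?b" by (simp add: distrib_right)
    also have "expval \<rho> E1 + expval \<rho> E2 = 1" using expval_add[OF Ec \<rho>'(2)] E(3) \<rho>'(4) by simp
    finally have r2: "expval (tpow \<rho> (Suc m)) M \<le> exp (- (real (n - Suc k) * t))" using m by simp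
    show ?thesis unfolding m(1) power_Suc
      using Mpsd M'psd r1 r2 m(1) by (intro exI[of _ M]) (simp add: compl)
  qed
qed

end

section \<open>Choice of scale, and the test for an arbitrary free state\<close>

lemma common_scale:
  assumes "finite X" "\<And>x. x \<in> X \<Longrightarrow> hermitian d x" "0 < d" "0 < r"
  shows "\<exists>c>0. \<forall>x\<in>X. weak_observable d r (complex_of_real c \<cdot>\<^sub>m x)"
proof -
  have "\<forall>x\<in>X. \<exists>c0>0. \<forall>c. 0 < c \<and> c \<le> c0 \<longrightarrow> weak_observable d r (complex_of_real c \<cdot>\<^sub>m x)"
    using weak_observable_scale[OF assms(2) assms(3,4)] by blast
  then obtain c0 where c0: "\<And>x. x \<in> X \<Longrightarrow> 0 < c0 x \<and> (\<forall>c. 0 < c \<and> c \<le> c0 x \<longrightarrow> weak_observable d r (complex_of_real c \<cdot>\<^sub>m x))"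
    by metis
  define c where "c = Min (insert 1 (c0 ` X))"
  have "0 < c" unfolding c_def using assms(1) c0 by (subst Min_gr_iff) auto
  moreover have "c \<le> c0 x" if "x \<in> X" for x unfolding c_def using assms(1) that by (intro Min_le) auto
  ultimately show ?thesis using c0 by blast
qed

text \<open>Covariances scale by \<open>c\<^sup>2\<close>, so the threshold
  \<open>c\<^sup>2 * v\<close> for scaled observables means the threshold \<open>v\<close> for the
  original ones.\<close>

lemma expval_site_spec_scale:
  assumes U: "unitary d U" and S: "S \<in> carrier_mat (d ^ n) (d ^ n)" and n: "2 \<le> n"
  shows "expval S (site d n (complex_of_real c \<cdot>\<^sub>m spec d U f) 0) = c * expval S (site d n (spec d U f) 0)"
    "expval S (site2 d n (complex_of_real c \<cdot>\<^sub>m spec d U f) 0 (complex_of_real c \<cdot>\<^sub>m spec d U f) 1)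
      = c\<^sup>2 * expval S (site2 d n (spec d U f) 0 (spec d U f) 1)"
  using n unfolding spec_smult[OF U]
  by (simp_all add: expval_site_spec[OF U S] expval_site2_spec[OF U S] sum_distrib_left power2_eq_square mult_ac)

context free_states
begin

text \<open>All parameters are fixed before \<open>n\<close> and \<open>\<sigma>\<close>: the
  finitely many observables come from compactness, and the number of rounds depends only on them and
  on the error.\<close>

lemma uniform_test:
  assumes closed: "closed_set d (F 1)" and \<rho>: "\<rho> \<in> density d" and \<epsilon>: "0 < \<epsilon>" and t: "0 \<le> t" "t < t1"
    and D: "\<forall>\<omega>\<in>F 1. ereal t1 < rel_ent d \<omega> \<rho>"
  shows "\<exists>N. \<forall>n\<ge>N. \<forall>\<sigma>\<in>F n. \<exists>M. psd (d ^ n) M \<and> psd (d ^ n) (1\<^sub>m (d ^ n) - M) \<and>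
    expval \<sigma> (1\<^sub>m (d ^ n) - M) \<le> \<epsilon> \<and> expval (tpow \<rho> n) M \<le> exp (- (real n * t))"
proof -
  have F1: "F 1 \<subseteq> density d" using states[of 1] by simp
  obtain U l and J :: "((nat \<Rightarrow> real) \<times> complex mat \<times> (nat \<Rightarrow> real)) set" where U: "unitary d U" and \<rho>U: "\<rho> = spec d U l"
    and l0: "\<forall>i<d. 0 \<le> l i" and J: "finite J"
    and JP: "\<forall>(f,V,h)\<in>J. unitary d V \<and> (\<forall>i<d. l i \<le> exp (- f i)) \<and> (\<Sum>i<d. exp (- h i)) \<le> 1"
    and Jw: "\<forall>\<omega>\<in>F 1. \<exists>(f,V,h)\<in>J. t1 < expval \<omega> (spec d U f) - expval \<omega> (spec d V h)"
    using finite_rel_ent_witnesses[OF F1 closed \<rho> d_pos D] by (elim exE conjE) (rule that)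
  \<comment> \<open>The gap is halved: the part \<open>t1 - t2\<close>, equal to
    \<open>2 * \<delta>\<close>, pays for the width of the two typical sets, and
    \<open>t2 - t\<close> pays for the measured systems.\<close>
  define t2 where "t2 = (t + t1) / 2"
  define \<delta> where "\<delta> = (t1 - t2) / 2"
  have t2: "t < t2" "0 \<le> t2" and \<delta>: "0 < \<delta>" using t by (auto simp: t2_def \<delta>_def field_simps)
  \<comment> \<open>The marginal at which the rounds will stop is not known in advance, so the
    observables of all triples are monitored together.\<close>
  define X where "X = (\<lambda>(f,V,h). spec d U f) ` J \<union> (\<lambda>(f,V,h). spec d V h) ` J"
  have X: "finite X" "\<And>x. x \<in> X \<Longrightarrow> hermitian d x" unfolding X_def using J U JP by (auto intro!: spec_hermitian)
  obtain c where c: "0 < c" "\<And>x. x \<in> X \<Longrightarrow> weak_observable d r (complex_of_real c \<cdot>\<^sub>m x)"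
    using common_scale[OF X d_pos r_pos] by blast
  define Obs where "Obs = (\<lambda>x. complex_of_real c \<cdot>\<^sub>m x) ` X"
  have Obs: "finite Obs" "\<And>Y. Y \<in> Obs \<Longrightarrow> weak_observable d r Y" using X(1) c(2) by (auto simp: Obs_def)
  define K where "K = (\<Sum>(f,V,h)\<in>J. \<Sum>i<d. \<bar>f i\<bar> + \<bar>h i\<bar>)"
  have K: "\<bar>f i\<bar> \<le> K" "\<bar>h i\<bar> \<le> K" if "(f,V,h) \<in> J" "i < d" for f V h i
  proof -
    have "\<bar>f i\<bar> + \<bar>h i\<bar> \<le> (\<Sum>i<d. \<bar>f i\<bar> + \<bar>h i\<bar>)"
      by (rule member_le_sum[of i "{..<d}" "\<lambda>i. \<bar>f i\<bar> + \<bar>h i\<bar>"]) (use that in auto)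
    also have "\<dots> = (case (f,V,h) of (f,V,h) \<Rightarrow> \<Sum>i<d. \<bar>f i\<bar> + \<bar>h i\<bar>)" by simp
    also have "\<dots> \<le> K" unfolding K_def
      by (rule member_le_sum) (use that J in \<open>auto intro!: sum_nonneg\<close>)
    finally show "\<bar>f i\<bar> \<le> K" "\<bar>h i\<bar> \<le> K" by auto
  qed
  \<comment> \<open>Chebyshev's \<open>1 / n\<close> term and the covariance each contribute at most
    \<open>v\<close>; with the factor 5 from \<open>typical_test\<close> the error is
    \<open>5 * (2 * v) / \<delta>\<^sup>2\<close>, that is \<open>\<epsilon> / 2\<close>.\<close>
  define v where "v = \<epsilon> * \<delta>\<^sup>2 / 20"
  have v: "0 < v" using \<epsilon> \<delta> by (simp add: v_def)
  define g where "g = c\<^sup>2 * v"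
  have g: "0 < g" using c v by (simp add: g_def)
  define n0 where "n0 = max 2 (nat \<lceil>2 * K\<^sup>2 / v\<rceil>)"
  have n0: "2 \<le> n0" by (simp add: n0_def)
  have n0K: "2 * K\<^sup>2 / real n \<le> v" if "n0 \<le> n" for n
  proof -
    have n: "0 < real n" using n0 that by simp
    have "2 * K\<^sup>2 / v \<le> real n" using that unfolding n0_def by linarith
    then show ?thesis using v n by (simp add: field_simps)
  qed
  have stop: "\<exists>M. psd (d ^ n) M \<and> psd (d ^ n) (1\<^sub>m (d ^ n) - M) \<and> expval \<sigma> (1\<^sub>m (d ^ n) - M) \<le> \<epsilon> / 2 \<and>
        expval (tpow \<rho> n) M \<le> exp (- (real n * t2))"
    if n: "n0 \<le> n" and s: "\<sigma> \<in> F n" and sym: "symmetric_state d n \<sigma>"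
      and cov: "\<And>Y. Y \<in> Obs \<Longrightarrow> expval \<sigma> (site2 d n Y 0 Y 1) - (expval \<sigma> (site d n Y 0))\<^sup>2 \<le> g" for n \<sigma>
  proof -
    have n2: "2 \<le> n" and n1: "1 \<le> n" using n n0 by auto
    have sd: "\<sigma> \<in> density (d ^ n)" by (rule free_density[OF n1 s])
    note sc = densityD(2)[OF sd]
    obtain \<omega> where \<omega>: "\<omega> \<in> F 1" "\<forall>A\<in>carrier_mat d d. expval \<sigma> (site d n A 0) = expval \<omega> A"
      using site_marginal[OF n1 s] by blast
    obtain x where x: "x \<in> J" "case x of (f,V,h) \<Rightarrow> t1 < expval \<omega> (spec d U f) - expval \<omega> (spec d V h)"
      using bspec[OF Jw \<omega>(1)] by (elim bexE)
    obtain f V h where fVh: "(f,V,h) \<in> J" "t1 < expval \<omega> (spec d U f) - expval \<omega> (spec d V h)"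
      using x by (cases x) simp
    have V: "unitary d V" and lf: "\<And>i. i < d \<Longrightarrow> l i \<le> exp (- f i)" and h1: "(\<Sum>i<d. exp (- h i)) \<le> 1"
      using bspec[OF JP fVh(1)] by simp_all
    have cov': "expval \<sigma> (site2 d n (spec d W q) 0 (spec d W q) 1) - (expval \<sigma> (site d n (spec d W q) 0))\<^sup>2 \<le> v"
      if W: "unitary d W" "spec d W q \<in> X" for W q
    proof -
      have "complex_of_real c \<cdot>\<^sub>m spec d W q \<in> Obs" using W by (simp add: Obs_def)
      from cov[OF this] have "c\<^sup>2 * (expval \<sigma> (site2 d n (spec d W q) 0 (spec d W q) 1) - (expval \<sigma> (site d n (spec d W q) 0))\<^sup>2) \<le> c\<^sup>2 * v"
        unfolding expval_site_spec_scale[OF W(1) sc n2] g_def by (simp add: power_mult_distrib right_diff_distrib)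
      then show ?thesis using c(1) by simp
    qed
    have XfV: "spec d U f \<in> X" "spec d V h \<in> X" using fVh(1) unfolding X_def by force+
    define a b where "a = expval \<sigma> (site d n (spec d U f) 0)" and "b = expval \<sigma> (site d n (spec d V h) 0)"
    have "a = expval \<omega> (spec d U f)" "b = expval \<omega> (spec d V h)" using \<omega>(2) U V by (auto simp: a_def b_def)
    then have ab: "t2 \<le> a - b - 2 * \<delta>" using fVh(2) by (simp add: \<delta>_def field_simps)
    have "\<exists>M. psd (d ^ n) M \<and> psd (d ^ n) (1\<^sub>m (d ^ n) - M) \<and>
      expval \<sigma> (1\<^sub>m (d ^ n) - M) \<le> 5 * ((2 * K\<^sup>2 / real n + v) / \<delta>\<^sup>2) \<and>
      expval (tpow (spec d U l) n) M \<le> exp (- (real n * (a - b - 2 * \<delta>)))"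
    proof (rule typical_test[OF U V sd n2 d_pos \<delta> _ h1])
      show "0 \<le> l i \<and> l i \<le> exp (- f i)" if "i < d" for i using that l0 lf by blast
      show "\<bar>f i\<bar> \<le> K" "\<bar>h i\<bar> \<le> K" if "i < d" for i using K[OF fVh(1) that] by auto
      show "expval \<sigma> (site d n (spec d U f) k) = a" "expval \<sigma> (site d n (spec d V h) k) = b" if "k < n" for k
        unfolding a_def b_def by (rule symmetric_site[OF sym _ that], use U V in simp)+
      show "expval \<sigma> (site2 d n (spec d U f) k (spec d U f) j) = expval \<sigma> (site2 d n (spec d U f) 0 (spec d U f) 1)"
        "expval \<sigma> (site2 d n (spec d V h) k (spec d V h) j) = expval \<sigma> (site2 d n (spec d V h) 0 (spec d V h) 1)"
        if "k < n" "j < n" "k \<noteq> j" for k j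
        by (rule symmetric_site2[OF sym _ _ that], use U V in simp, use U V in simp)+
      show "expval \<sigma> (site2 d n (spec d U f) 0 (spec d U f) 1) - a\<^sup>2 \<le> v"
        unfolding a_def by (rule cov'[OF U XfV(1)])
      show "expval \<sigma> (site2 d n (spec d V h) 0 (spec d V h) 1) - b\<^sup>2 \<le> v"
        unfolding b_def by (rule cov'[OF V XfV(2)])
    qed
    then obtain M where M: "psd (d ^ n) M" "psd (d ^ n) (1\<^sub>m (d ^ n) - M)"
      "expval \<sigma> (1\<^sub>m (d ^ n) - M) \<le> 5 * ((2 * K\<^sup>2 / real n + v) / \<delta>\<^sup>2)"
      "expval (tpow \<rho> n) M \<le> exp (- (real n * (a - b - 2 * \<delta>)))" unfolding \<rho>U by blast
    have "5 * ((2 * K\<^sup>2 / real n + v) / \<delta>\<^sup>2) \<le> 5 * ((v + v) / \<delta>\<^sup>2)"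
      using n0K[OF n] by (intro mult_left_mono divide_right_mono add_right_mono) auto
    also have "\<dots> = \<epsilon> / 2" using \<delta> by (simp add: v_def field_simps)
    finally have e: "expval \<sigma> (1\<^sub>m (d ^ n) - M) \<le> \<epsilon> / 2" by (rule order_trans[OF M(3)])
    have "exp (- (real n * (a - b - 2 * \<delta>))) \<le> exp (- (real n * t2))" using mult_left_mono[OF ab, of "real n"] by simp
    then show ?thesis using M(1,2,4) e by (meson order_trans)
  qed
  define C where "C = real (card Obs)"
  \<comment> \<open>The excess error after \<open>k\<close> rounds is at most
    \<open>C / (g\<^sup>2 * k)\<close>, which this choice brings down to
    \<open>\<epsilon> / 2\<close>; \<open>Suc\<close> keeps \<open>k\<close> positive.\<close>
  define k where "k = Suc (nat \<lceil>2 * C / (\<epsilon> * g\<^sup>2)\<rceil>)"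
  \<comment> \<open>At most \<open>k\<close> systems are spent; from \<open>N\<close> on the loss
    \<open>k * t2\<close> is covered by \<open>n * (t2 - t)\<close>.\<close>
  define N where "N = max (n0 + k) (nat \<lceil>real k * t2 / (t2 - t)\<rceil>)"
  have "\<exists>M. psd (d ^ n) M \<and> psd (d ^ n) (1\<^sub>m (d ^ n) - M) \<and>
    expval \<sigma> (1\<^sub>m (d ^ n) - M) \<le> \<epsilon> \<and> expval (tpow \<rho> n) M \<le> exp (- (real n * t))"
    if n: "N \<le> n" and s: "\<sigma> \<in> F n" for n \<sigma>
  proof -
    have nk: "n0 + k \<le> n" "1 \<le> n" using n n0 by (auto simp: N_def)
    let ?N = "d ^ n"
    have sc: "\<sigma> \<in> carrier_mat ?N ?N" using densityD(2)[OF free_density[OF nk(2) s]] .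
    obtain \<tau> where \<tau>: "\<tau> \<in> F n" "symmetric_state d n \<tau>" and av: "\<And>T. T \<in> carrier_mat ?N ?N \<Longrightarrow>
      \<exists>\<pi>. \<pi> permutes {..<n} \<and> expval (perm_unitary d n \<pi> * \<sigma> * adj (perm_unitary d n \<pi>)) T \<le> expval \<tau> T"
      using symmetrize[OF nk(2) s] by blast
    have n01: "1 \<le> n0" using n0 by simp
    have g0: "0 \<le> g" and e0: "0 \<le> \<epsilon> / 2" using g \<epsilon> by auto
    have "\<exists>M. psd ?N M \<and> psd ?N (1\<^sub>m ?N - M) \<and>
      g\<^sup>2 * real k * (expval \<tau> (1\<^sub>m ?N - M) - \<epsilon> / 2) \<le> C - potential Obs n \<tau> \<and>
      expval (tpow \<rho> n) M \<le> exp (- (real (n - k) * t2))"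
      unfolding C_def by (rule adaptive_test[OF Obs \<rho> t2(2) e0 g0 n01 stop nk(1) \<tau>])
    then obtain M where M: "psd ?N M" "psd ?N (1\<^sub>m ?N - M)"
      "g\<^sup>2 * real k * (expval \<tau> (1\<^sub>m ?N - M) - \<epsilon> / 2) \<le> C - potential Obs n \<tau>"
      "expval (tpow \<rho> n) M \<le> exp (- (real (n - k) * t2))" by blast
    have err: "expval \<tau> (1\<^sub>m ?N - M) \<le> \<epsilon>"
    proof (rule ccontr)
      assume "\<not> ?thesis"
      then have "g\<^sup>2 * real k * (\<epsilon> / 2) < g\<^sup>2 * real k * (expval \<tau> (1\<^sub>m ?N - M) - \<epsilon> / 2)"
        using g by (intro mult_strict_left_mono) (auto simp: k_def)
      also have "\<dots> \<le> C - potential Obs n \<tau>" by (rule M(3))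
      also have "\<dots> \<le> C" by (simp add: potential_def sum_nonneg)
      finally have 1: "g\<^sup>2 * real k * (\<epsilon> / 2) < C" .
      have "2 * C / (\<epsilon> * g\<^sup>2) \<le> real k" unfolding k_def by linarith
      then have "C \<le> g\<^sup>2 * real k * (\<epsilon> / 2)" using g \<epsilon> by (simp add: field_simps)
      then show False using 1 by simp
    qed
    have Mc: "1\<^sub>m ?N - M \<in> carrier_mat ?N ?N" using psd_carrier[OF M(2)] .
    obtain \<pi> where \<pi>: "\<pi> permutes {..<n}" "expval (perm_unitary d n \<pi> * \<sigma> * adj (perm_unitary d n \<pi>)) (1\<^sub>m ?N - M) \<le> expval \<tau> (1\<^sub>m ?N - M)"
      using av[OF Mc] by blast
    define P where "P = perm_unitary d n \<pi>"
    have P: "P \<in> carrier_mat ?N ?N" "unitary ?N P" unfolding P_def using unitary_perm_unitary[OF d_pos \<pi>(1)] by auto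
    \<comment> \<open>The test is good for one permuted copy of \<open>\<sigma>\<close>; pulling
      that permutation back onto the test makes it good for \<open>\<sigma>\<close> itself.\<close>
    define M' where "M' = adj P * M * P"
    have M'c: "adj P * (1\<^sub>m ?N - M) * P = 1\<^sub>m ?N - M'"
    proof -
      have Mc': "M \<in> carrier_mat ?N ?N" using psd_carrier[OF M(1)] .
      have aP: "adj P \<in> carrier_mat ?N ?N" using P by simp
      have "adj P * (1\<^sub>m ?N - M) = adj P * 1\<^sub>m ?N - adj P * M"
        by (rule mult_minus_distrib_mat[OF aP one_carrier_mat Mc'])
      also have "adj P * 1\<^sub>m ?N = adj P" by (rule right_mult_one_mat[OF aP])
      finally have "adj P * (1\<^sub>m ?N - M) * P = (adj P - adj P * M) * P" by simp
      also have "\<dots> = adj P * P - adj P * M * P"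
        by (rule minus_mult_distrib_mat[OF aP mult_carrier_mat[OF aP Mc'] P(1)])
      finally show ?thesis using unitary_left[OF P(2)] by (simp add: M'_def)
    qed
    have sw: "expval S (adj P * T * P) = expval (P * S * adj P) T" if "T \<in> carrier_mat ?N ?N" "S \<in> carrier_mat ?N ?N" for S T
      unfolding expval_def using mtrace_conj_swap[OF that(1) P(1) that(2)] by simp
    have "psd ?N M'" unfolding M'_def by (rule psd_conj[OF M(1) P(1)])
    moreover have "psd ?N (1\<^sub>m ?N - M')" unfolding M'c[symmetric] by (rule psd_conj[OF M(2) P(1)])
    moreover have "expval \<sigma> (1\<^sub>m ?N - M') \<le> \<epsilon>"
      unfolding M'c[symmetric] sw[OF Mc sc] using \<pi>(2) err by (simp add: P_def)
    moreover have "expval (tpow \<rho> n) M' \<le> exp (- (real n * t))"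
    proof -
      have "expval (tpow \<rho> n) M' = expval (P * tpow \<rho> n * adj P) M"
        unfolding M'_def by (rule sw[OF psd_carrier[OF M(1)] densityD(2)[OF tpow_density[OF \<rho>]]])
      also have "P * tpow \<rho> n * adj P = tpow \<rho> n"
        unfolding P_def by (rule perm_unitary_conj_tpow[OF d_pos \<pi>(1) densityD(2)[OF \<rho>]])
      also have "expval (tpow \<rho> n) M \<le> exp (- (real (n - k) * t2))" by (rule M(4))
      also have "\<dots> \<le> exp (- (real n * t))"
      proof -
        have "real k * t2 / (t2 - t) \<le> real n" using n unfolding N_def by linarith
        then have "real k * t2 \<le> real n * (t2 - t)" using t2 by (simp add: field_simps)
        moreover have "real (n - k) = real n - real k" using nk by simp
        ultimately show ?thesis by (simp add: algebra_simps)
      qed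
      finally show ?thesis .
    qed
    ultimately show ?thesis by blast
  qed
  then show ?thesis by blast
qed

end

section \<open>The exponent\<close>

text \<open>One test bounds the infimum from above. If the infimum is 0 the value is
  \<open>\<infinity>\<close>; otherwise take logarithms.\<close>

lemma DH_ge:
  assumes "psd N M" "psd N (1\<^sub>m N - M)" "expval \<sigma> (1\<^sub>m N - M) \<le> \<epsilon>" "expval \<omega> M \<le> exp (- x)" "psd N \<omega>"
  shows "ereal x \<le> DH N \<epsilon> \<sigma> \<omega>"
proof -
  define A where "A = {Re (mtrace (M * \<omega>)) | M. psd N M \<and> psd N (1\<^sub>m N - M) \<and> Re (mtrace ((1\<^sub>m N - M) * \<sigma>)) \<le> \<epsilon>}"
  have A: "expval \<omega> M \<in> A" using assms unfolding A_def expval_def by blast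
  have pos: "0 \<le> a" if "a \<in> A" for a using that mtrace_psd_mult_nonneg[OF _ assms(5)] by (auto simp: A_def)
  have "Inf A \<le> exp (- x)" using cInf_lower[OF A] pos assms(4) by (meson bdd_belowI order_trans)
  moreover have "0 \<le> Inf A" using A pos by (intro cInf_greatest) auto
  moreover have "x \<le> - ln (Inf A)" if "0 < Inf A" "Inf A \<le> exp (- x)"
    using ln_le_cancel_iff[of "Inf A" "exp (- x)"] that by simp
  ultimately show ?thesis unfolding DH_def A_def[symmetric] Let_def by (auto simp: less_le)
qed

text \<open>The test that always accepts keeps the set of errors nonempty, and the common lower
  bound keeps its infimum positive, which rules out the value \<open>\<infinity>\<close>.\<close>

lemma DH_le:
  assumes "\<And>M. psd N M \<Longrightarrow> psd N (1\<^sub>m N - M) \<Longrightarrow> expval \<sigma> (1\<^sub>m N - M) \<le> \<epsilon> \<Longrightarrow> exp (- x) \<le> expval \<omega> M"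
    and "\<sigma> \<in> carrier_mat N N" "0 \<le> \<epsilon>"
  shows "DH N \<epsilon> \<sigma> \<omega> \<le> ereal x"
proof -
  define A where "A = {Re (mtrace (M * \<omega>)) | M. psd N M \<and> psd N (1\<^sub>m N - M) \<and> Re (mtrace ((1\<^sub>m N - M) * \<sigma>)) \<le> \<epsilon>}"
  have z: "1\<^sub>m N - 1\<^sub>m N = (0\<^sub>m N N :: complex mat)" by (rule eq_matI) auto
  have e: "Re (mtrace ((1\<^sub>m N - 1\<^sub>m N) * \<sigma>)) \<le> \<epsilon>" unfolding z using assms(2,3) by (simp add: mtrace_def)
  have "psd N (1\<^sub>m N - 1\<^sub>m N)" unfolding z by (rule psd_zero)
  then have "Re (mtrace (1\<^sub>m N * \<omega>)) \<in> A"
    unfolding A_def by (intro CollectI exI[of _ "1\<^sub>m N"] conjI refl psd_one e)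
  then have ne: "A \<noteq> {}" by blast
  have "exp (- x) \<le> Inf A" using ne assms(1) by (intro cInf_greatest) (auto simp: A_def expval_def)
  moreover from this have "0 < Inf A" using exp_gt_zero[of "- x"] by linarith
  ultimately have "- ln (Inf A) \<le> x" using ln_le_cancel_iff[of "exp (- x)" "Inf A"] by simp
  then show ?thesis using \<open>0 < Inf A\<close> unfolding DH_def A_def[symmetric] Let_def by simp
qed

text \<open>The additive error in \<open>stein_converse\<close> tends to 0, so any fixed acceptance
  probability, however small, already forces the exponent.\<close>

lemma DH_iid_upper:
  assumes \<sigma>: "\<sigma> \<in> density d" and \<rho>: "\<rho> \<in> density d" and d: "0 < d" and \<epsilon>: "0 < \<epsilon>" "\<epsilon> < 1"
    and D: "rel_ent d \<sigma> \<rho> < ereal y"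
  shows "\<forall>\<^sub>F n in sequentially. DH (d ^ n) \<epsilon> (tpow \<sigma> n) (tpow \<rho> n) \<le> ereal (real n * y)"
proof -
  obtain U l where U: "unitary d U" and l0: "\<And>i. i < d \<Longrightarrow> 0 \<le> l i" and \<rho>U: "\<rho> = spec d U l"
    and logr: "mat_log d \<rho> = spec d U (\<lambda>i. ln (l i))" using mat_log_spec[OF densityD(1)[OF \<rho>]] by metis
  obtain V s where V: "unitary d V" and s0: "\<And>i. i < d \<Longrightarrow> 0 \<le> s i" and \<sigma>V: "\<sigma> = spec d V s"
    and logs: "mat_log d \<sigma> = spec d V (\<lambda>i. ln (s i))" using mat_log_spec[OF densityD(1)[OF \<sigma>]] by metis
  have fin: "rel_ent d \<sigma> \<rho> \<noteq> \<infinity>" using D by auto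
  define a b where "a = expval \<sigma> (spec d U (\<lambda>i. - ln (l i)))" and "b = expval \<sigma> (spec d V (\<lambda>i. - ln (s i)))"
  note R = rel_ent_finite[OF \<sigma> U \<rho>U logr V \<sigma>V logs fin]
  have ab: "a - b < y" using D unfolding R(1) a_def b_def by simp
  \<comment> \<open>Two of the four shares go to the typical sets, the other two absorb the constant
    \<open>c\<close>.\<close>
  define \<delta> where "\<delta> = (y - (a - b)) / 4"
  have \<delta>: "0 < \<delta>" using ab by (simp add: \<delta>_def)
  have ker: "expval \<sigma> (spec d U (\<lambda>i. of_bool (l i = 0))) = 0"
    unfolding expval_spec[OF U densityD(2)[OF \<sigma>]] using R(2) by (intro sum.neutral) auto
  define K where "K = (\<Sum>i<d. \<bar>ln (l i)\<bar> + \<bar>ln (s i)\<bar>)"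
  have K: "\<bar>ln (l i)\<bar> \<le> K" "\<bar>ln (s i)\<bar> \<le> K" if "i < d" for i
  proof -
    have "\<bar>ln (l i)\<bar> + \<bar>ln (s i)\<bar> \<le> K" unfolding K_def
      by (rule member_le_sum[of i "{..<d}" "\<lambda>i. \<bar>ln (l i)\<bar> + \<bar>ln (s i)\<bar>"]) (use that in auto)
    then show "\<bar>ln (l i)\<bar> \<le> K" "\<bar>ln (s i)\<bar> \<le> K" by auto
  qed
  \<comment> \<open>The acceptance probability is at least \<open>4 * c\<close>: half of it is left
    to the vanishing term, and the factor 2 of the main term turns the other half into
    \<open>c\<close>.\<close>
  define c where "c = (1 - \<epsilon>) / 4"
  have c: "0 < c" using \<epsilon> by (simp add: c_def)
  have large: "\<forall>\<^sub>F n in sequentially. x \<le> real n" for x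
    using filterlim_real_sequentially by (simp add: filterlim_at_top)
  show ?thesis
    using large[of 2] large[of "16 * K\<^sup>2 / (\<delta>\<^sup>2 * (2 * c))"] large[of "- ln c / (2 * \<delta>)"]
  proof eventually_elim
    case (elim n)
    have n: "2 \<le> n" using elim(1) by simp
    have "16 * K\<^sup>2 \<le> real n * (\<delta>\<^sup>2 * (2 * c))" using elim(2) \<delta> c by (simp add: field_simps)
    then have q: "16 * K\<^sup>2 / (real n * \<delta>\<^sup>2) \<le> 2 * c" using n \<delta> by (simp add: field_simps)
    have "- ln c \<le> real n * (2 * \<delta>)" using elim(3) \<delta> by (simp add: field_simps)
    then have "exp (- (real n * (2 * \<delta>))) \<le> exp (ln c)" by simp
    then have cexp: "exp (- (real n * (2 * \<delta>))) \<le> c" using c by simp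
    show ?case
    proof (rule DH_le)
      note sn = densityD[OF tpow_density[OF \<sigma>, of n]]
      show "tpow \<sigma> n \<in> carrier_mat (d ^ n) (d ^ n)" by (rule sn(2))
      show "0 \<le> \<epsilon>" using \<epsilon> by simp
      fix M assume M: "psd (d ^ n) M" "psd (d ^ n) (1\<^sub>m (d ^ n) - M)" "expval (tpow \<sigma> n) (1\<^sub>m (d ^ n) - M) \<le> \<epsilon>"
      let ?p = "expval (tpow \<rho> n) M"
      have "expval (tpow \<sigma> n) M \<le> 2 * exp (real n * (a - b + 2 * \<delta>)) * ?p + 16 * K\<^sup>2 / (real n * \<delta>\<^sup>2)"
        unfolding \<sigma>V \<rho>U
        by (rule stein_converse[OF U V _ n d \<delta> l0 s0 _ K _ _ M(1,2)]) (use \<sigma> ker in \<open>simp_all add: a_def b_def \<sigma>V\<close>)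
      moreover have "1 - \<epsilon> \<le> expval (tpow \<sigma> n) M"
        using M(3) expval_minus[OF one_carrier_mat psd_carrier[OF M(1)] sn(2)] sn(4) by simp
      ultimately have "c \<le> exp (real n * (a - b + 2 * \<delta>)) * ?p" using q by (simp add: c_def)
      then have "exp (- (real n * (2 * \<delta>))) \<le> exp (real n * (a - b + 2 * \<delta>)) * ?p" using cexp by simp
      then have "exp (- (real n * (2 * \<delta>))) * exp (- (real n * (a - b + 2 * \<delta>)))
          \<le> exp (real n * (a - b + 2 * \<delta>)) * ?p * exp (- (real n * (a - b + 2 * \<delta>)))" by (rule mult_right_mono) simp
      also have "\<dots> = ?p"
      proof -
        have "exp x * q * exp (- x) = q * (exp x * exp (- x))" for x q :: real by (simp only: mult_ac)
        then show ?thesis by (simp only: exp_minus_inverse mult_1_right)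
      qed
      also have "exp (- (real n * (2 * \<delta>))) * exp (- (real n * (a - b + 2 * \<delta>))) = exp (- (real n * y))"
        unfolding exp_add[symmetric] by (simp add: \<delta>_def algebra_simps)
      finally show "exp (- (real n * y)) \<le> ?p" .
    qed
  qed
qed

text \<open>Both bounds compare with reals strictly below or strictly above the infimum, so an
  infinite value needs no separate treatment.\<close>

theorem mainTheorem5:
  fixes d :: nat and F :: "nat \<Rightarrow> complex mat set" and r :: "nat \<Rightarrow> real"
  assumes states: "\<forall>n\<ge>1. F n \<subseteq> density (d ^ n)"
    and convex: "\<forall>n\<ge>1. convex_set (F n)"
    and closed: "\<forall>n\<ge>1. closed_set (d ^ n) (F n)"
    and full: "\<exists>\<sigma>\<in>F 1. full_rank d \<sigma>"
    and ptr: "\<forall>n\<ge>1. \<forall>\<sigma>\<in>F (n + 1). ptrace_last (d ^ n) d \<sigma> \<in> F n"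
    and tens: "\<forall>n\<ge>1. \<forall>m\<ge>1. \<forall>\<sigma>\<in>F n. \<forall>\<sigma>'\<in>F m. kron \<sigma> \<sigma>' \<in> F (n + m)"
    and perm: "\<forall>n\<ge>1. \<forall>\<pi>. \<pi> permutes {..<n} \<longrightarrow>
                 (\<forall>\<sigma>\<in>F n. perm_unitary d n \<pi> * \<sigma> * adj (perm_unitary d n \<pi>) \<in> F n)"
    and r_range: "\<forall>n\<ge>1. 0 < r n \<and> r n \<le> 1"
    and compat: "\<forall>n\<ge>1. \<forall>m\<ge>1. \<forall>X. hermitian (d ^ n) X \<and> opnorm X \<le> r n \<longrightarrow>
                 (\<forall>s\<in>{1, -1::real}. \<forall>\<sigma>\<in>F (n + m).
                    ptrace_first (d ^ n) (d ^ m)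
                      (kron ((1/2) \<cdot>\<^sub>m (1\<^sub>m (d ^ n) + complex_of_real s \<cdot>\<^sub>m X)) (1\<^sub>m (d ^ m)) * \<sigma>)
                    \<in> cone (F m))"
  shows "\<forall>\<rho>\<in>density d.
           (\<forall>\<epsilon>. 0 < \<epsilon> \<and> \<epsilon> < 1 \<longrightarrow>
              ((\<lambda>n. DH_set (d ^ n) \<epsilon> (F n) (tpow \<rho> n) / ereal (real n))
                 \<longlongrightarrow> (INF \<sigma>\<in>F 1. rel_ent d \<sigma> \<rho>)) sequentially)
         \<and> ((\<lambda>\<epsilon>. liminf (\<lambda>n. DH_set (d ^ n) \<epsilon> (F n) (tpow \<rho> n) / ereal (real n)))
              \<longlongrightarrow> (INF \<sigma>\<in>F 1. rel_ent d \<sigma> \<rho>)) (at_right 0)"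
proof (intro ballI)
  fix \<rho> assume \<rho>: "\<rho> \<in> density d"
  \<comment> \<open>A matrix of size 0 has trace 0, so a density matrix excludes this case.\<close>
  have d: "0 < d"
  proof (rule ccontr)
    assume "\<not> 0 < d"
    then show False using densityD(2,3)[OF \<rho>] by (auto simp: mtrace_def)
  qed
  interpret free_states d F "r 1"
  proof
    show "ptrace_first d (d ^ m) (kron ((1/2) \<cdot>\<^sub>m (1\<^sub>m d + complex_of_real s \<cdot>\<^sub>m X)) (1\<^sub>m (d ^ m)) * \<sigma>) \<in> cone (F m)"
      if "1 \<le> m" "hermitian d X" "opnorm X \<le> r 1" "s \<in> {1, -1}" "\<sigma> \<in> F (Suc m)" for m X s \<sigma>
      using compat[rule_format, of 1 m X s \<sigma>] that by simp
  qed (use states convex ptr perm r_range d in auto)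
  let ?L = "INF \<sigma>\<in>F 1. rel_ent d \<sigma> \<rho>"
  let ?f = "\<lambda>\<epsilon> n. DH_set (d ^ n) \<epsilon> (F n) (tpow \<rho> n)"
  have F1: "F 1 \<subseteq> density d" using states[rule_format, of 1] by simp
  have power_free: "tpow \<sigma> n \<in> F n" if "\<sigma> \<in> F 1" "1 \<le> n" for \<sigma> n
    using that(2)
  proof (induction n rule: nat_induct_at_least)
    case base
    then show ?case using that(1) by (simp add: kron_one_left[simplified])
  next
    case (Suc n)
    then show ?case using tens[rule_format, of n 1 "tpow \<sigma> n" \<sigma>] that(1) by simp
  qed
  have lim: "((\<lambda>n. ?f \<epsilon> n / ereal (real n)) \<longlongrightarrow> ?L) sequentially" if \<epsilon>: "0 < \<epsilon>" "\<epsilon> < 1" for \<epsilon>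
  proof (rule order_tendstoI)
    fix a assume "a < ?L"
    then obtain t where t: "a < ereal t" "ereal t < ?L" using ereal_dense2 by blast
    \<comment> \<open>A second real below the limit: the gap between \<open>t\<close> and
      \<open>t1\<close> is the slack consumed in \<open>uniform_test\<close>.\<close>
    obtain t1 where t1: "ereal t < ereal t1" "ereal t1 < ?L" using ereal_dense2[OF t(2)] by blast
    define t0 where "t0 = max t 0"
    have "\<exists>N. \<forall>n\<ge>N. \<forall>\<sigma>\<in>F n. \<exists>M. psd (d ^ n) M \<and> psd (d ^ n) (1\<^sub>m (d ^ n) - M) \<and>
       expval \<sigma> (1\<^sub>m (d ^ n) - M) \<le> \<epsilon> \<and> expval (tpow \<rho> n) M \<le> exp (- (real n * t))"
    proof (cases "0 \<le> t")
      case True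
      have "\<forall>\<omega>\<in>F 1. ereal t1 < rel_ent d \<omega> \<rho>" using t1(2) INF_lower less_le_trans by (metis (no_types, lifting))
      moreover have "closed_set d (F 1)" using closed[rule_format, of 1] by simp
      ultimately show ?thesis using uniform_test[OF _ \<rho> \<epsilon>(1) True, of t1] t1(1) by simp
    next
      \<comment> \<open>For negative \<open>t\<close> the test that always accepts is enough, since
        its weight 1 is at most \<open>exp (- (real n * t))\<close>.\<close>
      case False
      have "psd (d ^ n) (1\<^sub>m (d ^ n)) \<and> psd (d ^ n) (1\<^sub>m (d ^ n) - 1\<^sub>m (d ^ n)) \<and>
       expval \<sigma> (1\<^sub>m (d ^ n) - 1\<^sub>m (d ^ n)) \<le> \<epsilon> \<and> expval (tpow \<rho> n) (1\<^sub>m (d ^ n)) \<le> exp (- (real n * t))"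
        if "1 \<le> n" "\<sigma> \<in> F n" for n \<sigma>
      proof -
        have z: "1\<^sub>m (d ^ n) - 1\<^sub>m (d ^ n) = (0\<^sub>m (d ^ n) (d ^ n) :: complex mat)" by (rule eq_matI) auto
        have "expval \<sigma> (0\<^sub>m (d ^ n) (d ^ n)) = 0"
          using densityD(2)[OF free_density[OF that]] by (simp add: expval_def mtrace_def)
        moreover have "1 \<le> exp (- (real n * t))" using False by (simp add: mult_nonneg_nonpos)
        ultimately show ?thesis
          unfolding z using psd_one psd_zero \<epsilon> densityD(4)[OF tpow_density[OF \<rho>, of n]] by simp
      qed
      then show ?thesis by blast
    qed
    then obtain N where N: "\<And>n \<sigma>. N \<le> n \<Longrightarrow> \<sigma> \<in> F n \<Longrightarrow> \<exists>M. psd (d ^ n) M \<and> psd (d ^ n) (1\<^sub>m (d ^ n) - M) \<and>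
       expval \<sigma> (1\<^sub>m (d ^ n) - M) \<le> \<epsilon> \<and> expval (tpow \<rho> n) M \<le> exp (- (real n * t))" by blast
    show "\<forall>\<^sub>F n in sequentially. a < ?f \<epsilon> n / ereal (real n)"
      using eventually_ge_at_top[of "max N 1"]
    proof eventually_elim
      case (elim n)
      have "ereal (real n * t) \<le> ?f \<epsilon> n"
        unfolding DH_set_def
      proof (rule INF_greatest)
        fix \<sigma> assume "\<sigma> \<in> F n"
        then show "ereal (real n * t) \<le> DH (d ^ n) \<epsilon> \<sigma> (tpow \<rho> n)"
          using N[of n \<sigma>] elim DH_ge[OF _ _ _ _ densityD(1)[OF tpow_density[OF \<rho>]]] by auto
      qed
      then have "ereal (real n * t) / ereal (real n) \<le> ?f \<epsilon> n / ereal (real n)"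
        using elim by (intro ereal_divide_right_mono) auto
      moreover have "ereal (real n * t) / ereal (real n) = ereal t" using elim by simp
      ultimately show ?case using t(1) less_le_trans by metis
    qed
  next
    fix a assume "?L < a"
    then obtain \<sigma> where \<sigma>: "\<sigma> \<in> F 1" "rel_ent d \<sigma> \<rho> < a" by (auto simp: INF_less_iff)
    obtain y where y: "rel_ent d \<sigma> \<rho> < ereal y" "ereal y < a" using ereal_dense2[OF \<sigma>(2)] by blast
    have sd: "\<sigma> \<in> density d" using \<sigma>(1) F1 by blast
    show "\<forall>\<^sub>F n in sequentially. ?f \<epsilon> n / ereal (real n) < a"
      using DH_iid_upper[OF sd \<rho> d \<epsilon> y(1)] eventually_ge_at_top[of 1]
    proof eventually_elim
      case (elim n)
      have "?f \<epsilon> n \<le> DH (d ^ n) \<epsilon> (tpow \<sigma> n) (tpow \<rho> n)"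
        unfolding DH_set_def by (rule INF_lower[OF power_free[OF \<sigma>(1) elim(2)]])
      then have "?f \<epsilon> n / ereal (real n) \<le> ereal (real n * y) / ereal (real n)"
        using elim by (intro ereal_divide_right_mono) auto
      moreover have "ereal (real n * y) / ereal (real n) = ereal y" using elim by simp
      ultimately show ?case using y(2) le_less_trans by metis
    qed
  qed
  \<comment> \<open>By the first claim the liminf equals the same limit for each
    \<open>\<epsilon>\<close> in the open unit interval, so as a function of
    \<open>\<epsilon>\<close> it is constant near 0.\<close>
  have "\<forall>\<^sub>F \<epsilon> in at_right (0::real). \<epsilon> < 1" by (intro order_tendstoD(2)[OF tendsto_ident_at]) simp
  moreover have "\<forall>\<^sub>F \<epsilon> in at_right (0::real). 0 < \<epsilon>" by (simp add: eventually_at_right_less)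
  ultimately have "\<forall>\<^sub>F \<epsilon> in at_right 0. liminf (\<lambda>n. ?f \<epsilon> n / ereal (real n)) = ?L"
    by eventually_elim (intro lim_imp_Liminf lim, auto)
  then have "((\<lambda>\<epsilon>. liminf (\<lambda>n. ?f \<epsilon> n / ereal (real n))) \<longlongrightarrow> ?L) (at_right 0)"
    by (rule tendsto_eventually)
  then show "(\<forall>\<epsilon>. 0 < \<epsilon> \<and> \<epsilon> < 1 \<longrightarrow> ((\<lambda>n. ?f \<epsilon> n / ereal (real n)) \<longlongrightarrow> ?L) sequentially)
      \<and> ((\<lambda>\<epsilon>. liminf (\<lambda>n. ?f \<epsilon> n / ereal (real n))) \<longlongrightarrow> ?L) (at_right 0)"
    using lim by blast
qed

end
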